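(* Let $0=t_0<t_1<\dots<t_N=T$ be a partition of $[0,T]$ with time steps $k_n:=t_n-t_{n-1}$. Let $f^1,\dots,f^N\in L^2(\Omega)$ and $u_h^0\in L^2(\Omega)$ be given, and for each $n=1,\dots,N$ let $U_h^n\subseteq U$ be a closed subspace. Then for all $n=1,\dots,N$ the problem of finding $\mathbf{u}_h^n=(u_h^n,\boldsymbol\sigma_h^n)\in U_h^n$ such that $$B_{k_n}(\mathbf{u}_h^n,\mathbf{v}_h)=F_n(\mathbf{v}_h;f^n,u_h^{n-1})\quad\text{for all }\mathbf{v}_h\in U_h^n$$ (where $u_h^{n-1}$ is the first component of the solution of the previous step) admits a unique solution $\mathbf{u}_h^n\in U_h^n$.
   Context: $\Omega\subset\mathbb{R}^d$ is a bounded Lipschitz domain with polygonal boundary; $(\cdot,\cdot)$ and $\|\cdot\|$ denote the $L^2(\Omega)$ inner product and norm. The coefficients satisfy $\mathbf{A}\in L^\infty(\Omega)^{d\times d}$ symmetric with $\lambda_{\min}(\mathbf{A})\ge\alpha_0>0$ a.e., $\boldsymbol\beta\in L^\infty(\Omega)^d$, $\gamma\in L^\infty(\Omega)$, and $\tfrac12\operatorname{div}\boldsymbol\beta+\gamma\in L^\infty(\Omega)$ with $\tfrac12\operatorname{div}\boldsymbol\beta+\gamma\ge0$ a.e. Let $U:=H^1_0(\Omega)\times H(\operatorname{div},\Omega)$. For $k>0$ and $\mathbf{u}=(u,\boldsymbol\sigma),\mathbf{v}=(v,\boldsymbol\tau)\in U$ define $\tilde b_k(\mathbf u,\mathbf v):=(-\operatorname{div}\boldsymbol\sigma-\boldsymbol\beta\cdot\nabla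 u+\gamma u,v)+k(-\operatorname{div}\boldsymbol\sigma-\boldsymbol\beta\cdot\nabla u+\gamma u,-\operatorname{div}\boldsymbol\tau-\boldsymbol\beta\cdot\nabla v+\gamma v)+(\mathbf A^{1/2}\nabla u-\mathbf A^{-1/2}\boldsymbol\sigma,\mathbf A^{1/2}\nabla v-\mathbf A^{-1/2}\boldsymbol\tau)$, $b_k(\mathbf u,\mathbf v):=(u,-\operatorname{div}\boldsymbol\tau-\boldsymbol\beta\cdot\nabla v+\gamma v)+\tilde b_k(\mathbf u,\mathbf v)$, and $B_k(\mathbf u,\mathbf v):=\frac1k(u,v)+b_k(\mathbf u,\mathbf v)$. For $g,w\in L^2(\Omega)$ let $F_n(\mathbf v;g,w):=k_n\big(g+\tfrac{w}{k_n},\tfrac{v}{k_n}-\operatorname{div}\boldsymbol\tau-\boldsymbol\beta\cdot\nabla v+\gamma v\big)$. *)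

theory Defs
  imports "HOL-Analysis.Analysis"
begin

definition lipschitz_domain :: "(real^'d) set \<Rightarrow> bool" where
  "lipschitz_domain \<Omega> \<longleftrightarrow> open \<Omega> \<and> connected \<Omega> \<and> \<Omega> \<noteq> {} \<and>
     (\<forall>p \<in> frontier \<Omega>. \<exists>V e g C. open V \<and> p \<in> V \<and> norm e = 1 \<and>
        C-lipschitz_on {y. inner e y = 0} g \<and>
        \<Omega> \<inter> V = {x \<in> V. inner e x < g (x - inner e x *\<^sub>R e)})"

definition polygonal_boundary :: "(real^'d) set \<Rightarrow> bool" where
  "polygonal_boundary \<Omega> \<longleftrightarrow> (\<exists>H :: ((real^'d) \<times> real) set. finite H \<and>
     (\<forall>(a,b) \<in> H. a \<noteq> 0) \<and> frontier \<Omega> \<subseteq> (\<Union>(a,b) \<in> H. {x. inner a x = b}))"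

definition pd :: "'d::finite \<Rightarrow> (real^'d \<Rightarrow> real) \<Rightarrow> real^'d \<Rightarrow> real" where
  "pd i \<phi> x = frechet_derivative \<phi> (at x) (axis i 1)"

definition smooth_fun :: "(real^'d::finite \<Rightarrow> real) \<Rightarrow> bool" where
  "smooth_fun \<phi> \<longleftrightarrow> (\<forall>is :: 'd list. \<forall>x. (foldr pd is \<phi>) differentiable (at x))"

definition test_fun :: "(real^'d) set \<Rightarrow> (real^'d::finite \<Rightarrow> real) \<Rightarrow> bool" where
  "test_fun \<Omega> \<phi> \<longleftrightarrow> smooth_fun \<phi> \<and> compact (closure {x. \<phi> x \<noteq> 0})
      \<and> closure {x. \<phi> x \<noteq> 0} \<subseteq> \<Omega>"

definition cgrad :: "(real^'d::finite \<Rightarrow> real) \<Rightarrow> real^'d \<Rightarrow> real^'d" where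
  "cgrad \<phi> x = (\<chi> i. pd i \<phi> x)"

definition L2 :: "(real^'d) set \<Rightarrow> (real^'d::finite \<Rightarrow> 'b::euclidean_space) \<Rightarrow> bool" where
  "L2 \<Omega> f \<longleftrightarrow> f \<in> borel_measurable (lebesgue_on \<Omega>) \<and>
     integrable (lebesgue_on \<Omega>) (\<lambda>x. (norm (f x))\<^sup>2)"

definition Linf :: "(real^'d) set \<Rightarrow> (real^'d::finite \<Rightarrow> 'b::euclidean_space) \<Rightarrow> bool" where
  "Linf \<Omega> f \<longleftrightarrow> f \<in> borel_measurable (lebesgue_on \<Omega>) \<and>
     (\<exists>C. AE x in lebesgue_on \<Omega>. norm (f x) \<le> C)"

definition l2ip :: "(real^'d) set \<Rightarrow> (real^'d::finite \<Rightarrow> 'b::euclidean_space) \<Rightarrow> (real^'d \<Rightarrow> 'b) \<Rightarrow> real" where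
  "l2ip \<Omega> u v = (LINT x|lebesgue_on \<Omega>. inner (u x) (v x))"

definition is_weak_grad :: "(real^'d) set \<Rightarrow> (real^'d::finite \<Rightarrow> real) \<Rightarrow> (real^'d \<Rightarrow> real^'d) \<Rightarrow> bool" where
  "is_weak_grad \<Omega> u G \<longleftrightarrow> (\<forall>\<phi>. test_fun \<Omega> \<phi> \<longrightarrow> (\<forall>i.
      (LINT x|lebesgue_on \<Omega>. u x * pd i \<phi> x) = - (LINT x|lebesgue_on \<Omega>. G x $ i * \<phi> x)))"

definition is_weak_div :: "(real^'d) set \<Rightarrow> (real^'d::finite \<Rightarrow> real^'d) \<Rightarrow> (real^'d \<Rightarrow> real) \<Rightarrow> bool" where
  "is_weak_div \<Omega> \<sigma> q \<longleftrightarrow> (\<forall>\<phi>. test_fun \<Omega> \<phi> \<longrightarrow>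
      (LINT x|lebesgue_on \<Omega>. inner (\<sigma> x) (cgrad \<phi> x)) = - (LINT x|lebesgue_on \<Omega>. q x * \<phi> x))"

definition H1 :: "(real^'d) set \<Rightarrow> (real^'d::finite \<Rightarrow> real) \<Rightarrow> bool" where
  "H1 \<Omega> u \<longleftrightarrow> L2 \<Omega> u \<and> (\<exists>G. L2 \<Omega> G \<and> is_weak_grad \<Omega> u G)"

definition wgrad :: "(real^'d) set \<Rightarrow> (real^'d::finite \<Rightarrow> real) \<Rightarrow> real^'d \<Rightarrow> real^'d" where
  "wgrad \<Omega> u = (SOME G. L2 \<Omega> G \<and> is_weak_grad \<Omega> u G)"

definition Hdiv :: "(real^'d) set \<Rightarrow> (real^'d::finite \<Rightarrow> real^'d) \<Rightarrow> bool" where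
  "Hdiv \<Omega> \<sigma> \<longleftrightarrow> L2 \<Omega> \<sigma> \<and> (\<exists>q. L2 \<Omega> q \<and> is_weak_div \<Omega> \<sigma> q)"

definition wdiv :: "(real^'d) set \<Rightarrow> (real^'d::finite \<Rightarrow> real^'d) \<Rightarrow> real^'d \<Rightarrow> real" where
  "wdiv \<Omega> \<sigma> = (SOME q. L2 \<Omega> q \<and> is_weak_div \<Omega> \<sigma> q)"

definition H1_norm :: "(real^'d) set \<Rightarrow> (real^'d::finite \<Rightarrow> real) \<Rightarrow> real" where
  "H1_norm \<Omega> u = sqrt (l2ip \<Omega> u u + l2ip \<Omega> (wgrad \<Omega> u) (wgrad \<Omega> u))"

definition H10 :: "(real^'d) set \<Rightarrow> (real^'d::finite \<Rightarrow> real) \<Rightarrow> bool" where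
  "H10 \<Omega> u \<longleftrightarrow> H1 \<Omega> u \<and> (\<exists>\<phi>s. (\<forall>j. test_fun \<Omega> (\<phi>s j)) \<and>
      (\<lambda>j. H1_norm \<Omega> (\<lambda>x. u x - \<phi>s j x)) \<longlonglongrightarrow> 0)"

type_synonym 'd Uelem = "(real^'d \<Rightarrow> real) \<times> (real^'d \<Rightarrow> real^'d)"

definition U_space :: "(real^'d) set \<Rightarrow> ('d::finite) Uelem set" where
  "U_space \<Omega> = {(u, \<sigma>). H10 \<Omega> u \<and> Hdiv \<Omega> \<sigma>}"

definition U_norm :: "(real^'d) set \<Rightarrow> ('d::finite) Uelem \<Rightarrow> real" where
  "U_norm \<Omega> w = sqrt (l2ip \<Omega> (fst w) (fst w) + l2ip \<Omega> (wgrad \<Omega> (fst w)) (wgrad \<Omega> (fst w))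
      + l2ip \<Omega> (snd w) (snd w) + l2ip \<Omega> (wdiv \<Omega> (snd w)) (wdiv \<Omega> (snd w)))"

definition U_diff :: "('d::finite) Uelem \<Rightarrow> 'd Uelem \<Rightarrow> 'd Uelem" where
  "U_diff v w = ((\<lambda>x. fst v x - fst w x), (\<lambda>x. snd v x - snd w x))"

definition closed_subspace_U :: "(real^'d) set \<Rightarrow> ('d::finite) Uelem set \<Rightarrow> bool" where
  "closed_subspace_U \<Omega> V \<longleftrightarrow> V \<subseteq> U_space \<Omega> \<and> ((\<lambda>x. 0), (\<lambda>x. 0)) \<in> V \<and>
     (\<forall>v\<in>V. \<forall>w\<in>V. ((\<lambda>x. fst v x + fst w x), (\<lambda>x. snd v x + snd w x)) \<in> V) \<and>
     (\<forall>c::real. \<forall>v\<in>V. ((\<lambda>x. c * fst v x), (\<lambda>x. c *\<^sub>R snd v x)) \<in> V) \<and>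
     (\<forall>vs w. (\<forall>j. vs j \<in> V) \<and> w \<in> U_space \<Omega> \<and> (\<lambda>j. U_norm \<Omega> (U_diff (vs j) w)) \<longlonglongrightarrow> 0
        \<longrightarrow> w \<in> V)"

definition U_eq :: "(real^'d) set \<Rightarrow> ('d::finite) Uelem \<Rightarrow> 'd Uelem \<Rightarrow> bool" where
  "U_eq \<Omega> v w \<longleftrightarrow> (AE x in lebesgue_on \<Omega>. fst v x = fst w x \<and> snd v x = snd w x)"

definition mat_eigenvalues :: "real^'d^'d \<Rightarrow> real set" where
  "mat_eigenvalues M = {c. \<exists>v. v \<noteq> 0 \<and> M *v v = c *\<^sub>R v}"

definition mat_sqrt :: "real^'d^'d \<Rightarrow> real^'d^'d" where
  "mat_sqrt M = (THE S. transpose S = S \<and> (\<forall>c \<in> mat_eigenvalues S. c > 0) \<and> S ** S = M)"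

definition Lop :: "(real^'d) set \<Rightarrow> (real^'d \<Rightarrow> real^'d) \<Rightarrow> (real^'d \<Rightarrow> real) \<Rightarrow> ('d::finite) Uelem \<Rightarrow> real^'d \<Rightarrow> real" where
  "Lop \<Omega> \<beta> \<gamma> w = (\<lambda>x. - wdiv \<Omega> (snd w) x - inner (\<beta> x) (wgrad \<Omega> (fst w) x) + \<gamma> x * fst w x)"

definition flux :: "(real^'d) set \<Rightarrow> (real^'d \<Rightarrow> real^'d^'d) \<Rightarrow> ('d::finite) Uelem \<Rightarrow> real^'d \<Rightarrow> real^'d" where
  "flux \<Omega> A w = (\<lambda>x. mat_sqrt (A x) *v wgrad \<Omega> (fst w) x - matrix_inv (mat_sqrt (A x)) *v snd w x)"

definition b_tilde :: "(real^'d) set \<Rightarrow> (real^'d \<Rightarrow> real^'d^'d) \<Rightarrow> (real^'d \<Rightarrow> real^'d) \<Rightarrow> (real^'d \<Rightarrow> real)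
    \<Rightarrow> real \<Rightarrow> ('d::finite) Uelem \<Rightarrow> 'd Uelem \<Rightarrow> real" where
  "b_tilde \<Omega> A \<beta> \<gamma> k w v = l2ip \<Omega> (Lop \<Omega> \<beta> \<gamma> w) (fst v)
      + k * l2ip \<Omega> (Lop \<Omega> \<beta> \<gamma> w) (Lop \<Omega> \<beta> \<gamma> v) + l2ip \<Omega> (flux \<Omega> A w) (flux \<Omega> A v)"

definition b_form :: "(real^'d) set \<Rightarrow> (real^'d \<Rightarrow> real^'d^'d) \<Rightarrow> (real^'d \<Rightarrow> real^'d) \<Rightarrow> (real^'d \<Rightarrow> real)
    \<Rightarrow> real \<Rightarrow> ('d::finite) Uelem \<Rightarrow> 'd Uelem \<Rightarrow> real" where
  "b_form \<Omega> A \<beta> \<gamma> k w v = l2ip \<Omega> (fst w) (Lop \<Omega> \<beta> \<gamma> v) + b_tilde \<Omega> A \<beta> \<gamma> k w v"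

definition B_form :: "(real^'d) set \<Rightarrow> (real^'d \<Rightarrow> real^'d^'d) \<Rightarrow> (real^'d \<Rightarrow> real^'d) \<Rightarrow> (real^'d \<Rightarrow> real)
    \<Rightarrow> real \<Rightarrow> ('d::finite) Uelem \<Rightarrow> 'd Uelem \<Rightarrow> real" where
  "B_form \<Omega> A \<beta> \<gamma> k w v = (1 / k) * l2ip \<Omega> (fst w) (fst v) + b_form \<Omega> A \<beta> \<gamma> k w v"

definition F_form :: "(real^'d) set \<Rightarrow> (real^'d \<Rightarrow> real^'d) \<Rightarrow> (real^'d \<Rightarrow> real)
    \<Rightarrow> real \<Rightarrow> ('d::finite) Uelem \<Rightarrow> (real^'d \<Rightarrow> real) \<Rightarrow> (real^'d \<Rightarrow> real) \<Rightarrow> real" where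
  "F_form \<Omega> \<beta> \<gamma> k v g w = k * l2ip \<Omega> (\<lambda>x. g x + w x / k) (\<lambda>x. fst v x / k + Lop \<Omega> \<beta> \<gamma> v x)"

end

theory Submission
  imports Defs "HOL-Library.Function_Algebras" "HOL-Computational_Algebra.Polynomial"
begin

text \<open>
  Completing the square gives
  \<open>B\<^sub>k(u, v) = k (u/k + L u, v/k + L v) + (flux u, flux v)\<close> with \<open>L u = - div \<sigma> - \<beta> \<cdot> \<nabla>u + \<gamma> u\<close>.
  So \<open>B\<^sub>k\<close> is the semi-inner product that the residual map \<open>R\<close> pulls back from \<open>L\<^sup>2\<close>, and each time
  step is a Riesz representation problem in \<open>U\<^sub>h\<close>. Completeness of \<open>U\<^sub>h\<close> for this seminorm follows
  from its equivalence with the norm of \<open>U\<close>: testing \<open>u/k + L u\<close> with \<open>u \<in> H\<^sup>1\<^sub>0\<close> and using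
  \<open>-(\<beta> \<cdot> \<nabla>u, u) = (div \<beta> u, u)/2\<close> bounds \<open>\<parallel>u\<parallel>\<^sup>2/k + \<parallel>A\<^sup>1\<^sup>/\<^sup>2\<nabla>u\<parallel>\<^sup>2\<close> by the residual, and then
  \<open>\<sigma>\<close> and \<open>div \<sigma>\<close> are recovered from it.
\<close>

section \<open>Semi-inner product spaces\<close>

lemma nonneg_quadratic_imp_discriminant_le:
  fixes a b c :: real
  assumes b: "0 \<le> b" and nonneg: "\<And>s. 0 \<le> a + 2 * s * c + s\<^sup>2 * b"
  shows "c\<^sup>2 \<le> a * b"
proof (cases "b = 0")
  case True
  have "c = 0"
    using nonneg[of "- (a + 1) / (2 * c)"] True by (cases "c = 0") (simp_all add: field_simps)
  then show ?thesis by (simp add: True)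
next
  case False
  then have "0 < b" using b by simp
  have "0 \<le> a - c\<^sup>2 / b"
    using nonneg[of "- c / b"] False by (simp add: field_simps power2_eq_square)
  then show ?thesis using \<open>0 < b\<close> by (simp add: field_simps)
qed

definition induced_norm :: "('a \<Rightarrow> 'a \<Rightarrow> real) \<Rightarrow> 'a \<Rightarrow> real" where
  "induced_norm ip u = sqrt (ip u u)"

definition Cauchy_wrt :: "('a::minus \<Rightarrow> real) \<Rightarrow> (nat \<Rightarrow> 'a) \<Rightarrow> bool" where
  "Cauchy_wrt p X \<longleftrightarrow> (\<forall>e>0. \<exists>N. \<forall>m\<ge>N. \<forall>n\<ge>N. p (X m - X n) < e)"

definition complete_wrt :: "('a::minus \<Rightarrow> real) \<Rightarrow> 'a set \<Rightarrow> bool" where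
  "complete_wrt p S \<longleftrightarrow>
    (\<forall>X. (\<forall>n. X n \<in> S) \<longrightarrow> Cauchy_wrt p X \<longrightarrow> (\<exists>x\<in>S. (\<lambda>n. p (X n - x)) \<longlonglongrightarrow> 0))"

lemma Cauchy_wrt_mono:
  assumes "Cauchy_wrt p X" "\<And>m n. q (Y m - Y n) \<le> C * p (X m - X n)" "0 < C"
  shows "Cauchy_wrt q Y"
  unfolding Cauchy_wrt_def
proof (intro allI impI)
  fix e :: real assume "0 < e"
  then obtain N where N: "\<And>m n. m \<ge> N \<Longrightarrow> n \<ge> N \<Longrightarrow> p (X m - X n) < e / C"
    using assms(1,3) unfolding Cauchy_wrt_def by (metis divide_pos_pos)
  have "q (Y m - Y n) < e" if "m \<ge> N" "n \<ge> N" for m n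
    using assms(2)[of m n] N[OF that] assms(3) by (simp add: field_simps)
  then show "\<exists>N. \<forall>m\<ge>N. \<forall>n\<ge>N. q (Y m - Y n) < e" by blast
qed

lemma Cauchy_wrt_imp_fast_subsequence:
  assumes "Cauchy_wrt p X"
  obtains r :: "nat \<Rightarrow> nat" where "strict_mono r"
    "\<And>j m n. r j \<le> m \<Longrightarrow> r j \<le> n \<Longrightarrow> p (X m - X n) < (1/2) ^ j"
proof -
  have "\<exists>N. \<forall>m\<ge>N. \<forall>n\<ge>N. p (X m - X n) < (1/2) ^ j" for j :: nat
    using assms by (simp add: Cauchy_wrt_def)
  then obtain N where N: "\<And>j m n. N j \<le> m \<Longrightarrow> N j \<le> n \<Longrightarrow> p (X m - X n) < (1/2) ^ j"
    by metis
  have "\<exists>r. \<forall>j. N j \<le> r j \<and> r j < r (Suc j)"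
  proof (rule dependent_nat_choice)
    show "\<exists>n. N (Suc j) \<le> n \<and> k < n" for j k
      by (intro exI[of _ "N (Suc j) + Suc k"]) simp
  qed auto
  then obtain r where r: "\<And>j. N j \<le> r j" "\<And>j. r j < r (Suc j)" by blast
  show thesis
    using r by (intro that[of r] N) (auto simp: strict_mono_Suc_iff intro: order_trans)
qed

lemma tendsto_0_le_bound:
  fixes f b :: "nat \<Rightarrow> real"
  assumes "b \<longlonglongrightarrow> 0" "\<And>n. 0 \<le> f n" "\<And>n. f n \<le> b n"
  shows "f \<longlonglongrightarrow> 0"
  by (rule tendsto_sandwich[OF _ _ tendsto_const assms(1)]) (simp_all add: assms)

lemma complete_wrt_equivalent:
  assumes complete: "complete_wrt p S" and pos: "0 < C" "\<And>u v. u \<in> S \<Longrightarrow> v \<in> S \<Longrightarrow> 0 \<le> q (u - v)"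
    and le: "\<And>u v. u \<in> S \<Longrightarrow> v \<in> S \<Longrightarrow> p (u - v) \<le> C * q (u - v)"
      "\<And>u v. u \<in> S \<Longrightarrow> v \<in> S \<Longrightarrow> q (u - v) \<le> C' * p (u - v)"
  shows "complete_wrt q S"
  unfolding complete_wrt_def
proof (intro allI impI)
  fix X assume "\<forall>n. X n \<in> S" and Cauchy: "Cauchy_wrt q X"
  then have X: "\<And>n. X n \<in> S" by blast
  have "Cauchy_wrt p X" by (rule Cauchy_wrt_mono[OF Cauchy le(1)[OF X X] pos(1)])
  then obtain x where x: "x \<in> S" "(\<lambda>n. p (X n - x)) \<longlonglongrightarrow> 0"
    using complete X unfolding complete_wrt_def by blast
  have "(\<lambda>n. q (X n - x)) \<longlonglongrightarrow> 0"
    using le(2)[OF X x(1)] pos(2)[OF X x(1)]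
    by (intro tendsto_0_le_bound[OF tendsto_mult_right_zero[OF x(2), of C']])
  then show "\<exists>x\<in>S. (\<lambda>n. q (X n - x)) \<longlonglongrightarrow> 0" using x(1) by blast
qed

lemma tendsto_0_if_eventually_le_powers:
  fixes f :: "nat \<Rightarrow> real"
  assumes "\<bar>c\<bar> < 1" and nonneg: "\<And>j n. r j \<le> n \<Longrightarrow> 0 \<le> f n" and le: "\<And>j n. r j \<le> n \<Longrightarrow> f n \<le> c ^ j"
  shows "f \<longlonglongrightarrow> 0"
proof (rule LIMSEQ_I)
  fix e :: real assume "0 < e"
  then obtain j where "norm (c ^ j - 0) < e"
    using LIMSEQ_D[OF LIMSEQ_power_zero] assms(1) by (metis order_refl real_norm_def)
  then have "norm (f n - 0) < e" if "r j \<le> n" for n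
    using nonneg[OF that] le[OF that] by simp
  then show "\<exists>N. \<forall>n\<ge>N. norm (f n - 0) < e" by blast
qed

locale semi_inner_product_space =
  fixes S :: "'a::real_vector set" and ip :: "'a \<Rightarrow> 'a \<Rightarrow> real"
  assumes subspace: "subspace S"
    and ip_commute: "u \<in> S \<Longrightarrow> v \<in> S \<Longrightarrow> ip u v = ip v u"
    and ip_add_scaleR_left:
      "u \<in> S \<Longrightarrow> v \<in> S \<Longrightarrow> w \<in> S \<Longrightarrow> ip (u + c *\<^sub>R v) w = ip u w + c * ip v w"
    and ip_nonneg: "u \<in> S \<Longrightarrow> 0 \<le> ip u u"
begin

abbreviation seminorm :: "'a \<Rightarrow> real" where
  "seminorm \<equiv> induced_norm ip"

lemmas zero_in = subspace_0[OF subspace]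
lemmas diff_in = subspace_diff[OF subspace]
lemmas in_subspace [intro] = zero_in diff_in subspace_add[OF subspace] subspace_scale[OF subspace]

lemma ip_add_left: "u \<in> S \<Longrightarrow> v \<in> S \<Longrightarrow> w \<in> S \<Longrightarrow> ip (u + v) w = ip u w + ip v w"
  using ip_add_scaleR_left[of u v w 1] by simp

lemma ip_diff_left: "u \<in> S \<Longrightarrow> v \<in> S \<Longrightarrow> w \<in> S \<Longrightarrow> ip (u - v) w = ip u w - ip v w"
  using ip_add_scaleR_left[of u v w "-1"] by simp

lemma ip_zero_left: "w \<in> S \<Longrightarrow> ip 0 w = 0"
  using ip_diff_left[of 0 0 w] zero_in by simp

lemma ip_scaleR_left: "u \<in> S \<Longrightarrow> w \<in> S \<Longrightarrow> ip (c *\<^sub>R u) w = c * ip u w"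
  using ip_add_scaleR_left[of 0 u w c] zero_in by (simp add: ip_zero_left)

lemma ip_add_right: "u \<in> S \<Longrightarrow> v \<in> S \<Longrightarrow> w \<in> S \<Longrightarrow> ip w (u + v) = ip w u + ip w v"
  using ip_add_left[of u v w] by (simp add: ip_commute[of w] in_subspace)

lemma ip_diff_right: "u \<in> S \<Longrightarrow> v \<in> S \<Longrightarrow> w \<in> S \<Longrightarrow> ip w (u - v) = ip w u - ip w v"
  using ip_diff_left[of u v w] by (simp add: ip_commute[of w] in_subspace)

lemma ip_scaleR_right: "u \<in> S \<Longrightarrow> w \<in> S \<Longrightarrow> ip w (c *\<^sub>R u) = c * ip w u"
  using ip_scaleR_left[of u w c] by (simp add: ip_commute[of w] in_subspace)

lemmas ip_linear =
  ip_add_left ip_diff_left ip_scaleR_left ip_add_right ip_diff_right ip_scaleR_right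

lemma seminorm_nonneg: "u \<in> S \<Longrightarrow> 0 \<le> seminorm u"
  by (simp add: induced_norm_def ip_nonneg)

lemma seminorm_square: "u \<in> S \<Longrightarrow> (seminorm u)\<^sup>2 = ip u u"
  by (simp add: induced_norm_def ip_nonneg)

lemma seminorm_zero: "seminorm 0 = 0"
  using zero_in by (simp add: induced_norm_def ip_zero_left)

lemma seminorm_scaleR: "u \<in> S \<Longrightarrow> seminorm (c *\<^sub>R u) = \<bar>c\<bar> * seminorm u"
  by (simp add: induced_norm_def ip_linear in_subspace real_sqrt_mult mult.assoc[symmetric])

lemma seminorm_diff_commute: "u \<in> S \<Longrightarrow> v \<in> S \<Longrightarrow> seminorm (u - v) = seminorm (v - u)"
  using seminorm_scaleR[of "u - v" "-1"] by (simp add: in_subspace)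

lemma ip_self_add: "u \<in> S \<Longrightarrow> v \<in> S \<Longrightarrow> ip (u + v) (u + v) = ip u u + 2 * ip u v + ip v v"
  by (simp add: ip_linear in_subspace ip_commute[of v u])

lemma Cauchy_Schwarz:
  assumes "u \<in> S" "v \<in> S"
  shows "\<bar>ip u v\<bar> \<le> seminorm u * seminorm v"
proof -
  have "0 \<le> ip u u + 2 * s * ip u v + s\<^sup>2 * ip v v" for s
    using ip_nonneg[of "u + s *\<^sub>R v"] assms
    by (simp add: ip_linear in_subspace ip_commute[of v u] power2_eq_square algebra_simps)
  then have "(ip u v)\<^sup>2 \<le> (seminorm u * seminorm v)\<^sup>2"
    using assms ip_nonneg
    by (simp add: power_mult_distrib seminorm_square nonneg_quadratic_imp_discriminant_le)
  then show ?thesis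
    using assms by (simp add: abs_le_square_iff[symmetric] abs_mult seminorm_nonneg)
qed

lemma seminorm_triangle:
  assumes "u \<in> S" "v \<in> S"
  shows "seminorm (u + v) \<le> seminorm u + seminorm v"
proof (rule power2_le_imp_le)
  show "(seminorm (u + v))\<^sup>2 \<le> (seminorm u + seminorm v)\<^sup>2"
    using Cauchy_Schwarz[OF assms] assms
    by (simp add: seminorm_square in_subspace ip_self_add power2_sum)
qed (simp add: assms seminorm_nonneg)

lemma seminorm_triangle_via:
  "u \<in> S \<Longrightarrow> v \<in> S \<Longrightarrow> w \<in> S \<Longrightarrow> seminorm (u - w) \<le> seminorm (u - v) + seminorm (v - w)"
  using seminorm_triangle[of "u - v" "v - w"] by (simp add: in_subspace)

lemma tendsto_ip:
  assumes X: "\<And>n. X n \<in> S" "x \<in> S" "(\<lambda>n. seminorm (X n - x)) \<longlonglongrightarrow> 0"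
    and Y: "\<And>n. Y n \<in> S" "y \<in> S" "(\<lambda>n. seminorm (Y n - y)) \<longlonglongrightarrow> 0"
  shows "(\<lambda>n. ip (X n) (Y n)) \<longlonglongrightarrow> ip x y"
proof -
  let ?dx = "\<lambda>n. seminorm (X n - x)" and ?dy = "\<lambda>n. seminorm (Y n - y)"
  have "(\<lambda>n. ip (X n) (Y n) - ip x y) \<longlonglongrightarrow> 0"
  proof (rule Lim_null_comparison)
    have "\<bar>ip (X n) (Y n) - ip x y\<bar> \<le> ?dx n * ?dy n + ?dx n * seminorm y + seminorm x * ?dy n" for n
    proof -
      have "ip (X n) (Y n) - ip x y = ip (X n - x) (Y n - y) + ip (X n - x) y + ip x (Y n - y)"
        using X Y by (simp add: ip_linear in_subspace)
      then show ?thesis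
        using Cauchy_Schwarz[of "X n - x" "Y n - y"] Cauchy_Schwarz[of "X n - x" y]
          Cauchy_Schwarz[of x "Y n - y"] X Y by (simp add: in_subspace)
    qed
    then show "\<forall>\<^sub>F n in sequentially. norm (ip (X n) (Y n) - ip x y)
        \<le> ?dx n * ?dy n + ?dx n * seminorm y + seminorm x * ?dy n" by simp
    show "(\<lambda>n. ?dx n * ?dy n + ?dx n * seminorm y + seminorm x * ?dy n) \<longlonglongrightarrow> 0"
      using X(3) Y(3) by (auto intro!: tendsto_eq_intros)
  qed
  then show ?thesis by (simp add: LIM_zero_iff)
qed

lemma tendsto_ip_left:
  assumes "\<And>n. X n \<in> S" "x \<in> S" "(\<lambda>n. seminorm (X n - x)) \<longlonglongrightarrow> 0" "y \<in> S"
  shows "(\<lambda>n. ip (X n) y) \<longlonglongrightarrow> ip x y"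
  using assms by (intro tendsto_ip) (simp_all add: seminorm_zero)

lemma tendsto_ip_right:
  assumes "x \<in> S" "\<And>n. Y n \<in> S" "y \<in> S" "(\<lambda>n. seminorm (Y n - y)) \<longlonglongrightarrow> 0"
  shows "(\<lambda>n. ip x (Y n)) \<longlonglongrightarrow> ip x y"
  using assms by (intro tendsto_ip) (simp_all add: seminorm_zero)

definition energy :: "('a \<Rightarrow> real) \<Rightarrow> 'a \<Rightarrow> real" where
  "energy F u = ip u u - 2 * F u"

context
  fixes F :: "'a \<Rightarrow> real" and C :: real
  assumes linear: "\<And>u v c. u \<in> S \<Longrightarrow> v \<in> S \<Longrightarrow> F (u + c *\<^sub>R v) = F u + c * F v"
    and bounded: "\<And>u. u \<in> S \<Longrightarrow> \<bar>F u\<bar> \<le> C * seminorm u"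
begin

lemma bdd_below_energy: "bdd_below (energy F ` S)"
proof (rule bdd_belowI2)
  show "- C\<^sup>2 \<le> energy F v" if "v \<in> S" for v
    using bounded[OF that] zero_le_power2[of "seminorm v - C"]
    by (simp add: energy_def seminorm_square[OF that, symmetric] power2_diff abs_le_iff
        algebra_simps)
qed

lemma energy_parallelogram:
  assumes "u \<in> S" "v \<in> S"
  shows "(seminorm (u - v))\<^sup>2
    = 2 * energy F u + 2 * energy F v - 4 * energy F ((1/2) *\<^sub>R (u + v))"
proof -
  have "F ((1/2) *\<^sub>R (u + v)) = (F u + F v) / 2"
    using linear[of 0 "u + v" "1/2"] linear[of u v 1] linear[of 0 0 "-1"] assms zero_in
    by (simp add: in_subspace)
  then show ?thesis
    using assms
    by (simp add: seminorm_square energy_def ip_linear in_subspace ip_commute[of v u] algebra_simps)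
qed

lemma almost_minimizer_residual:
  assumes "u \<in> S" "v \<in> S" and m: "\<And>w. w \<in> S \<Longrightarrow> m \<le> energy F w"
  shows "(ip u v - F v)\<^sup>2 \<le> (energy F u - m) * ip v v"
proof (rule nonneg_quadratic_imp_discriminant_le)
  show "0 \<le> energy F u - m + 2 * s * (ip u v - F v) + s\<^sup>2 * ip v v" for s
    using m[of "u + s *\<^sub>R v"] assms(1,2)
    by (simp add: energy_def linear ip_linear in_subspace ip_commute[of v u] power2_eq_square
        algebra_simps)
qed (simp add: ip_nonneg assms)

lemma minimizing_sequence_Cauchy:
  assumes X: "\<And>n. X n \<in> S" "\<And>n. energy F (X n) < m + inverse (real (Suc n))"
    and m: "\<And>w. w \<in> S \<Longrightarrow> m \<le> energy F w"
  shows "Cauchy_wrt seminorm X"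
  unfolding Cauchy_wrt_def
proof (intro allI impI)
  fix e :: real assume "0 < e"
  then obtain N where N: "inverse (real (Suc N)) < e\<^sup>2 / 4"
    using reals_Archimedean[of "e\<^sup>2 / 4"] by auto
  have "seminorm (X i - X j) < e" if "N \<le> i" "N \<le> j" for i j
  proof (rule power2_less_imp_less)
    have small: "energy F (X n) < m + e\<^sup>2 / 4" if "N \<le> n" for n
    proof -
      have "inverse (real (Suc n)) \<le> inverse (real (Suc N))"
        using that by (auto intro!: le_imp_inverse_le)
      then show ?thesis using X(2)[of n] N by linarith
    qed
    have "m \<le> energy F ((1/2) *\<^sub>R (X i + X j))" by (intro m in_subspace X)
    then show "(seminorm (X i - X j))\<^sup>2 < e\<^sup>2"
      unfolding energy_parallelogram[OF X(1) X(1)] using small[OF that(1)] small[OF that(2)]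
      by linarith
  qed (use \<open>0 < e\<close> in simp)
  then show "\<exists>N. \<forall>i\<ge>N. \<forall>j\<ge>N. seminorm (X i - X j) < e" by blast
qed

theorem Riesz_representation:
  assumes "complete_wrt seminorm S"
  obtains u where "u \<in> S" "\<And>v. v \<in> S \<Longrightarrow> ip u v = F v"
proof -
  define m where "m = (INF v\<in>S. energy F v)"
  have m: "m \<le> energy F v" if "v \<in> S" for v
    unfolding m_def by (rule cINF_lower[OF bdd_below_energy that])
  have "\<exists>v\<in>S. energy F v < m + inverse (real (Suc n))" for n
    using cINF_less_iff[OF _ bdd_below_energy, of "m + inverse (real (Suc n))"] zero_in
    by (auto simp: m_def)
  then obtain X where X: "\<And>n. X n \<in> S" "\<And>n. energy F (X n) < m + inverse (real (Suc n))"
    by metis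
  obtain u where u: "u \<in> S" "(\<lambda>n. seminorm (X n - u)) \<longlonglongrightarrow> 0"
    using assms minimizing_sequence_Cauchy[OF X m] X(1) unfolding complete_wrt_def by blast
  have "ip u v = F v" if v: "v \<in> S" for v
  proof -
    have "(\<lambda>n. (ip (X n) v - F v)\<^sup>2) \<longlonglongrightarrow> 0"
    proof (rule tendsto_0_le_bound)
      show "(\<lambda>n. inverse (real (Suc n)) * ip v v) \<longlonglongrightarrow> 0"
        by (rule tendsto_mult_left_zero[OF LIMSEQ_inverse_real_of_nat])
      fix n
      have "(ip (X n) v - F v)\<^sup>2 \<le> (energy F (X n) - m) * ip v v"
        by (rule almost_minimizer_residual[OF X(1) v m])
      also have "\<dots> \<le> inverse (real (Suc n)) * ip v v"
        using X(2)[of n] ip_nonneg[OF v] by (intro mult_right_mono) simp_all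
      finally show "(ip (X n) v - F v)\<^sup>2 \<le> inverse (real (Suc n)) * ip v v" .
    qed simp
    moreover have "(\<lambda>n. (ip (X n) v - F v)\<^sup>2) \<longlonglongrightarrow> (ip u v - F v)\<^sup>2"
      by (intro tendsto_intros tendsto_ip_left X u v)
    ultimately have "(ip u v - F v)\<^sup>2 = 0" by (rule LIMSEQ_unique[symmetric])
    then show ?thesis by simp
  qed
  then show thesis using u(1) that by blast
qed

end

end

section \<open>Square-integrable functions\<close>

instantiation "fun" :: (type, real_vector) real_vector
begin

definition "c *\<^sub>R f = (\<lambda>x. c *\<^sub>R f x)"

instance
  by standard (simp_all add: scaleR_fun_def fun_eq_iff scaleR_add_right scaleR_add_left)

end

lemma scaleR_fun_apply [simp]: "(c *\<^sub>R f) x = c *\<^sub>R f x"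
  by (simp add: scaleR_fun_def)

abbreviation l2norm :: "(real^'d) set \<Rightarrow> (real^'d::finite \<Rightarrow> 'b::euclidean_space) \<Rightarrow> real" where
  "l2norm \<Omega> \<equiv> induced_norm (l2ip \<Omega>)"

lemma L2_measurable: "L2 \<Omega> f \<Longrightarrow> f \<in> borel_measurable (lebesgue_on \<Omega>)"
  by (simp add: L2_def)

lemma L2_dominated:
  fixes f :: "real^'d::finite \<Rightarrow> 'b::euclidean_space" and g :: "real^'d \<Rightarrow> 'c::euclidean_space"
  assumes "L2 \<Omega> f" "g \<in> borel_measurable (lebesgue_on \<Omega>)"
    "AE x in lebesgue_on \<Omega>. norm (g x) \<le> C * norm (f x)"
  shows "L2 \<Omega> g"
  unfolding L2_def
proof
  show "integrable (lebesgue_on \<Omega>) (\<lambda>x. (norm (g x))\<^sup>2)"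
  proof (rule Bochner_Integration.integrable_bound)
    show "integrable (lebesgue_on \<Omega>) (\<lambda>x. C\<^sup>2 * (norm (f x))\<^sup>2)"
      using assms by (auto simp: L2_def)
    show "AE x in lebesgue_on \<Omega>. norm ((norm (g x))\<^sup>2) \<le> norm (C\<^sup>2 * (norm (f x))\<^sup>2)"
      using assms(3)
    proof eventually_elim
      case (elim x)
      then have "(norm (g x))\<^sup>2 \<le> (C * norm (f x))\<^sup>2" by (intro power_mono) auto
      then show ?case by (simp add: power_mult_distrib)
    qed
  qed (use assms in measurable)
qed (fact assms)

lemma L2_integrable_inner:
  assumes "L2 \<Omega> f" "L2 \<Omega> g"
  shows "integrable (lebesgue_on \<Omega>) (\<lambda>x. f x \<bullet> g x)"
proof (rule Bochner_Integration.integrable_bound)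
  show "integrable (lebesgue_on \<Omega>) (\<lambda>x. (norm (f x))\<^sup>2 + (norm (g x))\<^sup>2)"
    using assms by (auto simp: L2_def)
  show "(\<lambda>x. f x \<bullet> g x) \<in> borel_measurable (lebesgue_on \<Omega>)"
    using assms by (auto simp: L2_def)
  have "norm (f x \<bullet> g x) \<le> (norm (f x))\<^sup>2 + (norm (g x))\<^sup>2" for x
    using sum_squares_bound[of "norm (f x)" "norm (g x)"] Cauchy_Schwarz_ineq2[of "f x" "g x"]
      mult_nonneg_nonneg[OF norm_ge_zero norm_ge_zero, of "f x" "g x"]
    unfolding real_norm_def by linarith
  then show "AE x in lebesgue_on \<Omega>. norm (f x \<bullet> g x) \<le> norm ((norm (f x))\<^sup>2 + (norm (g x))\<^sup>2)"
    by (auto intro!: AE_I2 order_trans[OF _ abs_ge_self])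
qed

lemma L2_zero: "L2 \<Omega> 0"
  by (simp add: L2_def zero_fun_def)

lemma L2_scaleR: "L2 \<Omega> f \<Longrightarrow> L2 \<Omega> (c *\<^sub>R f)"
  by (rule L2_dominated[where C = "\<bar>c\<bar>"]) (auto simp: L2_def scaleR_fun_def)

lemma L2_add:
  assumes "L2 \<Omega> f" "L2 \<Omega> g"
  shows "L2 \<Omega> (f + g)"
  unfolding L2_def
proof
  have "(norm ((f + g) x))\<^sup>2 = (norm (f x))\<^sup>2 + 2 * (f x \<bullet> g x) + (norm (g x))\<^sup>2" for x
    by (simp add: power2_norm_eq_inner inner_add inner_commute)
  then show "integrable (lebesgue_on \<Omega>) (\<lambda>x. (norm ((f + g) x))\<^sup>2)"
    using assms L2_integrable_inner[OF assms] by (auto simp: L2_def)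
  show "f + g \<in> borel_measurable (lebesgue_on \<Omega>)"
    using assms unfolding plus_fun_def by (auto simp: L2_def)
qed

lemma subspace_L2: "subspace {f. L2 \<Omega> f}"
  by (simp add: subspace_def L2_zero L2_add L2_scaleR)

lemma L2_diff: "L2 \<Omega> f \<Longrightarrow> L2 \<Omega> g \<Longrightarrow> L2 \<Omega> (f - g)"
  using subspace_diff[OF subspace_L2] by simp

lemma L2_Pair: "L2 \<Omega> f \<Longrightarrow> L2 \<Omega> g \<Longrightarrow> L2 \<Omega> (\<lambda>x. (f x, g x))"
  by (auto simp: L2_def norm_Pair)

lemma L2_bounded_linear:
  assumes "bounded_linear h" "L2 \<Omega> f"
  shows "L2 \<Omega> (\<lambda>x. h (f x))"
proof -
  obtain K where K: "\<And>y. norm (h y) \<le> norm y * K"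
    using bounded_linear.bounded[OF assms(1)] by blast
  have "h \<in> borel_measurable borel"
    using assms(1) by (intro borel_measurable_continuous_onI linear_continuous_on)
  then have "(\<lambda>x. h (f x)) \<in> borel_measurable (lebesgue_on \<Omega>)"
    by (rule measurable_compose[OF L2_measurable[OF assms(2)]])
  then show ?thesis
    using K by (intro L2_dominated[OF assms(2), of _ K]) (auto simp: mult.commute)
qed

lemmas L2_fst = L2_bounded_linear[OF bounded_linear_fst]
  and L2_snd = L2_bounded_linear[OF bounded_linear_snd]
  and L2_component = L2_bounded_linear[OF bounded_linear_vec_nth]

lemma l2ip_self: "l2ip \<Omega> f f = (LINT x|lebesgue_on \<Omega>. (norm (f x))\<^sup>2)"
  by (simp add: l2ip_def power2_norm_eq_inner)

interpretation L2: semi_inner_product_space "{f. L2 \<Omega> f}"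
  "l2ip \<Omega> :: (real^'d \<Rightarrow> 'b::euclidean_space) \<Rightarrow> _"
  rewrites "\<And>f. f \<in> {f. L2 \<Omega> f} \<equiv> L2 \<Omega> f"
  for \<Omega> :: "(real^'d::finite) set"
proof -
  show "semi_inner_product_space {f. L2 \<Omega> f} (l2ip \<Omega> :: (real^'d \<Rightarrow> 'b) \<Rightarrow> _)"
  proof
    fix f g h :: "real^'d \<Rightarrow> 'b" and c
    assume "f \<in> {f. L2 \<Omega> f}" "g \<in> {f. L2 \<Omega> f}" "h \<in> {f. L2 \<Omega> f}"
    then show "l2ip \<Omega> (f + c *\<^sub>R g) h = l2ip \<Omega> f h + c * l2ip \<Omega> g h"
      by (simp add: l2ip_def inner_add_left L2_integrable_inner)
  qed (simp_all add: subspace_L2 l2ip_self, simp add: l2ip_def inner_commute)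
qed simp

lemma l2ip_cong_AE:
  assumes "L2 \<Omega> f" "L2 \<Omega> f'" "L2 \<Omega> g" "L2 \<Omega> g'"
    and "AE x in lebesgue_on \<Omega>. f x = f' x" "AE x in lebesgue_on \<Omega>. g x = g' x"
  shows "l2ip \<Omega> f g = l2ip \<Omega> f' g'"
  unfolding l2ip_def
proof (rule integral_cong_AE)
  show "AE x in lebesgue_on \<Omega>. f x \<bullet> g x = f' x \<bullet> g' x"
    using assms(5,6) by eventually_elim auto
qed (use assms L2_integrable_inner in blast)+

lemma l2norm_cong_AE:
  "L2 \<Omega> f \<Longrightarrow> L2 \<Omega> g \<Longrightarrow> AE x in lebesgue_on \<Omega>. f x = g x \<Longrightarrow> l2norm \<Omega> f = l2norm \<Omega> g"
  by (simp add: induced_norm_def l2ip_cong_AE[of \<Omega> f g f g])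

lemma l2norm_eq_0_AE:
  assumes "L2 \<Omega> f" "l2norm \<Omega> f = 0"
  shows "AE x in lebesgue_on \<Omega>. f x = 0"
proof -
  have "(LINT x|lebesgue_on \<Omega>. (norm (f x))\<^sup>2) = 0"
    using assms by (simp add: induced_norm_def l2ip_self)
  then have "AE x in lebesgue_on \<Omega>. (norm (f x))\<^sup>2 = 0"
    using assms(1) by (subst (asm) integral_nonneg_eq_0_iff_AE) (auto simp: L2_def)
  then show ?thesis by eventually_elim simp
qed

lemma l2norm_dominated:
  fixes f :: "real^'d::finite \<Rightarrow> 'b::euclidean_space" and g :: "real^'d \<Rightarrow> 'c::euclidean_space"
  assumes "L2 \<Omega> f" "L2 \<Omega> g" "0 \<le> C" "AE x in lebesgue_on \<Omega>. norm (g x) \<le> C * norm (f x)"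
  shows "l2norm \<Omega> g \<le> C * l2norm \<Omega> f"
proof (rule power2_le_imp_le)
  have "l2ip \<Omega> g g \<le> (LINT x|lebesgue_on \<Omega>. C\<^sup>2 * (norm (f x))\<^sup>2)"
    unfolding l2ip_self
  proof (rule integral_mono_AE)
    show "AE x in lebesgue_on \<Omega>. (norm (g x))\<^sup>2 \<le> C\<^sup>2 * (norm (f x))\<^sup>2"
      using assms(4) by eventually_elim (metis norm_ge_zero power_mono power_mult_distrib)
  qed (use assms in \<open>auto simp: L2_def\<close>)
  then show "(l2norm \<Omega> g)\<^sup>2 \<le> (C * l2norm \<Omega> f)\<^sup>2"
    using assms by (simp add: power_mult_distrib L2.seminorm_square l2ip_self)
qed (simp add: assms L2.seminorm_nonneg)

lemma l2norm_nn_integral: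
  assumes "L2 \<Omega> f"
  shows "(\<integral>\<^sup>+x. ennreal ((norm (f x))\<^sup>2) \<partial>lebesgue_on \<Omega>) = ennreal ((l2norm \<Omega> f)\<^sup>2)"
  using assms by (subst nn_integral_eq_integral) (auto simp: L2_def L2.seminorm_square l2ip_self)

lemma convergent_if_summable_weighted_squares:
  fixes h :: "nat \<Rightarrow> 'a::banach"
  assumes "summable (\<lambda>j. 2 ^ j * (norm (h (Suc j) - h j))\<^sup>2)"
  shows "convergent h"
proof -
  have "norm (h (Suc j) - h j) \<le> 2 ^ j * (norm (h (Suc j) - h j))\<^sup>2 + (1/2) ^ j" for j
  proof -
    let ?d = "norm (h (Suc j) - h j)"
    have "0 \<le> (1/2) ^ j * (2 ^ j * ?d - 1)\<^sup>2 + ?d" by simp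
    then show ?thesis by (simp add: power2_eq_square power_divide field_simps)
  qed
  then have "summable (\<lambda>j. h (Suc j) - h j)"
    by (intro summable_norm_cancel[OF summable_comparison_test[OF _
          summable_add[OF assms summable_geometric]]]) auto
  then have "convergent (\<lambda>n. h 0 + (\<Sum>j<n. h (Suc j) - h j))"
    by (intro convergent_add convergent_const) (simp add: summable_iff_convergent)
  then show ?thesis by (simp add: sum_lessThan_telescope[of h])
qed

lemma AE_convergent_if_fast_Cauchy:
  fixes h :: "nat \<Rightarrow> 'a \<Rightarrow> 'b::{banach, second_countable_topology}"
  assumes [measurable]: "\<And>j. h j \<in> borel_measurable M"
    and small: "\<And>j. (\<integral>\<^sup>+x. ennreal ((norm (h (Suc j) x - h j x))\<^sup>2) \<partial>M) \<le> ennreal ((1/4) ^ j)"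
  shows "AE x in M. convergent (\<lambda>j. h j x)"
proof -
  define d where "d j x = norm (h (Suc j) x - h j x)" for j x
  have [measurable]: "d j \<in> borel_measurable M" for j unfolding d_def by measurable
  have "(\<integral>\<^sup>+x. (\<Sum>j. ennreal (2 ^ j * (d j x)\<^sup>2)) \<partial>M) = (\<Sum>j. \<integral>\<^sup>+x. ennreal (2 ^ j * (d j x)\<^sup>2) \<partial>M)"
    by (rule nn_integral_suminf) measurable
  also have "\<dots> \<le> (\<Sum>j. ennreal ((1/2) ^ j))"
  proof (intro suminf_le allI)
    fix j
    have "(\<integral>\<^sup>+x. ennreal (2 ^ j * (d j x)\<^sup>2) \<partial>M) = ennreal (2 ^ j) * (\<integral>\<^sup>+x. ennreal ((d j x)\<^sup>2) \<partial>M)"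
      by (simp add: ennreal_mult' nn_integral_cmult)
    also have "\<dots> \<le> ennreal (2 ^ j) * ennreal ((1/4) ^ j)"
      using small[of j] by (intro mult_left_mono) (simp_all add: d_def)
    also have "\<dots> = ennreal ((1/2) ^ j)"
      by (simp add: ennreal_mult'[symmetric] power_mult_distrib[symmetric])
    finally show "(\<integral>\<^sup>+x. ennreal (2 ^ j * (d j x)\<^sup>2) \<partial>M) \<le> ennreal ((1/2) ^ j)" .
  qed auto
  also have "\<dots> < \<infinity>"
    by (simp add: suminf_ennreal2 summable_geometric)
  finally have "AE x in M. (\<Sum>j. ennreal (2 ^ j * (d j x)\<^sup>2)) \<noteq> \<infinity>"
    by (intro nn_integral_noteq_infinite) auto
  then show ?thesis
  proof eventually_elim
    case (elim x)
    then show ?case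
      unfolding d_def
      by (intro convergent_if_summable_weighted_squares summable_suminf_not_top) simp_all
  qed
qed

lemma nn_integral_square_dist_limit_le:
  fixes h :: "nat \<Rightarrow> 'a \<Rightarrow> 'b::{real_normed_vector, second_countable_topology}"
  assumes [measurable]: "f \<in> borel_measurable M" "\<And>i. h i \<in> borel_measurable M"
    and lim: "AE x in M. (\<lambda>i. h i x) \<longlonglongrightarrow> g x"
    and bound: "\<forall>\<^sub>F i in sequentially. (\<integral>\<^sup>+x. ennreal ((norm (f x - h i x))\<^sup>2) \<partial>M) \<le> c"
  shows "(\<integral>\<^sup>+x. ennreal ((norm (f x - g x))\<^sup>2) \<partial>M) \<le> c"
proof -
  have "(\<integral>\<^sup>+x. ennreal ((norm (f x - g x))\<^sup>2) \<partial>M)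
      = (\<integral>\<^sup>+x. liminf (\<lambda>i. ennreal ((norm (f x - h i x))\<^sup>2)) \<partial>M)"
  proof (rule nn_integral_cong_AE)
    show "AE x in M. ennreal ((norm (f x - g x))\<^sup>2) = liminf (\<lambda>i. ennreal ((norm (f x - h i x))\<^sup>2))"
      using lim
    proof eventually_elim
      case (elim x)
      then have "(\<lambda>i. ennreal ((norm (f x - h i x))\<^sup>2)) \<longlonglongrightarrow> ennreal ((norm (f x - g x))\<^sup>2)"
        by (intro tendsto_intros)
      then show ?case using lim_imp_Liminf[OF sequentially_bot] by metis
    qed
  qed
  also have "\<dots> \<le> liminf (\<lambda>i. \<integral>\<^sup>+x. ennreal ((norm (f x - h i x))\<^sup>2) \<partial>M)"
    by (rule nn_integral_liminf) measurable
  also have "\<dots> \<le> c"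
    using bound by (rule Liminf_le[OF sequentially_bot])
  finally show ?thesis .
qed

lemma L2_if_nn_integral_square_finite:
  assumes "f \<in> borel_measurable (lebesgue_on \<Omega>)"
    and "(\<integral>\<^sup>+x. ennreal ((norm (f x))\<^sup>2) \<partial>lebesgue_on \<Omega>) < \<infinity>"
  shows "L2 \<Omega> f"
  using assms unfolding L2_def by (auto intro!: integrableI_bounded)

lemma fast_Cauchy_limit:
  fixes f :: "nat \<Rightarrow> 'a \<Rightarrow> 'b::{banach, second_countable_topology}"
  assumes [measurable]: "\<And>n. f n \<in> borel_measurable M" and r: "strict_mono r"
    and dist_le: "\<And>j m n. r j \<le> m \<Longrightarrow> r j \<le> n \<Longrightarrow>
      (\<integral>\<^sup>+x. ennreal ((norm (f m x - f n x))\<^sup>2) \<partial>M) \<le> ennreal ((1/4) ^ j)"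
  obtains g where "g \<in> borel_measurable M"
    "\<And>j m. r j \<le> m \<Longrightarrow> (\<integral>\<^sup>+x. ennreal ((norm (f m x - g x))\<^sup>2) \<partial>M) \<le> ennreal ((1/4) ^ j)"
proof -
  have r_ge: "j \<le> r j" "r j \<le> r (Suc j)" for j
    using r by (auto simp: strict_mono_imp_increasing strict_mono_less_eq)
  define g where "g x = lim (\<lambda>j. f (r j) x)" for x
  have "g \<in> borel_measurable M" unfolding g_def by measurable
  moreover have "AE x in M. convergent (\<lambda>j. f (r j) x)"
    by (rule AE_convergent_if_fast_Cauchy) (auto intro: dist_le r_ge)
  then have lim: "AE x in M. (\<lambda>j. f (r j) x) \<longlonglongrightarrow> g x"
    by eventually_elim (simp add: g_def convergent_LIMSEQ_iff)
  have "(\<integral>\<^sup>+x. ennreal ((norm (f m x - g x))\<^sup>2) \<partial>M) \<le> ennreal ((1/4) ^ j)" if "r j \<le> m" for m j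
  proof (rule nn_integral_square_dist_limit_le[OF _ _ lim])
    show "\<forall>\<^sub>F i in sequentially. (\<integral>\<^sup>+x. ennreal ((norm (f m x - f (r i) x))\<^sup>2) \<partial>M)
        \<le> ennreal ((1/4) ^ j)"
      using eventually_ge_at_top[of "r j"]
      by eventually_elim (intro dist_le that order_trans[OF _ r_ge(1)])
  qed measurable
  ultimately show thesis by (rule that)
qed

theorem L2_complete: "complete_wrt (l2norm \<Omega>) {f. L2 \<Omega> f}"
  unfolding complete_wrt_def
proof (intro allI impI)
  fix f :: "nat \<Rightarrow> real^'a \<Rightarrow> 'b" assume "\<forall>n. f n \<in> {f. L2 \<Omega> f}" and Cauchy: "Cauchy_wrt (l2norm \<Omega>) f"
  then have f: "\<And>n. L2 \<Omega> (f n)" by simp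
  have square: "((1/2) ^ j)\<^sup>2 = ((1/4) ^ j :: real)" for j
    by (simp add: power2_eq_square power_mult_distrib[symmetric])
  obtain r where r: "strict_mono r"
    "\<And>j m n. r j \<le> m \<Longrightarrow> r j \<le> n \<Longrightarrow> l2norm \<Omega> (f m - f n) < (1/2) ^ j"
    using Cauchy_wrt_imp_fast_subsequence[OF Cauchy] by blast
  have dist_le: "(\<integral>\<^sup>+x. ennreal ((norm (f m x - f n x))\<^sup>2) \<partial>lebesgue_on \<Omega>) \<le> ennreal ((1/4) ^ j)"
    if "r j \<le> m" "r j \<le> n" for j m n
  proof -
    have "(l2norm \<Omega> (f m - f n))\<^sup>2 \<le> ((1/2) ^ j)\<^sup>2"
      using r(2)[OF that] by (intro power_mono L2.seminorm_nonneg L2_diff f) simp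
    then show ?thesis
      using l2norm_nn_integral[OF L2_diff[OF f f], of m n] by (simp add: square ennreal_leI)
  qed
  obtain g where g: "g \<in> borel_measurable (lebesgue_on \<Omega>)" and limit_le: "\<And>j m. r j \<le> m \<Longrightarrow>
      (\<integral>\<^sup>+x. ennreal ((norm (f m x - g x))\<^sup>2) \<partial>lebesgue_on \<Omega>) \<le> ennreal ((1/4) ^ j)"
    using fast_Cauchy_limit[where f = f, OF L2_measurable[OF f] r(1) dist_le] by blast
  have diff: "L2 \<Omega> (f m - g)" if "r j \<le> m" for m j
    using limit_le[OF that] g L2_measurable[OF f]
    by (intro L2_if_nn_integral_square_finite)
      (auto simp: fun_diff_def less_top top_unique intro: order.strict_trans1)
  have "l2norm \<Omega> (f n - g) \<le> (1/2) ^ j" if "r j \<le> n" for n j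
  proof (rule power2_le_imp_le)
    show "(l2norm \<Omega> (f n - g))\<^sup>2 \<le> ((1/2) ^ j)\<^sup>2"
      using limit_le[OF that] l2norm_nn_integral[OF diff[OF that]]
      by (simp add: square ennreal_le_iff)
  qed simp
  then have "(\<lambda>n. l2norm \<Omega> (f n - g)) \<longlonglongrightarrow> 0"
    using L2.seminorm_nonneg[OF diff]
    by (intro tendsto_0_if_eventually_le_powers[where c = "1/2" and r = r]) auto
  moreover have "L2 \<Omega> g" using L2_diff[OF f[of "r 0"] diff[OF order_refl, of 0]] by simp
  ultimately show "\<exists>g\<in>{f. L2 \<Omega> f}. (\<lambda>n. l2norm \<Omega> (f n - g)) \<longlonglongrightarrow> 0" by blast
qed

section \<open>Bounded coefficients\<close>

lemma borel_measurable_lebesgue_on_cong_AE: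
  fixes f g :: "'a::euclidean_space \<Rightarrow> 'b::euclidean_space"
  assumes S: "S \<in> sets lebesgue" and f: "f \<in> borel_measurable (lebesgue_on S)"
    and eq: "AE x in lebesgue_on S. f x = g x"
  shows "g \<in> borel_measurable (lebesgue_on S)"
proof -
  have "(\<lambda>x. if x \<in> S then g x else 0) \<in> borel_measurable lebesgue"
  proof (rule borel_measurable_AE)
    show "(\<lambda>x. if x \<in> S then f x else 0) \<in> borel_measurable lebesgue"
      using borel_measurable_if[OF S] f by blast
    show "AE x in lebesgue. (if x \<in> S then f x else 0) = (if x \<in> S then g x else 0)"
      using eq S by (auto simp: AE_restrict_space_iff elim: eventually_mono)
  qed
  then show ?thesis using borel_measurable_if[OF S] by blast
qed

lemma borel_measurable_continuous_on_AE:
  fixes f :: "'a::euclidean_space \<Rightarrow> 'b::euclidean_space" and h :: "'b \<Rightarrow> 'c::euclidean_space"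
  assumes S: "S \<in> sets lebesgue" and f: "f \<in> borel_measurable (lebesgue_on S)"
    and K: "closed K" "continuous_on K h" "AE x in lebesgue_on S. f x \<in> K"
  shows "(\<lambda>x. h (f x)) \<in> borel_measurable (lebesgue_on S)"
proof (rule borel_measurable_lebesgue_on_cong_AE[OF S])
  have "(\<lambda>y. indicator K y *\<^sub>R h y) \<in> borel_measurable borel"
    by (rule borel_measurable_continuous_on_indicator[OF borel_closed[OF K(1)] K(2)])
  then show "(\<lambda>x. indicator K (f x) *\<^sub>R h (f x)) \<in> borel_measurable (lebesgue_on S)"
    by (rule measurable_compose[OF f])
  show "AE x in lebesgue_on S. indicator K (f x) *\<^sub>R h (f x) = h (f x)"
    using K(3) by eventually_elim simp
qed

lemma Linf_bound:
  assumes "Linf \<Omega> f"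
  obtains C where "0 < C" "AE x in lebesgue_on \<Omega>. norm (f x) \<le> C"
proof -
  obtain C where "AE x in lebesgue_on \<Omega>. norm (f x) \<le> C" using assms by (auto simp: Linf_def)
  then have "AE x in lebesgue_on \<Omega>. norm (f x) \<le> \<bar>C\<bar> + 1" by eventually_elim auto
  then show ?thesis by (intro that[of "\<bar>C\<bar> + 1"]) auto
qed

lemma Linf_continuous_compose:
  fixes A :: "real^'d::finite \<Rightarrow> 'a::euclidean_space" and h :: "'a \<Rightarrow> 'b::euclidean_space"
  assumes \<Omega>: "\<Omega> \<in> sets lebesgue" and A: "Linf \<Omega> A"
    and K: "closed K" "continuous_on K h" "AE x in lebesgue_on \<Omega>. A x \<in> K"
  shows "Linf \<Omega> (\<lambda>x. h (A x))"
  unfolding Linf_def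
proof
  show "(\<lambda>x. h (A x)) \<in> borel_measurable (lebesgue_on \<Omega>)"
    using A by (intro borel_measurable_continuous_on_AE[OF \<Omega> _ K]) (simp add: Linf_def)
  obtain C where C: "AE x in lebesgue_on \<Omega>. norm (A x) \<le> C" using Linf_bound[OF A] by blast
  have "compact (h ` (K \<inter> cball 0 C))"
    by (intro compact_continuous_image continuous_on_subset[OF K(2)] closed_Int_compact K) auto
  then obtain B where B: "\<And>y. y \<in> K \<Longrightarrow> norm y \<le> C \<Longrightarrow> norm (h y) \<le> B"
    using compact_imp_bounded by (fastforce simp: bounded_iff)
  have "AE x in lebesgue_on \<Omega>. norm (h (A x)) \<le> B"
    using C K(3) by eventually_elim (rule B)
  then show "\<exists>B. AE x in lebesgue_on \<Omega>. norm (h (A x)) \<le> B" by blast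
qed

lemma Linf_bilinear_AE_le:
  fixes h :: "'a::euclidean_space \<Rightarrow> 'b::euclidean_space \<Rightarrow> 'c::euclidean_space"
    and \<beta> :: "real^'d::finite \<Rightarrow> 'a"
  assumes h: "bounded_bilinear h" and \<beta>: "Linf \<Omega> \<beta>"
  obtains C where "0 < C" "\<And>f. AE x in lebesgue_on \<Omega>. norm (h (\<beta> x) (f x)) \<le> C * norm (f x)"
proof -
  obtain K where K: "0 < K" "\<And>a b. norm (h a b) \<le> norm a * norm b * K"
    using bounded_bilinear.pos_bounded[OF h] by blast
  obtain B where B: "0 < B" "AE x in lebesgue_on \<Omega>. norm (\<beta> x) \<le> B" using Linf_bound[OF \<beta>] .
  have "AE x in lebesgue_on \<Omega>. norm (h (\<beta> x) (f x)) \<le> (B * K) * norm (f x)" for f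
    using B(2)
  proof eventually_elim
    case (elim x)
    have "norm (\<beta> x) * norm (f x) * K \<le> B * norm (f x) * K"
      using elim K(1) by (intro mult_right_mono) auto
    then show ?case using K(2)[of "\<beta> x" "f x"] by (simp add: mult_ac)
  qed
  then show thesis using K(1) B(1) by (intro that[of "B * K"]) simp_all
qed

lemma L2_Linf_bilinear:
  assumes h: "bounded_bilinear h" and \<beta>: "Linf \<Omega> \<beta>" and f: "L2 \<Omega> f"
  shows "L2 \<Omega> (\<lambda>x. h (\<beta> x) (f x))"
proof -
  obtain C where C: "\<And>f. AE x in lebesgue_on \<Omega>. norm (h (\<beta> x) (f x)) \<le> C * norm (f x)"
    using Linf_bilinear_AE_le[OF h \<beta>] by blast
  have "(\<lambda>x. h (\<beta> x) (f x)) \<in> borel_measurable (lebesgue_on \<Omega>)"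
  proof (rule borel_measurable_continuous_Pair[where H = h])
    show "\<beta> \<in> borel_measurable (lebesgue_on \<Omega>)" using \<beta> by (simp add: Linf_def)
    show "continuous_on UNIV (\<lambda>p. h (fst p) (snd p))"
      by (rule bounded_bilinear.continuous_on[OF h continuous_on_fst continuous_on_snd]) simp_all
  qed (rule L2_measurable[OF f])
  then show ?thesis by (rule L2_dominated[OF f _ C])
qed

lemma l2norm_Linf_bilinear_le:
  assumes h: "bounded_bilinear h" and \<beta>: "Linf \<Omega> \<beta>"
  obtains C where "0 < C" "\<And>f. L2 \<Omega> f \<Longrightarrow> l2norm \<Omega> (\<lambda>x. h (\<beta> x) (f x)) \<le> C * l2norm \<Omega> f"
proof -
  obtain C where C: "0 < C" "\<And>f. AE x in lebesgue_on \<Omega>. norm (h (\<beta> x) (f x)) \<le> C * norm (f x)"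
    using Linf_bilinear_AE_le[OF h \<beta>] by blast
  then show thesis
    by (intro that[of C] l2norm_dominated L2_Linf_bilinear[OF h \<beta>]) simp_all
qed

lemma l2norm_bounded_linear_le:
  assumes h: "bounded_linear h"
  obtains C where "0 < C" "\<And>f. L2 \<Omega> f \<Longrightarrow> l2norm \<Omega> (\<lambda>x. h (f x)) \<le> C * l2norm \<Omega> f"
proof -
  obtain C where "0 < C" "\<And>y. norm (h y) \<le> norm y * C"
    using bounded_linear.pos_bounded[OF h] by blast
  then show thesis
    by (intro that[of C] l2norm_dominated L2_bounded_linear[OF h]) (simp_all add: mult.commute)
qed

lemma l2norm_tendsto_if_bounded:
  fixes T :: "(real^'d::finite \<Rightarrow> 'b::euclidean_space) \<Rightarrow> real^'d \<Rightarrow> 'c::euclidean_space"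
  assumes T: "\<And>f. L2 \<Omega> f \<Longrightarrow> L2 \<Omega> (T f)" "\<And>f. L2 \<Omega> f \<Longrightarrow> l2norm \<Omega> (T f) \<le> C * l2norm \<Omega> f"
      "\<And>f g. T (f - g) = T f - T g"
    and f: "\<And>n. L2 \<Omega> (f n)" "L2 \<Omega> g" "(\<lambda>n. l2norm \<Omega> (f n - g)) \<longlonglongrightarrow> 0"
  shows "(\<lambda>n. l2norm \<Omega> (T (f n) - T g)) \<longlonglongrightarrow> 0"
  unfolding T(3)[symmetric]
  by (rule tendsto_0_le_bound[OF tendsto_mult_right_zero[OF f(3), of C]])
    (intro T L2.seminorm_nonneg L2_diff f)+

lemma l2norm_bounded_linear_tendsto:
  assumes h: "bounded_linear h" and "\<And>n. L2 \<Omega> (f n)" "L2 \<Omega> g" "(\<lambda>n. l2norm \<Omega> (f n - g)) \<longlonglongrightarrow> 0"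
  shows "(\<lambda>n. l2norm \<Omega> ((\<lambda>x. h (f n x)) - (\<lambda>x. h (g x)))) \<longlonglongrightarrow> 0"
proof -
  obtain C where C: "\<And>f. L2 \<Omega> f \<Longrightarrow> l2norm \<Omega> (\<lambda>x. h (f x)) \<le> C * l2norm \<Omega> f"
    using l2norm_bounded_linear_le[OF h] by blast
  show ?thesis
    by (rule l2norm_tendsto_if_bounded[of \<Omega> "\<lambda>f x. h (f x)" C])
      (simp_all add: C L2_bounded_linear[OF h] linear_diff[OF bounded_linear.linear[OF h]]
          fun_eq_iff assms)
qed

lemma l2norm_Linf_bilinear_tendsto:
  assumes h: "bounded_bilinear h" and \<beta>: "Linf \<Omega> \<beta>"
    and "\<And>n. L2 \<Omega> (f n)" "L2 \<Omega> g" "(\<lambda>n. l2norm \<Omega> (f n - g)) \<longlonglongrightarrow> 0"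
  shows "(\<lambda>n. l2norm \<Omega> ((\<lambda>x. h (\<beta> x) (f n x)) - (\<lambda>x. h (\<beta> x) (g x)))) \<longlonglongrightarrow> 0"
proof -
  obtain C where C: "\<And>f. L2 \<Omega> f \<Longrightarrow> l2norm \<Omega> (\<lambda>x. h (\<beta> x) (f x)) \<le> C * l2norm \<Omega> f"
    using l2norm_Linf_bilinear_le[OF h \<beta>] by blast
  show ?thesis
    by (rule l2norm_tendsto_if_bounded[of \<Omega> "\<lambda>f x. h (\<beta> x) (f x)" C])
      (simp_all add: C L2_Linf_bilinear[OF h \<beta>] bounded_bilinear.diff_right[OF h] fun_eq_iff assms)
qed

section \<open>Maps into \<open>L\<^sup>2\<close>\<close>

lemma l2ip_Pair:
  assumes "L2 \<Omega> f" "L2 \<Omega> g" "L2 \<Omega> f'" "L2 \<Omega> g'"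
  shows "l2ip \<Omega> (\<lambda>x. (f x, g x)) (\<lambda>x. (f' x, g' x)) = l2ip \<Omega> f f' + l2ip \<Omega> g g'"
  using assms by (simp add: l2ip_def L2_integrable_inner)

lemma l2norm_Pair_le:
  assumes "L2 \<Omega> f" "L2 \<Omega> g"
  shows "l2norm \<Omega> (\<lambda>x. (f x, g x)) \<le> l2norm \<Omega> f + l2norm \<Omega> g"
proof (rule power2_le_imp_le)
  show "(l2norm \<Omega> (\<lambda>x. (f x, g x)))\<^sup>2 \<le> (l2norm \<Omega> f + l2norm \<Omega> g)\<^sup>2"
    using assms by (simp add: L2.seminorm_square L2_Pair l2ip_Pair power2_sum L2.seminorm_nonneg)
qed (simp add: assms L2.seminorm_nonneg)

locale AE_linear =
  fixes \<Omega> :: "(real^'d::finite) set" and S :: "'a::real_vector set"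
    and T :: "'a \<Rightarrow> real^'d \<Rightarrow> 'b::euclidean_space"
  assumes subspace_domain: "subspace S"
    and L2_T: "u \<in> S \<Longrightarrow> L2 \<Omega> (T u)"
    and T_add_scaleR:
      "u \<in> S \<Longrightarrow> v \<in> S \<Longrightarrow> AE x in lebesgue_on \<Omega>. T (u + c *\<^sub>R v) x = T u x + c *\<^sub>R T v x"
begin

sublocale semi_inner_product_space S "\<lambda>u v. l2ip \<Omega> (T u) (T v)"
proof
  fix u v w c assume S: "u \<in> S" "v \<in> S" "w \<in> S"
  have "l2ip \<Omega> (T (u + c *\<^sub>R v)) (T w) = l2ip \<Omega> (T u + c *\<^sub>R T v) (T w)"
    using T_add_scaleR[OF S(1,2), of c] S subspace_domain
    by (intro l2ip_cong_AE L2_T L2_add L2_scaleR) (simp_all add: subspace_add subspace_scale)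
  then show "l2ip \<Omega> (T (u + c *\<^sub>R v)) (T w) = l2ip \<Omega> (T u) (T w) + c * l2ip \<Omega> (T v) (T w)"
    using S by (simp add: L2.ip_linear L2_T L2_scaleR)
qed (simp_all add: subspace_domain L2_T L2.ip_commute L2.ip_nonneg)

lemma seminorm_eq: "seminorm u = l2norm \<Omega> (T u)"
  by (simp add: induced_norm_def)

lemma T_diff_AE: "u \<in> S \<Longrightarrow> v \<in> S \<Longrightarrow> AE x in lebesgue_on \<Omega>. T (u - v) x = T u x - T v x"
  using T_add_scaleR[of u v "-1"] by simp

lemma l2norm_diff:
  assumes "u \<in> S" "v \<in> S"
  shows "l2norm \<Omega> (T (u - v)) = l2norm \<Omega> (T u - T v)"
  using T_diff_AE[OF assms] assms
  by (intro l2norm_cong_AE L2_diff L2_T) (simp_all add: in_subspace)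

lemma complete_if_closed_graph:
  assumes closed: "\<And>u y. (\<And>n. u n \<in> S) \<Longrightarrow> L2 \<Omega> y \<Longrightarrow> (\<lambda>n. l2norm \<Omega> (T (u n) - y)) \<longlonglongrightarrow> 0 \<Longrightarrow>
    \<exists>v\<in>S. AE x in lebesgue_on \<Omega>. T v x = y x"
  shows "complete_wrt seminorm S"
  unfolding complete_wrt_def
proof (intro allI impI)
  fix u assume "\<forall>n. u n \<in> S" and Cauchy: "Cauchy_wrt seminorm u"
  then have u: "\<And>n. u n \<in> S" by blast
  have "Cauchy_wrt (l2norm \<Omega>) (\<lambda>n. T (u n))"
    by (rule Cauchy_wrt_mono[OF Cauchy, of _ _ 1]) (simp_all add: seminorm_eq l2norm_diff u)
  then obtain y where y: "L2 \<Omega> y" "(\<lambda>n. l2norm \<Omega> (T (u n) - y)) \<longlonglongrightarrow> 0"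
    using L2_complete[of \<Omega>, unfolded complete_wrt_def, rule_format, of "\<lambda>n. T (u n)"] L2_T[OF u]
    by auto
  obtain v where v: "v \<in> S" "AE x in lebesgue_on \<Omega>. T v x = y x"
    using closed[OF u y] by blast
  have "l2norm \<Omega> (T (u n) - T v) = l2norm \<Omega> (T (u n) - y)" for n
    using v y(1) u by (intro l2norm_cong_AE L2_diff L2_T) (auto elim: eventually_mono)
  then show "\<exists>v\<in>S. (\<lambda>n. seminorm (u n - v)) \<longlonglongrightarrow> 0"
    using v(1) y(2) u by (intro bexI[of _ v]) (simp_all add: seminorm_eq l2norm_diff)
qed

end

definition controlled_on ::
  "(real^'d) set \<Rightarrow> 'a set \<Rightarrow> ('a \<Rightarrow> real) \<Rightarrow> ('a \<Rightarrow> real^'d::finite \<Rightarrow> 'b::euclidean_space) \<Rightarrow> bool" where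
  "controlled_on \<Omega> U p f \<longleftrightarrow> (\<exists>C>0. \<forall>v\<in>U. L2 \<Omega> (f v) \<and> l2norm \<Omega> (f v) \<le> C * p v)"

lemma controlled_onI:
  assumes "0 < C" "\<And>v. v \<in> U \<Longrightarrow> L2 \<Omega> (f v)" "\<And>v. v \<in> U \<Longrightarrow> l2norm \<Omega> (f v) \<le> C * p v"
  shows "controlled_on \<Omega> U p f"
  using assms unfolding controlled_on_def by blast

lemma controlled_on_cong_AE:
  assumes "controlled_on \<Omega> U p f"
    and "\<And>v. v \<in> U \<Longrightarrow> L2 \<Omega> (g v)" "\<And>v. v \<in> U \<Longrightarrow> AE x in lebesgue_on \<Omega>. f v x = g v x"
  shows "controlled_on \<Omega> U p g"
  using assms l2norm_cong_AE unfolding controlled_on_def by metis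

lemma controlled_on_add:
  assumes "controlled_on \<Omega> U p f" "controlled_on \<Omega> U p g"
  shows "controlled_on \<Omega> U p (\<lambda>v. f v + g v)"
proof -
  obtain C C' where C: "0 < C" "0 < C'"
    "\<And>v. v \<in> U \<Longrightarrow> L2 \<Omega> (f v) \<and> l2norm \<Omega> (f v) \<le> C * p v"
    "\<And>v. v \<in> U \<Longrightarrow> L2 \<Omega> (g v) \<and> l2norm \<Omega> (g v) \<le> C' * p v"
    using assms unfolding controlled_on_def by blast
  have "l2norm \<Omega> (f v + g v) \<le> (C + C') * p v" if "v \<in> U" for v
    using L2.seminorm_triangle[of \<Omega> "f v" "g v"] C(3,4)[OF that] by (simp add: distrib_right)
  then show ?thesis using C by (intro controlled_onI[of "C + C'"]) (simp_all add: L2_add)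
qed

lemma controlled_on_le:
  assumes f: "controlled_on \<Omega> U p f" and B: "0 < B"
    "\<And>v. v \<in> U \<Longrightarrow> l2norm \<Omega> (g v) \<le> B * l2norm \<Omega> (f v)"
    and g: "\<And>v. v \<in> U \<Longrightarrow> L2 \<Omega> (g v)"
  shows "controlled_on \<Omega> U p g"
proof -
  obtain C where C: "0 < C" "\<And>v. v \<in> U \<Longrightarrow> l2norm \<Omega> (f v) \<le> C * p v"
    using f unfolding controlled_on_def by blast
  have "l2norm \<Omega> (g v) \<le> (B * C) * p v" if "v \<in> U" for v
    using order_trans[OF B(2)[OF that] mult_left_mono[OF C(2)[OF that] less_imp_le[OF B(1)]]]
    by (simp add: mult.assoc)
  then show ?thesis using B(1) C(1) g by (intro controlled_onI[of "B * C"]) simp_all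
qed

lemma controlled_on_L2: "controlled_on \<Omega> U p f \<Longrightarrow> v \<in> U \<Longrightarrow> L2 \<Omega> (f v)"
  by (auto simp: controlled_on_def)

lemma controlled_on_bounded_bilinear:
  assumes "bounded_bilinear h" "Linf \<Omega> \<beta>" "controlled_on \<Omega> U p f"
  shows "controlled_on \<Omega> U p (\<lambda>v x. h (\<beta> x) (f v x))"
proof -
  obtain B where B: "0 < B" "\<And>f. L2 \<Omega> f \<Longrightarrow> l2norm \<Omega> (\<lambda>x. h (\<beta> x) (f x)) \<le> B * l2norm \<Omega> f"
    using l2norm_Linf_bilinear_le[OF assms(1,2)] by blast
  then show ?thesis
    using controlled_on_L2[OF assms(3)]
    by (intro controlled_on_le[OF assms(3) B(1)] L2_Linf_bilinear[OF assms(1,2)] B(2))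
qed

lemma controlled_on_bounded_linear:
  assumes "bounded_linear h" "controlled_on \<Omega> U p f"
  shows "controlled_on \<Omega> U p (\<lambda>v x. h (f v x))"
proof -
  obtain B where B: "0 < B" "\<And>f. L2 \<Omega> f \<Longrightarrow> l2norm \<Omega> (\<lambda>x. h (f x)) \<le> B * l2norm \<Omega> f"
    using l2norm_bounded_linear_le[OF assms(1)] by blast
  then show ?thesis
    using controlled_on_L2[OF assms(2)]
    by (intro controlled_on_le[OF assms(2) B(1)] L2_bounded_linear[OF assms(1)] B(2))
qed

lemma controlled_on_scaleR: "controlled_on \<Omega> U p f \<Longrightarrow> controlled_on \<Omega> U p (\<lambda>v. c *\<^sub>R f v)"
  using controlled_on_bounded_linear[OF bounded_linear_scaleR_right, of \<Omega> U p f c]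
  by (simp add: scaleR_fun_def)

lemma controlled_on_diff:
  "controlled_on \<Omega> U p f \<Longrightarrow> controlled_on \<Omega> U p g \<Longrightarrow> controlled_on \<Omega> U p (\<lambda>v. f v - g v)"
  using controlled_on_add[of \<Omega> U p f "\<lambda>v. (-1) *\<^sub>R g v"] controlled_on_scaleR[of \<Omega> U p g "-1"]
  by simp

lemma controlled_on_Pair:
  assumes "controlled_on \<Omega> U p f" "controlled_on \<Omega> U p g"
  shows "controlled_on \<Omega> U p (\<lambda>v x. (f v x, g v x))"
proof -
  obtain C C' where C: "0 < C" "0 < C'"
    "\<And>v. v \<in> U \<Longrightarrow> L2 \<Omega> (f v) \<and> l2norm \<Omega> (f v) \<le> C * p v"
    "\<And>v. v \<in> U \<Longrightarrow> L2 \<Omega> (g v) \<and> l2norm \<Omega> (g v) \<le> C' * p v"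
    using assms unfolding controlled_on_def by blast
  have "l2norm \<Omega> (\<lambda>x. (f v x, g v x)) \<le> (C + C') * p v" if "v \<in> U" for v
    using l2norm_Pair_le[of \<Omega> "f v" "g v"] C(3,4)[OF that] by (simp add: distrib_right)
  then show ?thesis using C by (intro controlled_onI[of "C + C'"]) (simp_all add: L2_Pair)
qed

section \<open>Square roots of positive definite matrices\<close>

lemma symmetric_matrix_inner:
  fixes M :: "real^'n^'n"
  assumes "transpose M = M"
  shows "(M *v x) \<bullet> y = x \<bullet> (M *v y)"
  by (metis assms dot_lmul_matrix transpose_matrix_vector)

lemma symmetric_matrixI:
  fixes M :: "real^'n^'n"
  assumes "\<And>x y. (M *v x) \<bullet> y = x \<bullet> (M *v y)"
  shows "transpose M = M"
proof -
  have "M $ i $ j = M $ j $ i" for i j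
    using assms[of "axis j 1" "axis i 1"]
    by (simp add: matrix_vector_mul_component inner_axis inner_axis' inner_commute)
  then show ?thesis by (simp add: transpose_def vec_eq_iff)
qed

lemma symmetric_Rayleigh_minimizer:
  fixes M :: "real^'n^'n"
  assumes W: "subspace W" "W \<noteq> {0}"
  obtains v where "v \<in> W" "norm v = 1" "\<And>x. x \<in> W \<Longrightarrow> (v \<bullet> (M *v v)) * (x \<bullet> x) \<le> x \<bullet> (M *v x)"
proof -
  let ?S = "sphere 0 1 \<inter> W"
  obtain w where "w \<in> W" "w \<noteq> 0" using W subspace_0 by blast
  then have "w /\<^sub>R norm w \<in> ?S" using W(1) by (simp add: subspace_scale)
  moreover have "compact ?S" by (intro compact_Int_closed closed_subspace W) simp
  moreover have "continuous_on ?S (\<lambda>x. x \<bullet> (M *v x))"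
    by (intro continuous_on_inner continuous_on_id linear_continuous_on
        matrix_vector_mul_bounded_linear)
  ultimately obtain v where v: "v \<in> ?S" and min: "\<And>x. x \<in> ?S \<Longrightarrow> v \<bullet> (M *v v) \<le> x \<bullet> (M *v x)"
    using continuous_attains_inf[of ?S "\<lambda>x. x \<bullet> (M *v x)"] by blast
  have "(v \<bullet> (M *v v)) * (x \<bullet> x) \<le> x \<bullet> (M *v x)" if "x \<in> W" for x
  proof (cases "x = 0")
    case False
    have "v \<bullet> (M *v v) \<le> (x /\<^sub>R norm x) \<bullet> (M *v (x /\<^sub>R norm x))"
      using False W(1) that by (intro min) (simp add: subspace_scale)
    also have "\<dots> = x \<bullet> (M *v x) / (x \<bullet> x)"
      by (simp add: matrix_vector_mult_scaleR power2_norm_eq_inner[symmetric] power2_eq_square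
          divide_inverse)
    finally show ?thesis using False by (simp add: field_simps)
  qed simp
  then show thesis using v that by auto
qed

text \<open>A minimiser of the Rayleigh quotient is a critical point of it.\<close>

lemma symmetric_eigenvector_in_invariant_subspace:
  fixes M :: "real^'n^'n"
  assumes sym: "transpose M = M" and W: "subspace W" "W \<noteq> {0}"
    and invariant: "\<And>x. x \<in> W \<Longrightarrow> M *v x \<in> W"
  obtains v where "v \<in> W" "norm v = 1" "M *v v = (v \<bullet> (M *v v)) *\<^sub>R v"
proof -
  obtain v where v: "v \<in> W" "norm v = 1"
    and min: "\<And>x. x \<in> W \<Longrightarrow> (v \<bullet> (M *v v)) * (x \<bullet> x) \<le> x \<bullet> (M *v x)"
    using symmetric_Rayleigh_minimizer[OF W] by blast
  define c where "c = v \<bullet> (M *v v)"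
  define w where "w = M *v v - c *\<^sub>R v"
  have w: "w \<in> W" unfolding w_def using W(1) v(1) invariant by (intro subspace_diff subspace_scale)
  have "(w \<bullet> w)\<^sup>2 \<le> 0 * (w \<bullet> (M *v w) - c * (w \<bullet> w))"
  proof (rule nonneg_quadratic_imp_discriminant_le)
    show "0 \<le> w \<bullet> (M *v w) - c * (w \<bullet> w)" using min[OF w] by (simp add: c_def)
    fix s
    have "0 \<le> (v + s *\<^sub>R w) \<bullet> (M *v (v + s *\<^sub>R w)) - c * ((v + s *\<^sub>R w) \<bullet> (v + s *\<^sub>R w))"
      using min[of "v + s *\<^sub>R w"] W(1) v(1) w by (simp add: c_def subspace_add subspace_scale)
    also have "\<dots> = 0 + 2 * s * (w \<bullet> (M *v v - c *\<^sub>R v)) + s\<^sup>2 * (w \<bullet> (M *v w) - c * (w \<bullet> w))"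
      using symmetric_matrix_inner[OF sym, of v w] v(2)
      by (simp add: matrix_vector_right_distrib matrix_vector_mult_scaleR inner_add inner_diff_right
          inner_commute c_def[symmetric] norm_eq_1 power2_eq_square algebra_simps)
    finally show "0 \<le> 0 + 2 * s * (w \<bullet> w) + s\<^sup>2 * (w \<bullet> (M *v w) - c * (w \<bullet> w))"
      by (simp only: w_def)
  qed
  then have "M *v v = (v \<bullet> (M *v v)) *\<^sub>R v" by (simp add: w_def c_def)
  then show thesis using v that by blast
qed

definition orthonormal_basis :: "'a::euclidean_space set \<Rightarrow> bool" where
  "orthonormal_basis B \<longleftrightarrow>
    finite B \<and> pairwise orthogonal B \<and> (\<forall>v\<in>B. norm v = 1) \<and> span B = UNIV"

lemma orthonormal_basis_Parseval:
  assumes "orthonormal_basis B"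
  shows "x \<bullet> y = (\<Sum>v\<in>B. (x \<bullet> v) * (y \<bullet> v))"
proof -
  have "(\<Sum>v\<in>B. (y \<bullet> v) *\<^sub>R v) = y"
    using assms by (intro orthonormal_basis_expand) (simp_all add: orthonormal_basis_def)
  then have "x \<bullet> y = x \<bullet> (\<Sum>v\<in>B. (y \<bullet> v) *\<^sub>R v)" by simp
  then show ?thesis by (simp add: inner_sum_right mult.commute)
qed

lemma orthonormal_basis_norm_square:
  assumes "orthonormal_basis B"
  shows "(norm x)\<^sup>2 = (\<Sum>v\<in>B. (x \<bullet> v)\<^sup>2)"
  using orthonormal_basis_Parseval[OF assms, of x x]
  by (simp only: power2_norm_eq_inner power2_eq_square[of "_ \<bullet> _"])

lemma orthonormal_basis_eqI:
  assumes "orthonormal_basis B" "\<And>v. v \<in> B \<Longrightarrow> x \<bullet> v = y \<bullet> v"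
  shows "x = y"
  using orthonormal_basis_norm_square[OF assms(1), of "x - y"] assms(2)
  by (simp add: inner_diff_left)

lemma orthonormal_basis_nonempty: "orthonormal_basis B \<Longrightarrow> B \<noteq> {}"
  for B :: "'a::euclidean_space set"
  unfolding orthonormal_basis_def using UNIV_not_singleton[of "0::'a"] by auto

lemma subset_span_insert_if_orthogonal_subset_span:
  fixes v :: "'a::euclidean_space"
  assumes W: "subspace W" and v: "v \<in> W" "norm v = 1" and B: "W \<inter> {y. orthogonal v y} \<subseteq> span B"
  shows "W \<subseteq> span (insert v B)"
proof
  fix x assume "x \<in> W"
  then have "x - (v \<bullet> x) *\<^sub>R v \<in> W \<inter> {y. orthogonal v y}"
    using W v
    by (simp add: orthogonal_def inner_diff_right dot_square_norm subspace_diff subspace_scale)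
  then show "x \<in> span (insert v B)" using B by (auto simp: span_insert)
qed

lemma symmetric_orthonormal_eigenvectors_span:
  fixes M :: "real^'n^'n"
  assumes sym: "transpose M = M" and W: "subspace W" "\<And>x. x \<in> W \<Longrightarrow> M *v x \<in> W"
  shows "\<exists>B\<subseteq>W. finite B \<and> pairwise orthogonal B \<and> (\<forall>v\<in>B. norm v = 1) \<and> W \<subseteq> span B
    \<and> (\<forall>v\<in>B. M *v v = (v \<bullet> (M *v v)) *\<^sub>R v)"
  using W
proof (induction "dim W" arbitrary: W rule: less_induct)
  case less
  show ?case
  proof (cases "W = {0}")
    case True
    then show ?thesis by (intro exI[of _ "{}"]) simp
  next
    case False
    then obtain v where v: "v \<in> W" "norm v = 1" "M *v v = (v \<bullet> (M *v v)) *\<^sub>R v"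
      using symmetric_eigenvector_in_invariant_subspace[OF sym less.prems(1)] less.prems(2) by blast
    define V where "V = W \<inter> {y. orthogonal v y}"
    have V: "subspace V"
      unfolding V_def by (intro subspace_inter less.prems subspace_orthogonal_to_vector)
    have invariant: "M *v x \<in> V" if "x \<in> V" for x
      using that less.prems(2) symmetric_matrix_inner[OF sym, of v x] v(3)
      by (auto simp: V_def orthogonal_def) (metis inner_scaleR_left mult_zero_right)
    have "v \<notin> V" using v(2) by (auto simp: V_def orthogonal_def)
    then have "span V \<subset> span W"
      using v(1) V less.prems(1) by (simp add: span_eq_iff[THEN iffD2] V_def psubset_eq) blast
    then obtain B where B: "B \<subseteq> V" "finite B" "pairwise orthogonal B" "\<forall>w\<in>B. norm w = 1"
      "V \<subseteq> span B" "\<forall>w\<in>B. M *v w = (w \<bullet> (M *v w)) *\<^sub>R w"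
      using less.hyps[OF dim_psubset V invariant] by blast
    have "W \<subseteq> span (insert v B)"
      using B(5) v
      by (intro subset_span_insert_if_orthogonal_subset_span less.prems(1)) (simp_all add: V_def)
    moreover have "pairwise orthogonal (insert v B)"
      using B(1,3) by (auto simp: pairwise_insert V_def orthogonal_commute)
    ultimately show ?thesis
      using B v by (intro exI[of _ "insert v B"]) (auto simp: V_def)
  qed
qed

theorem symmetric_matrix_spectral:
  fixes M :: "real^'n^'n"
  assumes "transpose M = M"
  obtains B where "orthonormal_basis B" "\<And>v. v \<in> B \<Longrightarrow> M *v v = (v \<bullet> (M *v v)) *\<^sub>R v"
  using symmetric_orthonormal_eigenvectors_span[OF assms, of UNIV] that
  unfolding orthonormal_basis_def by auto

lemma eigenbasis_coordinate:
  fixes M :: "real^'n^'n"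
  assumes "transpose M = M" "M *v v = (v \<bullet> (M *v v)) *\<^sub>R v"
  shows "(M *v x) \<bullet> v = (v \<bullet> (M *v v)) * (x \<bullet> v)"
  using symmetric_matrix_inner[OF assms(1), of x v] assms(2) by (metis inner_scaleR_right)

lemma eigenbasis_eigenvalue:
  fixes M :: "real^'n^'n"
  assumes "orthonormal_basis B" "v \<in> B" "M *v v = c *\<^sub>R v"
  shows "c \<in> mat_eigenvalues M"
proof -
  have "v \<noteq> 0" using assms by (auto simp: orthonormal_basis_def)
  then show ?thesis using assms(3) by (auto simp: mat_eigenvalues_def)
qed

definition elliptic :: "real \<Rightarrow> real^'n^'n \<Rightarrow> bool" where
  "elliptic a M \<longleftrightarrow> transpose M = M \<and> (\<forall>x. a * (x \<bullet> x) \<le> x \<bullet> (M *v x))"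

lemma elliptic_symmetric: "elliptic a M \<Longrightarrow> transpose M = M"
  by (simp add: elliptic_def)

lemma elliptic_ge: "elliptic a M \<Longrightarrow> a * (x \<bullet> x) \<le> x \<bullet> (M *v x)"
  by (simp add: elliptic_def)

lemma elliptic_mono: "elliptic a M \<Longrightarrow> b \<le> a \<Longrightarrow> elliptic b M"
  unfolding elliptic_def by (meson inner_ge_zero mult_right_mono order_trans)

lemma elliptic_eigenvalue_ge:
  assumes "elliptic a M" "c \<in> mat_eigenvalues M"
  shows "a \<le> c"
proof -
  obtain v where v: "v \<noteq> 0" "M *v v = c *\<^sub>R v" using assms(2) by (auto simp: mat_eigenvalues_def)
  have "a * (v \<bullet> v) \<le> c * (v \<bullet> v)" using elliptic_ge[OF assms(1), of v] v(2) by simp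
  then show ?thesis using v(1) by simp
qed

lemma elliptic_if_eigenbasis_ge:
  assumes "transpose M = M" "orthonormal_basis B"
    and "\<And>v. v \<in> B \<Longrightarrow> M *v v = (v \<bullet> (M *v v)) *\<^sub>R v" "\<And>v. v \<in> B \<Longrightarrow> a \<le> v \<bullet> (M *v v)"
  shows "elliptic a M"
  unfolding elliptic_def
proof (intro conjI allI assms)
  fix x
  have "a * (x \<bullet> x) = (\<Sum>v\<in>B. a * (x \<bullet> v)\<^sup>2)"
    by (simp only: power2_norm_eq_inner[symmetric] orthonormal_basis_norm_square[OF assms(2)]
        sum_distrib_left)
  also have "\<dots> \<le> (\<Sum>v\<in>B. (v \<bullet> (M *v v)) * (x \<bullet> v)\<^sup>2)"
    using assms(4) by (intro sum_mono mult_right_mono) simp_all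
  also have "\<dots> = (\<Sum>v\<in>B. (x \<bullet> v) * ((M *v x) \<bullet> v))"
    by (intro sum.cong refl)
      (simp add: eigenbasis_coordinate[OF assms(1) assms(3)] power2_eq_square)
  also have "\<dots> = x \<bullet> (M *v x)" by (rule orthonormal_basis_Parseval[OF assms(2), symmetric])
  finally show "a * (x \<bullet> x) \<le> x \<bullet> (M *v x)" .
qed

lemma elliptic_iff_eigenvalues_ge:
  assumes "transpose M = M"
  shows "elliptic a M \<longleftrightarrow> (\<forall>c\<in>mat_eigenvalues M. a \<le> c)"
proof
  assume ge: "\<forall>c\<in>mat_eigenvalues M. a \<le> c"
  obtain B where B: "orthonormal_basis B" "\<And>v. v \<in> B \<Longrightarrow> M *v v = (v \<bullet> (M *v v)) *\<^sub>R v"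
    using symmetric_matrix_spectral[OF assms] by blast
  have "a \<le> v \<bullet> (M *v v)" if "v \<in> B" for v
    using ge eigenbasis_eigenvalue[OF B(1) that B(2)[OF that]] by blast
  then show "elliptic a M" by (intro elliptic_if_eigenbasis_ge[OF assms B])
qed (use elliptic_eigenvalue_ge in blast)

lemma elliptic_if_eigenvalues_pos:
  assumes "transpose M = M" "\<And>c. c \<in> mat_eigenvalues M \<Longrightarrow> 0 < c"
  obtains a where "0 < a" "elliptic a M"
proof -
  obtain B where B: "orthonormal_basis B" "\<And>v. v \<in> B \<Longrightarrow> M *v v = (v \<bullet> (M *v v)) *\<^sub>R v"
    using symmetric_matrix_spectral[OF assms(1)] by blast
  let ?a = "Min ((\<lambda>v. v \<bullet> (M *v v)) ` B)"
  have fin: "finite B" using B(1) by (simp add: orthonormal_basis_def)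
  have "0 < ?a"
    using fin orthonormal_basis_nonempty[OF B(1)] assms(2) eigenbasis_eigenvalue[OF B(1) _ B(2)]
    by simp
  moreover have "elliptic ?a M"
    using fin by (intro elliptic_if_eigenbasis_ge[OF assms(1) B]) simp_all
  ultimately show thesis using that by blast
qed

lemma symmetric_norm_le_if_eigenvalues_le:
  fixes M :: "real^'n^'n"
  assumes "transpose M = M" "\<And>c. c \<in> mat_eigenvalues M \<Longrightarrow> \<bar>c\<bar> \<le> K"
  shows "norm (M *v x) \<le> K * norm x"
proof (rule power2_le_imp_le)
  obtain B where B: "orthonormal_basis B" "\<And>v. v \<in> B \<Longrightarrow> M *v v = (v \<bullet> (M *v v)) *\<^sub>R v"
    using symmetric_matrix_spectral[OF assms(1)] by blast
  have K: "\<bar>v \<bullet> (M *v v)\<bar> \<le> K" if "v \<in> B" for v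
    by (rule assms(2)[OF eigenbasis_eigenvalue[OF B(1) that B(2)[OF that]]])
  then have "0 \<le> K" using orthonormal_basis_nonempty[OF B(1)] abs_ge_zero order_trans by blast
  then show "0 \<le> K * norm x" by simp
  have "(norm (M *v x))\<^sup>2 = (\<Sum>v\<in>B. (v \<bullet> (M *v v))\<^sup>2 * (x \<bullet> v)\<^sup>2)"
    unfolding orthonormal_basis_norm_square[OF B(1)]
    by (intro sum.cong refl) (simp add: eigenbasis_coordinate[OF assms(1) B(2)] power_mult_distrib)
  also have "\<dots> \<le> (\<Sum>v\<in>B. K\<^sup>2 * (x \<bullet> v)\<^sup>2)"
    using K \<open>0 \<le> K\<close> by (intro sum_mono mult_right_mono) (simp_all add: abs_le_square_iff[symmetric])
  also have "\<dots> = (K * norm x)\<^sup>2"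
    by (simp add: power_mult_distrib orthonormal_basis_norm_square[OF B(1)] sum_distrib_left)
  finally show "(norm (M *v x))\<^sup>2 \<le> (K * norm x)\<^sup>2" .
qed

lemma elliptic_norm_ge:
  assumes "elliptic a M"
  shows "a * norm x \<le> norm (M *v x)"
proof (cases "x = 0")
  case False
  have "norm x * (a * norm x) \<le> norm x * norm (M *v x)"
    using order_trans[OF elliptic_ge[OF assms, of x] norm_cauchy_schwarz]
    by (simp add: power2_norm_eq_inner[symmetric] power2_eq_square mult_ac)
  then show ?thesis using False by simp
qed simp

lemma elliptic_invertible:
  fixes M :: "real^'n^'n"
  assumes "elliptic a M" "0 < a"
  shows "invertible M"
proof -
  have "x = 0" if "M *v x = 0" for x
    using elliptic_norm_ge[OF assms(1), of x] assms(2) that by (simp add: mult_le_0_iff)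
  then show ?thesis
    by (simp add: invertible_left_inverse matrix_left_invertible_ker)
qed

lemma matrix_inv_mult_vec:
  fixes M :: "real^'n^'n"
  assumes "invertible M"
  shows "M *v (matrix_inv M *v x) = x" "matrix_inv M *v (M *v x) = x"
proof -
  have "M ** matrix_inv M = mat 1" "matrix_inv M ** M = mat 1"
    using assms unfolding matrix_inv_def invertible_def by (metis (mono_tags, lifting) someI_ex)+
  then show "M *v (matrix_inv M *v x) = x" "matrix_inv M *v (M *v x) = x"
    by (simp_all add: matrix_vector_mul_assoc)
qed

lemma diagonal_matrix_exists:
  fixes c :: "real^'n \<Rightarrow> real"
  assumes B: "orthonormal_basis B"
  obtains S :: "real^'n^'n" where "transpose S = S" "\<And>v. v \<in> B \<Longrightarrow> S *v v = c v *\<^sub>R v"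
proof -
  define S :: "real^'n^'n" where "S = (\<chi> i j. \<Sum>v\<in>B. c v * v $ i * v $ j)"
  have "transpose S = S" by (simp add: S_def transpose_def mult_ac)
  moreover have "S *v w = c w *\<^sub>R w" if "w \<in> B" for w
  proof -
    have "(S *v w) $ i = (c w *\<^sub>R w) $ i" for i
    proof -
      have "(S *v w) $ i = (\<Sum>v\<in>B. c v * v $ i * (v \<bullet> w))"
        by (simp add: S_def matrix_vector_mult_def inner_vec_def sum_distrib_left sum_distrib_right
            mult.assoc sum.swap[of _ B])
      also have "\<dots> = (\<Sum>v\<in>B. if v = w then c w * w $ i else 0)"
        using B that
        by (intro sum.cong refl)
          (auto simp: orthonormal_basis_def pairwise_def orthogonal_def norm_eq_1)
      also have "\<dots> = (c w *\<^sub>R w) $ i" using B that by (simp add: orthonormal_basis_def)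
      finally show ?thesis .
    qed
    then show ?thesis unfolding vec_eq_iff by blast
  qed
  ultimately show thesis using that by blast
qed

lemma elliptic_sqrt_exists:
  fixes M :: "real^'n^'n"
  assumes M: "elliptic a M" and a: "0 < a"
  obtains S where "elliptic (sqrt a) S" "S ** S = M"
proof -
  have sym: "transpose M = M" by (rule elliptic_symmetric[OF M])
  obtain B where B: "orthonormal_basis B" and eigen: "\<And>v. v \<in> B \<Longrightarrow> M *v v = (v \<bullet> (M *v v)) *\<^sub>R v"
    using symmetric_matrix_spectral[OF sym] by blast
  have unit: "v \<bullet> v = 1" if "v \<in> B" for v
    using B that by (simp add: orthonormal_basis_def norm_eq_1)
  have ge: "a \<le> v \<bullet> (M *v v)" if "v \<in> B" for v
    using elliptic_ge[OF M, of v] unit[OF that] by simp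
  obtain S where S: "transpose S = S" "\<And>v. v \<in> B \<Longrightarrow> S *v v = sqrt (v \<bullet> (M *v v)) *\<^sub>R v"
    using diagonal_matrix_exists[OF B, of "\<lambda>v. sqrt (v \<bullet> (M *v v))"] by blast
  have S_value: "v \<bullet> (S *v v) = sqrt (v \<bullet> (M *v v))" if "v \<in> B" for v
    using S(2)[OF that] unit[OF that] by simp
  have S_eigen: "S *v v = (v \<bullet> (S *v v)) *\<^sub>R v" if "v \<in> B" for v
    using S(2)[OF that] S_value[OF that] by simp
  have "S *v (S *v x) = M *v x" for x
  proof (rule orthonormal_basis_eqI[OF B])
    fix v assume v: "v \<in> B"
    then show "(S *v (S *v x)) \<bullet> v = (M *v x) \<bullet> v"
      using ge[OF v] a by (simp add: eigenbasis_coordinate[OF S(1) S_eigen] S_value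
          eigenbasis_coordinate[OF sym eigen] mult.assoc[symmetric])
  qed
  then have "S ** S = M" by (simp add: matrix_eq matrix_vector_mul_assoc[symmetric])
  moreover have "elliptic (sqrt a) S"
    using ge by (intro elliptic_if_eigenbasis_ge[OF S(1) B S_eigen]) (simp_all add: S_value)
  ultimately show thesis using that by blast
qed

text \<open>For \<open>D = S - T\<close> one has \<open>S D + D T = S\<^sup>2 - T\<^sup>2\<close>; this is tested with the eigenvectors of \<open>D\<close>.\<close>

lemma elliptic_diff_norm_le:
  fixes S T :: "real^'n^'n"
  assumes S: "elliptic a S" and T: "elliptic a T" and a: "0 < a"
    and K: "\<And>x. norm ((S ** S - T ** T) *v x) \<le> K * norm x"
  shows "norm ((S - T) *v x) \<le> K / (2 * a) * norm x"
proof (rule symmetric_norm_le_if_eigenvalues_le)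
  note inner_S = symmetric_matrix_inner[OF elliptic_symmetric[OF S]]
    and inner_T = symmetric_matrix_inner[OF elliptic_symmetric[OF T]]
  show "transpose (S - T) = S - T"
    by (rule symmetric_matrixI)
      (simp add: matrix_vector_mult_diff_rdistrib inner_diff inner_S inner_T)
  fix c assume "c \<in> mat_eigenvalues (S - T)"
  then obtain v where v: "v \<noteq> 0" "(S - T) *v v = c *\<^sub>R v" by (auto simp: mat_eigenvalues_def)
  have Sv: "S *v v = T *v v + c *\<^sub>R v"
    using v(2) by (simp add: matrix_vector_mult_diff_rdistrib algebra_simps)
  have sum_ge: "2 * a * (v \<bullet> v) \<le> v \<bullet> (S *v v) + v \<bullet> (T *v v)"
    using elliptic_ge[OF S, of v] elliptic_ge[OF T, of v] by simp
  have "v \<bullet> ((S ** S - T ** T) *v v) = (S *v v) \<bullet> (S *v v) - (T *v v) \<bullet> (T *v v)"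
    by (simp add: matrix_vector_mult_diff_rdistrib inner_diff matrix_vector_mul_assoc[symmetric]
        inner_S inner_T)
  also have "\<dots> = c * (v \<bullet> (S *v v) + v \<bullet> (T *v v))"
    by (simp add: Sv inner_add inner_commute[of "T *v v" v] algebra_simps)
  finally have "\<bar>c\<bar> * (v \<bullet> (S *v v) + v \<bullet> (T *v v)) = \<bar>v \<bullet> ((S ** S - T ** T) *v v)\<bar>"
    using order_trans[OF _ sum_ge, of 0] a by (simp add: abs_mult)
  also have "\<dots> \<le> norm v * (K * norm v)"
    using Cauchy_Schwarz_ineq2[of v "(S ** S - T ** T) *v v"] K[of v]
    by (meson mult_left_mono norm_ge_zero order_trans)
  also have "\<dots> = K * (v \<bullet> v)" by (simp add: power2_norm_eq_inner[symmetric] power2_eq_square)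
  finally have "\<bar>c\<bar> * (2 * a * (v \<bullet> v)) \<le> K * (v \<bullet> v)"
    using mult_left_mono[OF sum_ge, of "\<bar>c\<bar>"] by simp
  then have "(\<bar>c\<bar> * (2 * a)) * (v \<bullet> v) \<le> K * (v \<bullet> v)" by (simp add: mult_ac)
  then show "\<bar>c\<bar> \<le> K / (2 * a)" using v(1) a by (simp add: field_simps)
qed

lemma elliptic_sqrt_unique:
  assumes "elliptic a S" "0 < a" "elliptic b T" "0 < b" "S ** S = T ** T"
  shows "S = T"
proof -
  let ?c = "min a b"
  have "norm ((S - T) *v x) \<le> 0 / (2 * ?c) * norm x" for x
    using assms
    by (intro elliptic_diff_norm_le elliptic_mono[of a S ?c] elliptic_mono[of b T ?c]) auto
  then have "S *v x = T *v x" for x by (simp add: matrix_vector_mult_diff_rdistrib)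
  then show ?thesis by (simp add: matrix_eq)
qed

lemma mat_sqrt_elliptic:
  fixes M :: "real^'n^'n"
  assumes "elliptic a M" "0 < a"
  shows "mat_sqrt M ** mat_sqrt M = M" "elliptic (sqrt a) (mat_sqrt M)"
proof -
  let ?P = "\<lambda>S::real^'n^'n. transpose S = S \<and> (\<forall>c \<in> mat_eigenvalues S. c > 0) \<and> S ** S = M"
  obtain S where S: "elliptic (sqrt a) S" "S ** S = M"
    using elliptic_sqrt_exists[OF assms] by blast
  have "mat_sqrt M = S"
    unfolding mat_sqrt_def
  proof (rule the_equality)
    have "0 < c" if "c \<in> mat_eigenvalues S" for c
      using elliptic_eigenvalue_ge[OF S(1) that] assms(2) by (meson less_le_trans real_sqrt_gt_zero)
    then show "?P S" using S elliptic_symmetric by blast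
    show "T = S" if T: "?P T" for T
    proof -
      obtain b where "0 < b" "elliptic b T" using elliptic_if_eigenvalues_pos[of T] T by blast
      then show ?thesis using S T assms(2) elliptic_sqrt_unique[of b T "sqrt a" S] by simp
    qed
  qed
  then show "mat_sqrt M ** mat_sqrt M = M" "elliptic (sqrt a) (mat_sqrt M)" using S by simp_all
qed

lemma norm_matrix_vector_mult_le:
  fixes M :: "real^'n^'m"
  shows "norm (M *v x) \<le> norm M * norm x"
proof -
  have "norm (M *v x) \<le> L2_set (\<lambda>i. norm (M $ i) * norm x) UNIV"
    unfolding norm_vec_def[of "M *v x"]
    by (intro L2_set_mono) (simp_all add: matrix_vector_mul_component Cauchy_Schwarz_ineq2)
  also have "\<dots> = norm M * norm x"
    by (simp add: norm_vec_def[of M] L2_set_left_distrib)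
  finally show ?thesis .
qed

lemma continuous_on_matrix_fun:
  fixes h :: "'a::topological_space \<Rightarrow> real^'n^'m"
  assumes "\<And>x. continuous_on K (\<lambda>p. h p *v x)"
  shows "continuous_on K h"
proof -
  have eq: "(\<lambda>p. \<chi> i j. (h p *v axis j 1) $ i) = h"
    by (simp add: fun_eq_iff vec_eq_iff matrix_vector_mul_component inner_axis)
  have "continuous_on K (\<lambda>p. \<chi> i j. (h p *v axis j 1) $ i)"
    by (intro continuous_on_vec_lambda continuous_on_component assms)
  then show ?thesis by (simp only: eq)
qed

lemma continuous_on_mat_sqrt:
  assumes "0 < a"
  shows "continuous_on {M :: real^'n^'n. elliptic a M} mat_sqrt"
proof (rule continuous_on_matrix_fun)
  fix x :: "real^'n"
  have "(norm x / (2 * sqrt a))-lipschitz_on {M. elliptic a M} (\<lambda>M. mat_sqrt M *v x)"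
  proof (rule lipschitz_onI)
    fix M M' :: "real^'n^'n" assume "M \<in> {M. elliptic a M}" "M' \<in> {M. elliptic a M}"
    then have M: "elliptic a M" "elliptic a M'" by auto
    note root = mat_sqrt_elliptic[OF M(1) assms] mat_sqrt_elliptic[OF M(2) assms]
    have "norm ((mat_sqrt M - mat_sqrt M') *v x) \<le> norm (M - M') / (2 * sqrt a) * norm x"
      using root assms by (intro elliptic_diff_norm_le) (simp_all add: norm_matrix_vector_mult_le)
    then show "dist (mat_sqrt M *v x) (mat_sqrt M' *v x) \<le> norm x / (2 * sqrt a) * dist M M'"
      by (simp add: dist_norm matrix_vector_mult_diff_rdistrib mult.commute)
  qed (use assms in simp)
  then show "continuous_on {M. elliptic a M} (\<lambda>M. mat_sqrt M *v x)"
    by (rule lipschitz_on_continuous_on)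
qed

lemma continuous_on_det:
  fixes h :: "'a::topological_space \<Rightarrow> real^'n^'n"
  assumes "\<And>i j. continuous_on K (\<lambda>p. h p $ i $ j)"
  shows "continuous_on K (\<lambda>p. det (h p))"
  unfolding det_def by (intro continuous_intros assms)

lemma continuous_on_matrix_inv: "continuous_on {M :: real^'n^'n. invertible M} matrix_inv"
proof (rule continuous_on_matrix_fun)
  fix x :: "real^'n"
  let ?K = "{M :: real^'n^'n. invertible M}"
  let ?replaced = "\<lambda>M k. (\<chi> i j. if j = k then x $ i else M $ i $ j) :: real^'n^'n"
  have "matrix_inv M *v x = (\<chi> k. det (?replaced M k) / det M)" if "M \<in> ?K" for M :: "real^'n^'n"
    using that matrix_inv_mult_vec(1)[of M x] cramer[of M "matrix_inv M *v x" x]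
    by (simp add: invertible_det_nz)
  moreover have "continuous_on ?K (\<lambda>M. \<chi> k. det (?replaced M k) / det M)"
  proof (intro continuous_on_vec_lambda continuous_on_divide continuous_on_det)
    show "continuous_on ?K (\<lambda>M. ?replaced M k $ i $ j)" for k i j
      by (cases "j = k") (auto intro!: continuous_intros)
  qed (auto simp: invertible_det_nz intro!: continuous_intros)
  ultimately show "continuous_on ?K (\<lambda>M. matrix_inv M *v x)"
    by (subst continuous_on_cong[OF refl])
qed

lemma continuous_on_matrix_inv_mat_sqrt:
  assumes "0 < a"
  shows "continuous_on {M :: real^'n^'n. elliptic a M} (\<lambda>M. matrix_inv (mat_sqrt M))"
proof (rule continuous_on_compose2[OF continuous_on_matrix_inv continuous_on_mat_sqrt[OF assms]])
  show "mat_sqrt ` {M :: real^'n^'n. elliptic a M} \<subseteq> {M. invertible M}"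
    using assms mat_sqrt_elliptic(2) by (auto intro!: elliptic_invertible[of "sqrt a"])
qed

lemma closed_elliptic: "closed {M :: real^'n^'n. elliptic a M}"
  unfolding elliptic_def transpose_def matrix_vector_mult_def inner_vec_def
  by (intro closed_Collect_conj closed_Collect_all closed_Collect_eq closed_Collect_le
      continuous_intros)


lemma bounded_bilinear_matrix_vector_mult:
  "bounded_bilinear ((*v) :: real^'n^'m \<Rightarrow> real^'n \<Rightarrow> real^'m)"
proof
  show "\<exists>K. \<forall>(M :: real^'n^'m) x. norm (M *v x) \<le> norm M * norm x * K"
    using norm_matrix_vector_mult_le by (intro exI[of _ 1]) auto
qed (simp_all add: matrix_vector_mult_add_rdistrib matrix_vector_right_distrib
    matrix_vector_mult_scaleR
    scaleR_matrix_vector_assoc)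

section \<open>Test functions\<close>

lemma pd_eqI: "(\<phi> has_derivative D) (at x) \<Longrightarrow> pd i \<phi> x = D (axis i 1)"
  by (simp add: pd_def frechet_derivative_at[symmetric])

lemma has_derivative_frechet:
  "\<phi> differentiable (at x) \<Longrightarrow> (\<phi> has_derivative frechet_derivative \<phi> (at x)) (at x)"
  by (simp add: frechet_derivative_works)

lemma pd_add:
  "f differentiable (at x) \<Longrightarrow> g differentiable (at x) \<Longrightarrow>
    pd i (\<lambda>x. f x + g x) x = pd i f x + pd i g x"
  by (subst pd_eqI[OF has_derivative_add[OF has_derivative_frechet has_derivative_frechet]])
    (auto simp: pd_def)

lemma pd_mult:
  "f differentiable (at x) \<Longrightarrow> g differentiable (at x) \<Longrightarrow>
    pd i (\<lambda>x. f x * g x) x = f x * pd i g x + pd i f x * g x"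
  by (subst pd_eqI[OF has_derivative_mult[OF has_derivative_frechet has_derivative_frechet]])
    (auto simp: pd_def)

lemma smooth_fun_coinduct:
  assumes "P \<phi>" and "\<And>\<psi> x. P \<psi> \<Longrightarrow> \<psi> differentiable (at x)" and "\<And>\<psi> i. P \<psi> \<Longrightarrow> P (pd i \<psi>)"
  shows "smooth_fun \<phi>"
proof -
  have "P (foldr pd is \<phi>)" for "is"
    by (induction "is") (auto simp: assms)
  then show ?thesis by (simp add: smooth_fun_def assms)
qed

lemma smooth_fun_differentiable: "smooth_fun \<phi> \<Longrightarrow> \<phi> differentiable (at x)"
  unfolding smooth_fun_def by (metis foldr_Nil id_apply)

lemma smooth_fun_pd:
  assumes "smooth_fun \<phi>"
  shows "smooth_fun (pd i \<phi>)"
  unfolding smooth_fun_def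
proof (intro allI)
  fix "is" x
  show "foldr pd is (pd i \<phi>) differentiable (at x)"
    using assms[unfolded smooth_fun_def, rule_format, of "is @ [i]" x] by simp
qed

lemma smooth_fun_continuous: "smooth_fun \<phi> \<Longrightarrow> continuous_on A \<phi>"
  by (meson continuous_at_imp_continuous_on differentiable_imp_continuous_within
      smooth_fun_differentiable)

inductive sum_of_smooth_products :: "(real^'d::finite \<Rightarrow> real) \<Rightarrow> bool" where
  product: "smooth_fun f \<Longrightarrow> smooth_fun g \<Longrightarrow> sum_of_smooth_products (\<lambda>x. f x * g x)"
| sum: "sum_of_smooth_products f \<Longrightarrow> sum_of_smooth_products g \<Longrightarrow>
    sum_of_smooth_products (\<lambda>x. f x + g x)"

lemma sum_of_smooth_products_differentiable:
  "sum_of_smooth_products f \<Longrightarrow> f differentiable (at x)"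
  by (induction rule: sum_of_smooth_products.induct) (auto simp: smooth_fun_differentiable)

lemma sum_of_smooth_products_pd:
  "sum_of_smooth_products f \<Longrightarrow> sum_of_smooth_products (pd i f)"
proof (induction rule: sum_of_smooth_products.induct)
  case (product f g)
  then have "pd i (\<lambda>x. f x * g x) = (\<lambda>x. f x * pd i g x + pd i f x * g x)"
    by (auto simp: fun_eq_iff pd_mult smooth_fun_differentiable)
  then show ?case
    using product by (simp add: sum_of_smooth_products.intros smooth_fun_pd)
next
  case (sum f g)
  then have "pd i (\<lambda>x. f x + g x) = (\<lambda>x. pd i f x + pd i g x)"
    by (auto simp: fun_eq_iff pd_add sum_of_smooth_products_differentiable)
  then show ?case using sum by (simp add: sum_of_smooth_products.intros)
qed

lemma smooth_fun_mult:
  assumes "smooth_fun f" "smooth_fun g"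
  shows "smooth_fun (\<lambda>x. f x * g x)"
  using sum_of_smooth_products.product[OF assms] sum_of_smooth_products_differentiable
    sum_of_smooth_products_pd by (rule smooth_fun_coinduct)

lemma smooth_fun_const: "smooth_fun (\<lambda>x::real^'d. c)"
proof (rule smooth_fun_coinduct[where P = "\<lambda>\<eta>. \<exists>c. \<eta> = (\<lambda>x. c)"])
  fix \<psi> :: "real^'d \<Rightarrow> real" and i
  assume "\<exists>c. \<psi> = (\<lambda>x. c)"
  then obtain c where "\<psi> = (\<lambda>x. c)" by blast
  then have "pd i \<psi> = (\<lambda>x. 0)"
    by (intro ext) (simp only: pd_eqI[OF has_derivative_const])
  then show "\<exists>c. pd i \<psi> = (\<lambda>x. c)" by blast
qed auto

lemma smooth_fun_prod:
  "finite I \<Longrightarrow> (\<And>i. i \<in> I \<Longrightarrow> smooth_fun (f i)) \<Longrightarrow> smooth_fun (\<lambda>x. \<Prod>i\<in>I. f i x)"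
  by (induction I rule: finite_induct) (auto simp: smooth_fun_const smooth_fun_mult)

text \<open>This class of functions is closed under differentiation, whence the smoothness of each.\<close>

definition flat_exp :: "real poly \<Rightarrow> real \<Rightarrow> real" where
  "flat_exp p t = (if 0 < t then poly p (1 / t) * exp (- (1 / t)) else 0)"

lemma poly_div_exp_tendsto_0: "((\<lambda>y::real. poly p y / exp y) \<longlongrightarrow> 0) at_top"
proof -
  have "((\<lambda>y::real. \<Sum>i\<le>degree p. coeff p i * (y ^ i / exp y))
      \<longlongrightarrow> (\<Sum>i\<le>degree p. coeff p i * 0)) at_top"
    by (intro tendsto_sum tendsto_mult tendsto_const tendsto_power_div_exp_0)
  then show ?thesis by (simp add: poly_altdef sum_divide_distrib)
qed

lemma flat_exp_div_tendsto_0: "((\<lambda>h. flat_exp p h / h) \<longlongrightarrow> 0) (at 0)"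
proof (rule filterlim_split_at)
  show "((\<lambda>h. flat_exp p h / h) \<longlongrightarrow> 0) (at_left 0)"
  proof (rule Lim_transform_eventually)
    show "\<forall>\<^sub>F h in at_left 0. 0 = flat_exp p h / h"
      by (rule eventually_at_leftI[of "-1"]) (auto simp: flat_exp_def)
  qed simp
  show "((\<lambda>h. flat_exp p h / h) \<longlongrightarrow> 0) (at_right 0)"
  proof (rule Lim_transform_eventually)
    show "((\<lambda>h. poly ([:0, 1:] * p) (inverse h) / exp (inverse h)) \<longlongrightarrow> 0) (at_right 0)"
      by (rule filterlim_compose[OF poly_div_exp_tendsto_0 filterlim_inverse_at_top_right])
    show "\<forall>\<^sub>F h in at_right 0. poly ([:0, 1:] * p) (inverse h) / exp (inverse h) = flat_exp p h / h"
      by (rule eventually_at_right_less[THEN eventually_mono])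
        (auto simp: flat_exp_def exp_minus field_simps)
  qed
qed

lemma flat_exp_has_derivative:
  "(flat_exp p has_real_derivative flat_exp ([:0, 0, 1:] * (p - pderiv p)) t) (at t)"
proof -
  consider (pos) "0 < t" | (neg) "t < 0" | (zero) "t = 0" by linarith
  then show ?thesis
  proof cases
    case pos
    have "((\<lambda>t. poly p (1 / t) * exp (- (1 / t))) has_real_derivative
        flat_exp ([:0, 0, 1:] * (p - pderiv p)) t) (at t)"
      using pos by (auto intro!: derivative_eq_intros DERIV_chain2[OF poly_DERIV]
          simp: flat_exp_def field_simps power2_eq_square)
    then show ?thesis
      by (rule has_field_derivative_transform_within_open[of _ _ _ "{0<..}"])
        (use pos in \<open>simp_all add: flat_exp_def\<close>)
  next
    case neg
    have "((\<lambda>t. 0) has_real_derivative flat_exp ([:0, 0, 1:] * (p - pderiv p)) t) (at t)"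
      using neg by (simp add: flat_exp_def)
    then show ?thesis
      by (rule has_field_derivative_transform_within_open[of _ _ _ "{..<0}"])
        (use neg in \<open>simp_all add: flat_exp_def\<close>)
  next
    case zero
    then show ?thesis
      using flat_exp_div_tendsto_0[of p] by (simp add: DERIV_def flat_exp_def)
  qed
qed

lemma smooth_fun_flat_exp: "smooth_fun (\<lambda>x. flat_exp p (e \<bullet> x + c))"
proof (rule smooth_fun_coinduct[where P = "\<lambda>\<eta>. \<exists>p s. \<eta> = (\<lambda>x. s * flat_exp p (e \<bullet> x + c))"])
  show "\<exists>p' s. (\<lambda>x. flat_exp p (e \<bullet> x + c)) = (\<lambda>x. s * flat_exp p' (e \<bullet> x + c))"
    by (rule exI[of _ p], rule exI[of _ 1]) simp
  have der: "((\<lambda>x. s * flat_exp p (e \<bullet> x + c)) has_derivative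
      (\<lambda>h. s * (flat_exp ([:0, 0, 1:] * (p - pderiv p)) (e \<bullet> x + c) * (e \<bullet> h)))) (at x)" for p s x
  proof -
    have "((\<lambda>x. e \<bullet> x + c) has_derivative (\<lambda>h. e \<bullet> h)) (at x)"
      by (auto intro!: derivative_eq_intros)
    from has_derivative_compose[OF this, of "flat_exp p"]
    have "((\<lambda>x. flat_exp p (e \<bullet> x + c)) has_derivative
      (\<lambda>h. flat_exp ([:0, 0, 1:] * (p - pderiv p)) (e \<bullet> x + c) * (e \<bullet> h))) (at x)"
      using flat_exp_has_derivative[of p "e \<bullet> x + c"] unfolding has_field_derivative_def by blast
    then show ?thesis by (rule has_derivative_mult_right)
  qed
  show "\<psi> differentiable (at x)" if "\<exists>p s. \<psi> = (\<lambda>x. s * flat_exp p (e \<bullet> x + c))" for \<psi> x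
    using that der unfolding differentiable_def by blast
  show "\<exists>p s. pd i \<psi> = (\<lambda>x. s * flat_exp p (e \<bullet> x + c))"
    if ex: "\<exists>p s. \<psi> = (\<lambda>x. s * flat_exp p (e \<bullet> x + c))" for \<psi> i
  proof -
    obtain p s where \<psi>: "\<psi> = (\<lambda>x. s * flat_exp p (e \<bullet> x + c))" using ex by blast
    have "pd i \<psi> = (\<lambda>x. (s * e $ i) * flat_exp ([:0, 0, 1:] * (p - pderiv p)) (e \<bullet> x + c))"
      unfolding \<psi> by (rule ext, subst pd_eqI[OF der]) (simp add: inner_axis)
    then show ?thesis by blast
  qed
qed

definition box_bump :: "real^'d::finite \<Rightarrow> real^'d \<Rightarrow> nat \<Rightarrow> real^'d \<Rightarrow> real" where
  "box_bump a b n x = (\<Prod>i\<in>UNIV.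
    flat_exp 1 (real (Suc n) * (x $ i - a $ i)) * flat_exp 1 (real (Suc n) * (b $ i - x $ i)))"

lemma smooth_fun_box_bump: "smooth_fun (box_bump a b n)"
proof -
  have eq: "box_bump a b n = (\<lambda>x. \<Prod>i\<in>UNIV.
      flat_exp 1 ((real (Suc n) *\<^sub>R axis i 1) \<bullet> x + - real (Suc n) * a $ i)
    * flat_exp 1 ((- real (Suc n) *\<^sub>R axis i 1) \<bullet> x + real (Suc n) * b $ i))"
    by (auto simp: box_bump_def fun_eq_iff inner_axis' algebra_simps)
  show ?thesis
    unfolding eq by (intro smooth_fun_prod smooth_fun_mult smooth_fun_flat_exp) simp
qed

lemma box_bump_bounds: "0 \<le> box_bump a b n x" "box_bump a b n x \<le> 1"
  unfolding box_bump_def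
  by (auto simp: flat_exp_def intro!: prod_nonneg prod_le_1 mult_le_one)

lemma box_bump_eq_0:
  assumes "x \<notin> box a b"
  shows "box_bump a b n x = 0"
proof -
  obtain i where "\<not> a $ i < x $ i \<or> \<not> x $ i < b $ i" using assms by (auto simp: mem_box_cart)
  then have "flat_exp 1 (real (Suc n) * (x $ i - a $ i))
      * flat_exp 1 (real (Suc n) * (b $ i - x $ i)) = 0"
    by (auto simp: flat_exp_def zero_less_mult_iff)
  then show ?thesis unfolding box_bump_def by (meson UNIV_I finite prod_zero)
qed

lemma box_bump_tendsto: "(\<lambda>n. box_bump a b n x) \<longlonglongrightarrow> indicator (box a b) x"
proof (cases "x \<in> box a b")
  case False
  then show ?thesis by (simp add: box_bump_eq_0)
next
  case True
  have "(\<lambda>n. flat_exp 1 (real (Suc n) * t)) \<longlonglongrightarrow> 1" if "t > 0" for t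
  proof -
    have "(\<lambda>n. exp (- (inverse (real (Suc n)) * (1 / t)))) \<longlonglongrightarrow> exp (- (0 * (1 / t)))"
      by (intro tendsto_intros LIMSEQ_inverse_real_of_nat)
    moreover have "exp (- (inverse (real (Suc n)) * (1 / t))) = flat_exp 1 (real (Suc n) * t)" for n
      using that by (simp add: flat_exp_def divide_inverse del: of_nat_Suc)
    ultimately show ?thesis by simp
  qed
  then have "(\<lambda>n. box_bump a b n x) \<longlonglongrightarrow> (\<Prod>i\<in>(UNIV::'a set). 1 * 1)"
    unfolding box_bump_def
    by (intro tendsto_prod tendsto_mult) (use True in \<open>auto simp: mem_box_cart\<close>)
  then show ?thesis using True by simp
qed

lemma test_fun_box_bump:
  assumes "cbox a b \<subseteq> \<Omega>"
  shows "test_fun \<Omega> (box_bump a b n)"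
proof -
  have "{x. box_bump a b n x \<noteq> 0} \<subseteq> cbox a b"
    using box_bump_eq_0[of _ a b n] box_subset_cbox[of a b] by blast
  then have sub: "closure {x. box_bump a b n x \<noteq> 0} \<subseteq> cbox a b"
    by (rule closure_minimal) (rule closed_cbox)
  then have "bounded (closure {x. box_bump a b n x \<noteq> 0})"
    using bounded_cbox bounded_subset by blast
  then show ?thesis
    using sub assms by (auto simp: test_fun_def smooth_fun_box_bump compact_eq_bounded_closed)
qed

lemma small_cubes_subset_open:
  fixes \<Omega> :: "'a::euclidean_space set"
  assumes "open \<Omega>" "x \<in> \<Omega>"
  obtains d where "0 < d" "\<And>h. 0 < h \<Longrightarrow> h < d \<Longrightarrow> cbox x (x + h *\<^sub>R One) \<subseteq> \<Omega>"
proof -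
  obtain e where e: "0 < e" "ball x e \<subseteq> \<Omega>" using assms open_contains_ball by blast
  have "cbox x (x + h *\<^sub>R One) \<subseteq> \<Omega>" if "0 < h" "h < e / DIM('a)" for h
  proof
    fix y assume y: "y \<in> cbox x (x + h *\<^sub>R One)"
    have "norm (y - x) \<le> (\<Sum>b\<in>Basis. \<bar>(y - x) \<bullet> b\<bar>)" by (rule norm_le_l1)
    also have "\<dots> \<le> (\<Sum>b\<in>(Basis::'a set). h)"
      using y by (intro sum_mono) (force simp: mem_box inner_diff_left inner_add_left)
    also have "\<dots> < e" using that by (simp add: field_simps)
    finally show "y \<in> \<Omega>" using e(2) by (auto simp: dist_norm norm_minus_commute)
  qed
  then show thesis using e(1) by (intro that[of "e / DIM('a)"]) simp_all
qed

text \<open>Lebesgue's differentiation theorem along shrinking cubes.\<close>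

lemma AE_zero_if_box_integrals_zero:
  fixes f :: "'a::euclidean_space \<Rightarrow> 'b::euclidean_space"
  assumes "open \<Omega>" and f: "\<And>a b. f integrable_on cbox a b"
    and zero: "\<And>a b. cbox a b \<subseteq> \<Omega> \<Longrightarrow> integral (cbox a b) f = 0"
  shows "AE x in lebesgue. x \<in> \<Omega> \<longrightarrow> f x = 0"
proof -
  obtain N where N: "negligible N"
    and deriv: "\<And>x e. x \<notin> N \<Longrightarrow> 0 < e \<Longrightarrow> \<exists>d>0. \<forall>h. 0 < h \<and> h < d \<longrightarrow>
      norm (integral (cbox x (x + h *\<^sub>R One)) f /\<^sub>R h ^ DIM('a) - f x) < e"
    using integrable_ccontinuous_explicit[OF f] by blast
  have "f x = 0" if x: "x \<in> \<Omega>" "x \<notin> N" for x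
  proof (rule ccontr)
    assume "f x \<noteq> 0"
    then obtain d where d: "0 < d" "\<And>h. 0 < h \<Longrightarrow> h < d \<Longrightarrow>
      norm (integral (cbox x (x + h *\<^sub>R One)) f /\<^sub>R h ^ DIM('a) - f x) < norm (f x)"
      using deriv[OF x(2), of "norm (f x)"] by auto
    obtain d' where d': "0 < d'" "\<And>h. 0 < h \<Longrightarrow> h < d' \<Longrightarrow> cbox x (x + h *\<^sub>R One) \<subseteq> \<Omega>"
      using small_cubes_subset_open[OF assms(1) x(1)] by blast
    obtain h where "0 < h" "h < d" "h < d'"
      using d(1) d'(1) by (metis dense less_trans linorder_neqE_linordered_idom)
    then show False using d(2)[of h] zero[OF d'(2), of h] by simp
  qed
  moreover have "AE x in lebesgue. x \<notin> N"
    using N by (intro AE_not_in) (simp add: negligible_iff_null_sets)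
  ultimately show ?thesis by (auto elim: eventually_mono)
qed

lemma box_bump_integral_tendsto:
  fixes f :: "real^'d::finite \<Rightarrow> real"
  assumes f: "set_integrable lebesgue (cbox a b) f"
  shows "(\<lambda>n. LINT x|lebesgue. box_bump a b n x * f x) \<longlonglongrightarrow> integral (cbox a b) f"
proof -
  have int: "integrable lebesgue (\<lambda>x. indicator (cbox a b) x * f x)"
    using f by (simp add: set_integrable_def)
  note [measurable] = borel_measurable_integrable[OF int]
  have [measurable]: "box a b \<in> sets lebesgue" by simp
  have [measurable]: "box_bump a b n \<in> borel_measurable lebesgue" for n
    by (intro measurable_completion)
      (simp add: borel_measurable_continuous_onI smooth_fun_continuous smooth_fun_box_bump)
  have restrict: "indicator (box a b) x * f x
      = indicator (box a b) x * (indicator (cbox a b) x * f x)"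
    "box_bump a b n x * f x = box_bump a b n x * (indicator (cbox a b) x * f x)" for x n
    using box_subset_cbox[of a b] box_bump_eq_0[of x a b n] by (auto simp: indicator_def)
  have "(\<lambda>n. LINT x|lebesgue. box_bump a b n x * f x)
      \<longlonglongrightarrow> (LINT x|lebesgue. indicator (box a b) x * f x)"
    unfolding restrict
  proof (rule integral_dominated_convergence[OF _ _ integrable_norm[OF int]])
    show "AE x in lebesgue. norm (box_bump a b n x * (indicator (cbox a b) x * f x))
        \<le> norm (indicator (cbox a b) x * f x)" for n
      using box_bump_bounds[of a b n] by (intro AE_I2) (simp add: abs_mult mult_left_le_one_le)
  qed (auto intro!: tendsto_mult box_bump_tendsto tendsto_const)
  then show ?thesis
    using set_lebesgue_integral_eq_integral(2)[OF set_integrable_subset[OF f _ box_subset_cbox]]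
    by (simp add: integral_open_interval set_lebesgue_integral_def)
qed

lemma fundamental_lemma_calculus_of_variations:
  fixes g :: "real^'d::finite \<Rightarrow> real"
  assumes \<Omega>: "open \<Omega>" and g: "\<And>a b. set_integrable lebesgue (\<Omega> \<inter> cbox a b) g"
    and test: "\<And>\<phi>. test_fun \<Omega> \<phi> \<Longrightarrow> (LINT x|lebesgue_on \<Omega>. g x * \<phi> x) = 0"
  shows "AE x in lebesgue_on \<Omega>. g x = 0"
proof -
  have \<Omega>_sets: "\<Omega> \<in> sets lebesgue" using \<Omega> by (simp add: borel_open)
  define f where "f x = indicator \<Omega> x * g x" for x
  have f: "set_integrable lebesgue (cbox a b) f" for a b
    using g[of a b] by (simp add: set_integrable_def f_def indicator_inter_arith mult_ac)
  have "integral (cbox a b) f = 0" if sub: "cbox a b \<subseteq> \<Omega>" for a b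
  proof -
    have "(LINT x|lebesgue. box_bump a b n x * f x) = 0" for n
      using test[OF test_fun_box_bump[OF sub], of n] \<Omega>_sets
      by (simp add: f_def integral_restrict_space mult_ac)
    then show ?thesis using box_bump_integral_tendsto[OF f, of a b] by (simp add: LIMSEQ_const_iff)
  qed
  then have "AE x in lebesgue. x \<in> \<Omega> \<longrightarrow> f x = 0"
    using set_lebesgue_integral_eq_integral(1)[OF f] by (intro AE_zero_if_box_integrals_zero[OF \<Omega>])
  then show ?thesis
    using \<Omega>_sets by (auto simp: AE_restrict_space_iff f_def elim: eventually_mono)
qed

lemma smooth_fun_directional_derivative:
  assumes "smooth_fun \<phi>"
  shows "((\<lambda>s. \<phi> (x + s *\<^sub>R axis i 1)) has_real_derivative pd i \<phi> (x + s *\<^sub>R axis i 1)) (at s)"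
proof -
  have "((\<lambda>s. x + s *\<^sub>R axis i 1) has_derivative (\<lambda>h. h *\<^sub>R axis i 1)) (at s)"
    by (auto intro!: derivative_eq_intros)
  from has_derivative_compose[OF this
      has_derivative_frechet[OF smooth_fun_differentiable[OF assms]]]
  show ?thesis
    unfolding has_field_derivative_def pd_def
    using linear_frechet_derivative[OF smooth_fun_differentiable[OF assms], of "x + s *\<^sub>R axis i 1"]
    by (simp add: linear_cmul mult_commute_abs)
qed

lemma eq_0_outside_support: "x \<notin> closure {x. \<phi> x \<noteq> 0} \<Longrightarrow> \<phi> x = 0"
  using closure_subset[of "{x. \<phi> x \<noteq> 0}"] by auto

lemma pd_eq_0_outside_support:
  assumes "x \<notin> closure {x. \<phi> x \<noteq> 0}"
  shows "pd i \<phi> x = 0"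
proof -
  have "(\<phi> has_derivative (\<lambda>h. 0)) (at x)"
  proof (rule has_derivative_transform_within_open[OF has_derivative_const])
    show "open (- closure {x. \<phi> x \<noteq> 0})" "x \<in> - closure {x. \<phi> x \<noteq> 0}"
      using assms by auto
    show "0 = \<phi> y" if "y \<in> - closure {x. \<phi> x \<noteq> 0}" for y
      using that eq_0_outside_support[of y \<phi>] by simp
  qed
  then show ?thesis by (simp add: pd_eqI)
qed

lemma pd_support: "closure {x. pd i \<phi> x \<noteq> 0} \<subseteq> closure {x. \<phi> x \<noteq> 0}"
  by (rule closure_minimal) (auto intro: ccontr dest: pd_eq_0_outside_support)

lemma integral_eq_integral_UNIV_if_zero_outside:
  fixes f :: "'a::euclidean_space \<Rightarrow> 'b::banach"
  assumes "\<And>x. x \<notin> S \<Longrightarrow> f x = 0"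
  shows "integral S f = integral UNIV f"
proof -
  have "(\<lambda>x. if x \<in> S then f x else 0) = f" using assms by auto
  then show ?thesis
    using Henstock_Kurzweil_Integration.integral_restrict_UNIV[of S f] by simp
qed

lemma cbox_subset_enlarged_translate:
  fixes a b c :: "real^'d"
  assumes "\<And>i. \<bar>c $ i\<bar> \<le> 1"
  shows "cbox a b \<subseteq> cbox (a - 1 + c) (b + 1 + c)"
proof
  fix x assume x: "x \<in> cbox a b"
  have "(a - 1 + c) $ i \<le> x $ i \<and> x $ i \<le> (b + 1 + c) $ i" for i
  proof -
    have "a $ i \<le> x $ i" "x $ i \<le> b $ i" using x by (simp_all add: mem_box_cart)
    then show ?thesis using assms[of i] by (simp add: abs_le_iff)
  qed
  then show "x \<in> cbox (a - 1 + c) (b + 1 + c)" by (simp add: mem_box_cart)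
qed

lemma integral_cbox_translate:
  fixes f :: "'a::euclidean_space \<Rightarrow> 'b::banach"
  assumes "\<And>x. x \<notin> cbox (l + c) (u + c) \<Longrightarrow> f x = 0"
  shows "integral (cbox l u) (\<lambda>x. f (x + c)) = integral UNIV f"
  using integral_shift_cbox[of "l + c" c "u + c" f]
    integral_eq_integral_UNIV_if_zero_outside[of _ f] assms
  by simp

text \<open>Differentiate the translation-invariant integral \<open>s \<mapsto> \<integral> \<phi>(x + s e\<^sub>i) dx\<close> at \<open>s = 0\<close>.\<close>

lemma integral_pd_eq_0:
  fixes \<phi> :: "real^'d::finite \<Rightarrow> real"
  assumes \<phi>: "smooth_fun \<phi>" and K: "compact (closure {x. \<phi> x \<noteq> 0})"
  shows "integral UNIV (pd i \<phi>) = 0"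
proof -
  let ?e = "axis i 1 :: real^'d"
  obtain a where a: "closure {x. \<phi> x \<noteq> 0} \<subseteq> cbox (- a) a"
    using bounded_subset_cbox_symmetric compact_imp_bounded[OF K] by blast
  define l u where "l = - a - 1" and "u = a + 1"
  have sub: "closure {x. \<phi> x \<noteq> 0} \<subseteq> cbox (l + s *\<^sub>R ?e) (u + s *\<^sub>R ?e)" if "\<bar>s\<bar> < 1" for s
    unfolding l_def u_def using that
    by (intro order_trans[OF a] cbox_subset_enlarged_translate) (simp add: axis_def)
  have shifted: "integral (cbox l u) (\<lambda>x. \<phi> (x + s *\<^sub>R ?e)) = integral UNIV \<phi>" if "\<bar>s\<bar> < 1" for s
    using sub[OF that] by (intro integral_cbox_translate eq_0_outside_support[of _ \<phi>]) blast
  have "((\<lambda>s. integral (cbox l u) (\<lambda>x. \<phi> (x + s *\<^sub>R ?e))) has_real_derivative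
      integral (cbox l u) (\<lambda>x. pd i \<phi> (x + 0 *\<^sub>R ?e))) (at 0 within {-1<..<1})"
  proof (rule leibniz_rule_field_derivative)
    show "((\<lambda>s. \<phi> (x + s *\<^sub>R ?e)) has_real_derivative pd i \<phi> (x + s *\<^sub>R ?e))
        (at s within {-1<..<1})" for s x
      by (rule has_field_derivative_at_within[OF smooth_fun_directional_derivative[OF \<phi>]])
    show "(\<lambda>x. \<phi> (x + s *\<^sub>R ?e)) integrable_on cbox l u" for s
      by (intro integrable_continuous
          continuous_on_compose2[OF smooth_fun_continuous[OF \<phi>, of UNIV]]
          continuous_intros) simp
    show "continuous_on ({-1<..<1} \<times> cbox l u) (\<lambda>(s, x). pd i \<phi> (x + s *\<^sub>R ?e))"
      unfolding case_prod_unfold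
      by (intro continuous_on_compose2[OF smooth_fun_continuous[OF smooth_fun_pd[OF \<phi>], of UNIV]]
          continuous_intros) simp
  qed simp_all
  then have "((\<lambda>s. integral (cbox l u) (\<lambda>x. \<phi> (x + s *\<^sub>R ?e))) has_real_derivative
      integral (cbox l u) (pd i \<phi>)) (at 0)"
    by (simp add: at_within_open[of 0 "{-1<..<1}"])
  moreover have "((\<lambda>s. integral (cbox l u) (\<lambda>x. \<phi> (x + s *\<^sub>R ?e))) has_real_derivative 0) (at 0)"
    by (rule has_field_derivative_transform_within_open[
          OF DERIV_const[of "integral UNIV \<phi>"], of "{-1<..<1}"])
      (auto simp: shifted)
  ultimately have "integral (cbox l u) (pd i \<phi>) = 0" by (rule DERIV_unique)
  moreover have "integral (cbox l u) (pd i \<phi>) = integral UNIV (pd i \<phi>)"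
    using sub[of 0] pd_eq_0_outside_support[of _ \<phi> i]
    by (intro integral_eq_integral_UNIV_if_zero_outside) auto
  ultimately show ?thesis by simp
qed

lemma integrable_lborel_continuous_compact_support:
  fixes f :: "'a::euclidean_space \<Rightarrow> 'b::{banach, second_countable_topology}"
  assumes "continuous_on UNIV f" "compact K" "\<And>x. x \<notin> K \<Longrightarrow> f x = 0"
  shows "integrable lborel f"
proof -
  have "integrable lborel (\<lambda>x. indicator K x *\<^sub>R f x)"
    by (intro borel_integrable_compact assms(2) continuous_on_subset[OF assms(1)]) simp
  moreover have "(\<lambda>x. indicator K x *\<^sub>R f x) = f"
    using assms(3) by (auto simp: indicator_def)
  ultimately show ?thesis by (simp only:)
qed

lemma L2_continuous_compact_support:
  fixes f :: "real^'d::finite \<Rightarrow> 'b::euclidean_space"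
  assumes \<Omega>: "\<Omega> \<in> sets lebesgue" and f: "continuous_on UNIV f"
    and K: "compact K" "\<And>x. x \<notin> K \<Longrightarrow> f x = 0"
  shows "L2 \<Omega> f"
  unfolding L2_def
proof
  show "f \<in> borel_measurable (lebesgue_on \<Omega>)"
    by (intro continuous_imp_measurable_on_sets_lebesgue \<Omega> continuous_on_subset[OF f]) simp
  have "integrable lborel (\<lambda>x. (norm (f x))\<^sup>2)"
    using K
    by (intro integrable_lborel_continuous_compact_support[of _ K] continuous_intros f) simp_all
  then have "integrable lebesgue (\<lambda>x. (norm (f x))\<^sup>2)"
    by (simp add: integrable_completion borel_measurable_integrable)
  then show "integrable (lebesgue_on \<Omega>) (\<lambda>x. (norm (f x))\<^sup>2)"
    using \<Omega> integrable_mult_indicator[of \<Omega> lebesgue "\<lambda>x. (norm (f x))\<^sup>2"]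
    by (simp add: integrable_restrict_space)
qed

lemma test_fun_smooth: "test_fun \<Omega> \<phi> \<Longrightarrow> smooth_fun \<phi>"
  by (simp add: test_fun_def)

lemma test_fun_zero_outside: "test_fun \<Omega> \<phi> \<Longrightarrow> x \<notin> \<Omega> \<Longrightarrow> \<phi> x = 0"
  unfolding test_fun_def by (intro eq_0_outside_support[of x \<phi>]) auto

lemma test_fun_smaller_support:
  assumes "test_fun \<Omega> \<phi>" "smooth_fun \<psi>" "closure {x. \<psi> x \<noteq> 0} \<subseteq> closure {x. \<phi> x \<noteq> 0}"
  shows "test_fun \<Omega> \<psi>"
  using assms unfolding test_fun_def compact_eq_bounded_closed by (auto intro: bounded_subset)

lemma test_fun_mult:
  assumes "test_fun \<Omega> \<phi>" "smooth_fun \<psi>"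
  shows "test_fun \<Omega> (\<lambda>x. \<phi> x * \<psi> x)"
  by (rule test_fun_smaller_support[OF assms(1)
      smooth_fun_mult[OF test_fun_smooth[OF assms(1)] assms(2)]])
    (intro closure_mono, auto)

lemma test_fun_pd: "test_fun \<Omega> \<phi> \<Longrightarrow> test_fun \<Omega> (pd i \<phi>)"
  by (rule test_fun_smaller_support[OF _ smooth_fun_pd[OF test_fun_smooth] pd_support])

lemma L2_test_fun:
  assumes "\<Omega> \<in> sets lebesgue" "test_fun \<Omega> \<phi>"
  shows "L2 \<Omega> \<phi>"
proof (rule L2_continuous_compact_support[OF assms(1)])
  show "continuous_on UNIV \<phi>" by (rule smooth_fun_continuous[OF test_fun_smooth[OF assms(2)]])
  show "compact (closure {x. \<phi> x \<noteq> 0})" using assms(2) by (simp add: test_fun_def)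
  show "\<phi> x = 0" if "x \<notin> closure {x. \<phi> x \<noteq> 0}" for x by (rule eq_0_outside_support[OF that])
qed

lemma L2_cgrad:
  assumes "\<Omega> \<in> sets lebesgue" "test_fun \<Omega> \<phi>"
  shows "L2 \<Omega> (cgrad \<phi>)"
proof (rule L2_continuous_compact_support[OF assms(1)])
  show "continuous_on UNIV (cgrad \<phi>)"
    unfolding cgrad_def[abs_def]
    by (intro continuous_on_vec_lambda smooth_fun_continuous smooth_fun_pd
        test_fun_smooth[OF assms(2)])
  show "compact (closure {x. \<phi> x \<noteq> 0})" using assms(2) by (simp add: test_fun_def)
  show "cgrad \<phi> x = 0" if "x \<notin> closure {x. \<phi> x \<noteq> 0}" for x
    using pd_eq_0_outside_support[OF that] by (simp add: cgrad_def vec_eq_iff)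
qed

lemma test_fun_integral_pd_eq_0:
  assumes \<Omega>: "\<Omega> \<in> sets lebesgue" and \<phi>: "test_fun \<Omega> \<phi>"
  shows "(LINT x|lebesgue_on \<Omega>. pd i \<phi> x) = 0"
proof -
  have "continuous_on UNIV (pd i \<phi>)"
    by (rule smooth_fun_continuous[OF smooth_fun_pd[OF test_fun_smooth[OF \<phi>]]])
  have "(LINT x|lebesgue_on \<Omega>. pd i \<phi> x) = (LINT x|lebesgue. pd i \<phi> x)"
    using \<Omega> test_fun_zero_outside[OF test_fun_pd[OF \<phi>]]
    by (simp add: integral_restrict_space)
      (intro Bochner_Integration.integral_cong refl, auto simp: indicator_def)
  also have "\<dots> = (LINT x|lborel. pd i \<phi> x)"
    using \<open>continuous_on UNIV (pd i \<phi>)\<close>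
    by (intro integral_completion) (simp add: borel_measurable_continuous_onI)
  also have "\<dots> = integral UNIV (pd i \<phi>)"
    using \<phi> \<open>continuous_on UNIV (pd i \<phi>)\<close> pd_eq_0_outside_support[of _ \<phi> i]
    by (intro integral_lborel[symmetric]
        integrable_lborel_continuous_compact_support[of _ "closure {x. \<phi> x \<noteq> 0}"])
      (auto simp: test_fun_def)
  also have "\<dots> = 0" using \<phi> by (intro integral_pd_eq_0) (auto simp: test_fun_def)
  finally show ?thesis .
qed

lemma test_fun_integration_by_parts:
  assumes \<Omega>: "\<Omega> \<in> sets lebesgue" and \<phi>: "test_fun \<Omega> \<phi>" and \<psi>: "smooth_fun \<psi>"
  shows "(LINT x|lebesgue_on \<Omega>. \<phi> x * pd i \<psi> x + pd i \<phi> x * \<psi> x) = 0"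
proof -
  have "pd i (\<lambda>x. \<phi> x * \<psi> x) = (\<lambda>x. \<phi> x * pd i \<psi> x + pd i \<phi> x * \<psi> x)"
    using test_fun_smooth[OF \<phi>] \<psi> by (intro ext pd_mult smooth_fun_differentiable)
  then show ?thesis
    using test_fun_integral_pd_eq_0[OF \<Omega> test_fun_mult[OF \<phi> \<psi>], of i] by simp
qed

section \<open>Weak derivatives\<close>

definition weak_adjoint ::
  "(real^'d) set \<Rightarrow> ((real^'d \<Rightarrow> real) \<Rightarrow> real^'d \<Rightarrow> 'b) \<Rightarrow>
    (real^'d::finite \<Rightarrow> 'b::euclidean_space) \<Rightarrow> (real^'d \<Rightarrow> real) \<Rightarrow> bool" where
  "weak_adjoint \<Omega> D f g \<longleftrightarrow> (\<forall>\<phi>. test_fun \<Omega> \<phi> \<longrightarrow> l2ip \<Omega> f (D \<phi>) = - l2ip \<Omega> g \<phi>)"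

lemma is_weak_grad_iff: "is_weak_grad \<Omega> u G \<longleftrightarrow> (\<forall>i. weak_adjoint \<Omega> (pd i) u (\<lambda>x. G x $ i))"
  by (auto simp: is_weak_grad_def weak_adjoint_def l2ip_def)

lemma is_weak_div_iff: "is_weak_div \<Omega> \<sigma> q \<longleftrightarrow> weak_adjoint \<Omega> cgrad \<sigma> q"
  by (simp add: is_weak_div_def weak_adjoint_def l2ip_def)

lemma L2_set_integrable_cbox:
  fixes f :: "real^'d::finite \<Rightarrow> real"
  assumes \<Omega>: "\<Omega> \<in> sets lebesgue" and f: "L2 \<Omega> f"
  shows "set_integrable lebesgue (\<Omega> \<inter> cbox a b) f"
proof -
  let ?I = "indicator (cbox a b) :: real^'d \<Rightarrow> real"
  have int: "integrable lebesgue ?I"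
    by (simp add: lmeasurable_iff_integrable[symmetric])
  then have "integrable (lebesgue_on \<Omega>) ?I"
    using \<Omega> integrable_mult_indicator[of \<Omega> lebesgue ?I] by (simp add: integrable_restrict_space)
  moreover have "(norm (?I x))\<^sup>2 = ?I x" for x by (simp add: indicator_def)
  ultimately have "L2 \<Omega> ?I" unfolding L2_def by (simp only: borel_measurable_integrable)
  then have "integrable (lebesgue_on \<Omega>) (\<lambda>x. ?I x * f x)"
    using L2_integrable_inner[of \<Omega> ?I f] f by simp
  then show ?thesis
    using \<Omega>
    by (simp add: integrable_restrict_space set_integrable_def indicator_inter_arith mult_ac)
qed

locale open_domain =
  fixes \<Omega> :: "(real^'d::finite) set"
  assumes open_domain: "open \<Omega>"
begin

lemma sets_lebesgue: "\<Omega> \<in> sets lebesgue"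
  using open_domain by (simp add: borel_open)

lemmas L2_test = L2_test_fun[OF sets_lebesgue]
  and L2_test_pd = L2_test_fun[OF sets_lebesgue test_fun_pd]
  and L2_test_cgrad = L2_cgrad[OF sets_lebesgue]

lemma L2_eq_AE_if_test_eq:
  assumes "L2 \<Omega> f" "L2 \<Omega> g" "\<And>\<phi>. test_fun \<Omega> \<phi> \<Longrightarrow> l2ip \<Omega> f \<phi> = l2ip \<Omega> g \<phi>"
  shows "AE x in lebesgue_on \<Omega>. f x = g x"
proof -
  have "AE x in lebesgue_on \<Omega>. (f - g) x = 0"
  proof (rule fundamental_lemma_calculus_of_variations[OF open_domain])
    show "set_integrable lebesgue (\<Omega> \<inter> cbox a b) (f - g)" for a b
      by (intro L2_set_integrable_cbox sets_lebesgue L2_diff assms)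
    show "(LINT x|lebesgue_on \<Omega>. (f - g) x * \<phi> x) = 0" if "test_fun \<Omega> \<phi>" for \<phi>
      using L2.ip_diff_left[OF assms(1,2) L2_test[OF that]] assms(3)[OF that]
      by (simp add: l2ip_def)
  qed
  then show ?thesis by eventually_elim simp
qed

lemma weak_adjoint_unique:
  assumes "L2 \<Omega> g" "L2 \<Omega> g'" "weak_adjoint \<Omega> D f g" "weak_adjoint \<Omega> D f g'"
  shows "AE x in lebesgue_on \<Omega>. g x = g' x"
  using assms by (intro L2_eq_AE_if_test_eq) (auto simp: weak_adjoint_def)

lemma weak_adjoint_add_scaleR:
  assumes D: "\<And>\<phi>. test_fun \<Omega> \<phi> \<Longrightarrow> L2 \<Omega> (D \<phi>)"
    and "L2 \<Omega> f" "L2 \<Omega> f'" "L2 \<Omega> g" "L2 \<Omega> g'" "weak_adjoint \<Omega> D f g" "weak_adjoint \<Omega> D f' g'"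
  shows "weak_adjoint \<Omega> D (f + c *\<^sub>R f') (g + c *\<^sub>R g')"
  using assms by (simp add: weak_adjoint_def L2.ip_linear L2_scaleR L2_test D)

lemma weak_adjoint_limit:
  assumes D: "\<And>\<phi>. test_fun \<Omega> \<phi> \<Longrightarrow> L2 \<Omega> (D \<phi>)"
    and f: "\<And>n. L2 \<Omega> (f n)" "L2 \<Omega> f'" "(\<lambda>n. l2norm \<Omega> (f n - f')) \<longlonglongrightarrow> 0"
    and g: "\<And>n. L2 \<Omega> (g n)" "L2 \<Omega> g'" "(\<lambda>n. l2norm \<Omega> (g n - g')) \<longlonglongrightarrow> 0"
    and weak: "\<And>n. weak_adjoint \<Omega> D (f n) (g n)"
  shows "weak_adjoint \<Omega> D f' g'"
  unfolding weak_adjoint_def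
proof (intro allI impI)
  fix \<phi> assume \<phi>: "test_fun \<Omega> \<phi>"
  have "(\<lambda>n. l2ip \<Omega> (f n) (D \<phi>)) \<longlonglongrightarrow> l2ip \<Omega> f' (D \<phi>)"
    by (intro L2.tendsto_ip_left f D \<phi>)
  moreover have "(\<lambda>n. - l2ip \<Omega> (g n) \<phi>) \<longlonglongrightarrow> - l2ip \<Omega> g' \<phi>"
    by (intro tendsto_minus L2.tendsto_ip_left g L2_test \<phi>)
  ultimately show "l2ip \<Omega> f' (D \<phi>) = - l2ip \<Omega> g' \<phi>"
    using weak \<phi> by (simp add: weak_adjoint_def LIMSEQ_unique)
qed

lemma weak_grad_unique:
  assumes "L2 \<Omega> G" "L2 \<Omega> G'" "is_weak_grad \<Omega> u G" "is_weak_grad \<Omega> u G'"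
  shows "AE x in lebesgue_on \<Omega>. G x = G' x"
proof -
  have "AE x in lebesgue_on \<Omega>. \<forall>i\<in>UNIV. G x $ i = G' x $ i"
    using assms unfolding is_weak_grad_iff
    by (intro AE_finite_allI weak_adjoint_unique L2_component) auto
  then show ?thesis by eventually_elim (simp add: vec_eq_iff)
qed

lemma wgrad_weak: "H1 \<Omega> u \<Longrightarrow> L2 \<Omega> (wgrad \<Omega> u) \<and> is_weak_grad \<Omega> u (wgrad \<Omega> u)"
  unfolding H1_def wgrad_def by (rule someI_ex[of "\<lambda>G. L2 \<Omega> G \<and> is_weak_grad \<Omega> u G"]) blast

lemma wdiv_weak: "Hdiv \<Omega> \<sigma> \<Longrightarrow> L2 \<Omega> (wdiv \<Omega> \<sigma>) \<and> is_weak_div \<Omega> \<sigma> (wdiv \<Omega> \<sigma>)"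
  unfolding Hdiv_def wdiv_def by (rule someI_ex[of "\<lambda>q. L2 \<Omega> q \<and> is_weak_div \<Omega> \<sigma> q"]) blast

lemma H1_L2: "H1 \<Omega> u \<Longrightarrow> L2 \<Omega> u" "H1 \<Omega> u \<Longrightarrow> L2 \<Omega> (wgrad \<Omega> u)"
  using wgrad_weak by (auto simp: H1_def)

lemma Hdiv_L2: "Hdiv \<Omega> \<sigma> \<Longrightarrow> L2 \<Omega> \<sigma>" "Hdiv \<Omega> \<sigma> \<Longrightarrow> L2 \<Omega> (wdiv \<Omega> \<sigma>)"
  using wdiv_weak by (auto simp: Hdiv_def)

lemma wgrad_AE_eq:
  assumes "L2 \<Omega> u" "L2 \<Omega> G" "is_weak_grad \<Omega> u G"
  shows "H1 \<Omega> u" "AE x in lebesgue_on \<Omega>. wgrad \<Omega> u x = G x"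
proof -
  show "H1 \<Omega> u" using assms by (auto simp: H1_def)
  then show "AE x in lebesgue_on \<Omega>. wgrad \<Omega> u x = G x"
    using wgrad_weak assms by (intro weak_grad_unique) auto
qed

lemma wdiv_AE_eq:
  assumes "L2 \<Omega> \<sigma>" "L2 \<Omega> q" "is_weak_div \<Omega> \<sigma> q"
  shows "Hdiv \<Omega> \<sigma>" "AE x in lebesgue_on \<Omega>. wdiv \<Omega> \<sigma> x = q x"
proof -
  show "Hdiv \<Omega> \<sigma>" using assms by (auto simp: Hdiv_def)
  then show "AE x in lebesgue_on \<Omega>. wdiv \<Omega> \<sigma> x = q x"
    using wdiv_weak assms by (intro weak_adjoint_unique) (auto simp: is_weak_div_iff)
qed

lemma wgrad_add_scaleR:
  assumes "H1 \<Omega> u" "H1 \<Omega> v"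
  shows "H1 \<Omega> (u + c *\<^sub>R v)"
    "AE x in lebesgue_on \<Omega>. wgrad \<Omega> (u + c *\<^sub>R v) x = wgrad \<Omega> u x + c *\<^sub>R wgrad \<Omega> v x"
proof -
  have "is_weak_grad \<Omega> (u + c *\<^sub>R v) (wgrad \<Omega> u + c *\<^sub>R wgrad \<Omega> v)"
    unfolding is_weak_grad_iff
  proof
    fix i
    have "weak_adjoint \<Omega> (pd i) (u + c *\<^sub>R v) ((\<lambda>x. wgrad \<Omega> u x $ i) + c *\<^sub>R (\<lambda>x. wgrad \<Omega> v x $ i))"
      using assms wgrad_weak
      by (intro weak_adjoint_add_scaleR L2_test_pd H1_L2 L2_component) (auto simp: is_weak_grad_iff)
    then show "weak_adjoint \<Omega> (pd i) (u + c *\<^sub>R v) (\<lambda>x. (wgrad \<Omega> u + c *\<^sub>R wgrad \<Omega> v) x $ i)"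
      by (simp add: weak_adjoint_def l2ip_def)
  qed
  from wgrad_AE_eq[OF _ _ this] show "H1 \<Omega> (u + c *\<^sub>R v)"
    "AE x in lebesgue_on \<Omega>. wgrad \<Omega> (u + c *\<^sub>R v) x = wgrad \<Omega> u x + c *\<^sub>R wgrad \<Omega> v x"
    using assms by (simp_all add: L2_add L2_scaleR H1_L2)
qed

lemma wdiv_add_scaleR:
  assumes "Hdiv \<Omega> \<sigma>" "Hdiv \<Omega> \<tau>"
  shows "Hdiv \<Omega> (\<sigma> + c *\<^sub>R \<tau>)"
    "AE x in lebesgue_on \<Omega>. wdiv \<Omega> (\<sigma> + c *\<^sub>R \<tau>) x = wdiv \<Omega> \<sigma> x + c * wdiv \<Omega> \<tau> x"
proof -
  have "is_weak_div \<Omega> (\<sigma> + c *\<^sub>R \<tau>) (wdiv \<Omega> \<sigma> + c *\<^sub>R wdiv \<Omega> \<tau>)"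
    using assms wdiv_weak unfolding is_weak_div_iff
    by (intro weak_adjoint_add_scaleR L2_test_cgrad Hdiv_L2) auto
  from wdiv_AE_eq[OF _ _ this] show "Hdiv \<Omega> (\<sigma> + c *\<^sub>R \<tau>)"
    "AE x in lebesgue_on \<Omega>. wdiv \<Omega> (\<sigma> + c *\<^sub>R \<tau>) x = wdiv \<Omega> \<sigma> x + c * wdiv \<Omega> \<tau> x"
    using assms by (simp_all add: L2_add L2_scaleR Hdiv_L2)
qed

lemma H1_zero: "H1 \<Omega> 0"
  using L2_zero unfolding H1_def is_weak_grad_def by (auto intro!: exI[of _ 0] simp: zero_fun_def)

lemma Hdiv_zero: "Hdiv \<Omega> 0"
  using L2_zero unfolding Hdiv_def is_weak_div_def by (auto intro!: exI[of _ 0] simp: zero_fun_def)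

lemma subspace_H1: "subspace {u. H1 \<Omega> u}"
  using wgrad_add_scaleR(1)[where c = 1] wgrad_add_scaleR(1)[where u = 0]
  by (auto simp: subspace_def H1_zero)

lemma subspace_Hdiv: "subspace {\<sigma>. Hdiv \<Omega> \<sigma>}"
  using wdiv_add_scaleR(1)[where c = 1] wdiv_add_scaleR(1)[where \<sigma> = 0]
  by (auto simp: subspace_def Hdiv_zero)

sublocale H1: AE_linear \<Omega> "{u. H1 \<Omega> u}" "\<lambda>u x. (u x, wgrad \<Omega> u x)"
  rewrites "\<And>u. u \<in> {u. H1 \<Omega> u} \<equiv> H1 \<Omega> u"
proof -
  show "AE_linear \<Omega> {u. H1 \<Omega> u} (\<lambda>u x. (u x, wgrad \<Omega> u x))"
  proof
    show "AE x in lebesgue_on \<Omega>. ((u + c *\<^sub>R v) x, wgrad \<Omega> (u + c *\<^sub>R v) x)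
        = (u x, wgrad \<Omega> u x) + c *\<^sub>R (v x, wgrad \<Omega> v x)"
      if "u \<in> {u. H1 \<Omega> u}" "v \<in> {u. H1 \<Omega> u}" for u v c
      using wgrad_add_scaleR(2)[of u v c] that by (auto elim: eventually_mono)
  qed (simp_all add: subspace_H1 L2_Pair H1_L2)
qed simp

sublocale Hdiv: AE_linear \<Omega> "{\<sigma>. Hdiv \<Omega> \<sigma>}" "\<lambda>\<sigma> x. (\<sigma> x, wdiv \<Omega> \<sigma> x)"
  rewrites "\<And>\<sigma>. \<sigma> \<in> {\<sigma>. Hdiv \<Omega> \<sigma>} \<equiv> Hdiv \<Omega> \<sigma>"
proof -
  show "AE_linear \<Omega> {\<sigma>. Hdiv \<Omega> \<sigma>} (\<lambda>\<sigma> x. (\<sigma> x, wdiv \<Omega> \<sigma> x))"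
  proof
    show "AE x in lebesgue_on \<Omega>. ((\<sigma> + c *\<^sub>R \<tau>) x, wdiv \<Omega> (\<sigma> + c *\<^sub>R \<tau>) x)
        = (\<sigma> x, wdiv \<Omega> \<sigma> x) + c *\<^sub>R (\<tau> x, wdiv \<Omega> \<tau> x)"
      if "\<sigma> \<in> {\<sigma>. Hdiv \<Omega> \<sigma>}" "\<tau> \<in> {\<sigma>. Hdiv \<Omega> \<sigma>}" for \<sigma> \<tau> c
      using wdiv_add_scaleR(2)[of \<sigma> \<tau> c] that by (auto elim: eventually_mono)
  qed (simp_all add: subspace_Hdiv L2_Pair Hdiv_L2)
qed simp

lemma H1_seminorm_square:
  assumes "H1 \<Omega> u"
  shows "(H1.seminorm u)\<^sup>2 = (l2norm \<Omega> u)\<^sup>2 + (l2norm \<Omega> (wgrad \<Omega> u))\<^sup>2"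
  using H1_L2[OF assms] assms by (simp add: H1.seminorm_square l2ip_Pair L2.seminorm_square)

lemma Hdiv_seminorm_square:
  assumes "Hdiv \<Omega> \<sigma>"
  shows "(Hdiv.seminorm \<sigma>)\<^sup>2 = (l2norm \<Omega> \<sigma>)\<^sup>2 + (l2norm \<Omega> (wdiv \<Omega> \<sigma>))\<^sup>2"
  using Hdiv_L2[OF assms] assms by (simp add: Hdiv.seminorm_square l2ip_Pair L2.seminorm_square)

lemma l2norm_le_H1_seminorm:
  assumes "H1 \<Omega> u"
  shows "l2norm \<Omega> u \<le> H1.seminorm u" "l2norm \<Omega> (wgrad \<Omega> u) \<le> H1.seminorm u"
  using H1_seminorm_square[OF assms] H1.seminorm_nonneg[OF assms]
  by (auto intro: power2_le_imp_le)

lemma H1_norm_eq: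
  assumes "H1 \<Omega> u"
  shows "H1_norm \<Omega> u = H1.seminorm u"
proof -
  have "H1_norm \<Omega> u = sqrt ((H1.seminorm u)\<^sup>2)"
    by (simp add: H1_norm_def H1_seminorm_square[OF assms] L2.seminorm_square H1_L2 assms)
  then show ?thesis using H1.seminorm_nonneg[OF assms] by simp
qed

lemma H1_complete: "complete_wrt H1.seminorm {u. H1 \<Omega> u}"
proof (rule H1.complete_if_closed_graph)
  fix u and y :: "real^'d \<Rightarrow> real \<times> (real^'d)"
  assume u: "\<And>n. H1 \<Omega> (u n)" and y: "L2 \<Omega> y"
    and lim: "(\<lambda>n. l2norm \<Omega> ((\<lambda>x. (u n x, wgrad \<Omega> (u n) x)) - y)) \<longlonglongrightarrow> 0"
  have weak: "is_weak_grad \<Omega> (\<lambda>x. fst (y x)) (\<lambda>x. snd (y x))"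
    unfolding is_weak_grad_iff
  proof
    fix i
    have i: "bounded_linear (\<lambda>p::real \<times> (real^'d). snd p $ i)"
      by (intro bounded_linear_compose[OF bounded_linear_vec_nth] bounded_linear_snd)
    show "weak_adjoint \<Omega> (pd i) (\<lambda>x. fst (y x)) (\<lambda>x. snd (y x) $ i)"
    proof (rule weak_adjoint_limit[where f = u and g = "\<lambda>n x. wgrad \<Omega> (u n) x $ i"])
      show "(\<lambda>n. l2norm \<Omega> (u n - (\<lambda>x. fst (y x)))) \<longlonglongrightarrow> 0"
        using l2norm_bounded_linear_tendsto[OF bounded_linear_fst H1.L2_T y lim] u by simp
      show "(\<lambda>n. l2norm \<Omega> ((\<lambda>x. wgrad \<Omega> (u n) x $ i) - (\<lambda>x. snd (y x) $ i))) \<longlonglongrightarrow> 0"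
        using l2norm_bounded_linear_tendsto[OF i H1.L2_T y lim] u by simp
      show "weak_adjoint \<Omega> (pd i) (u n) (\<lambda>x. wgrad \<Omega> (u n) x $ i)" for n
        using wgrad_weak[OF u] by (simp add: is_weak_grad_iff)
    qed (intro L2_test_pd H1_L2 u L2_component L2_fst L2_snd y | assumption)+
  qed
  note v = wgrad_AE_eq[OF L2_fst[OF y] L2_snd[OF y] weak]
  have "AE x in lebesgue_on \<Omega>. (fst (y x), wgrad \<Omega> (\<lambda>x. fst (y x)) x) = y x"
    using v(2) by eventually_elim simp
  then show "\<exists>v\<in>{u. H1 \<Omega> u}. AE x in lebesgue_on \<Omega>. (v x, wgrad \<Omega> v x) = y x"
    using v(1) by (intro bexI[of _ "\<lambda>x. fst (y x)"]) simp_all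
qed

lemma Hdiv_complete: "complete_wrt Hdiv.seminorm {\<sigma>. Hdiv \<Omega> \<sigma>}"
proof (rule Hdiv.complete_if_closed_graph)
  fix \<sigma> and y :: "real^'d \<Rightarrow> (real^'d) \<times> real"
  assume \<sigma>: "\<And>n. Hdiv \<Omega> (\<sigma> n)" and y: "L2 \<Omega> y"
    and lim: "(\<lambda>n. l2norm \<Omega> ((\<lambda>x. (\<sigma> n x, wdiv \<Omega> (\<sigma> n) x)) - y)) \<longlonglongrightarrow> 0"
  have weak: "is_weak_div \<Omega> (\<lambda>x. fst (y x)) (\<lambda>x. snd (y x))"
    unfolding is_weak_div_iff
  proof (rule weak_adjoint_limit[where f = \<sigma> and g = "\<lambda>n. wdiv \<Omega> (\<sigma> n)"])
    show "(\<lambda>n. l2norm \<Omega> (\<sigma> n - (\<lambda>x. fst (y x)))) \<longlonglongrightarrow> 0"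
      using l2norm_bounded_linear_tendsto[OF bounded_linear_fst Hdiv.L2_T y lim] \<sigma> by simp
    show "(\<lambda>n. l2norm \<Omega> (wdiv \<Omega> (\<sigma> n) - (\<lambda>x. snd (y x)))) \<longlonglongrightarrow> 0"
      using l2norm_bounded_linear_tendsto[OF bounded_linear_snd Hdiv.L2_T y lim] \<sigma> by simp
    show "weak_adjoint \<Omega> cgrad (\<sigma> n) (wdiv \<Omega> (\<sigma> n))" for n
      using wdiv_weak[OF \<sigma>] by (simp add: is_weak_div_iff)
  qed (intro L2_test_cgrad Hdiv_L2 \<sigma> L2_fst L2_snd y | assumption)+
  note \<tau> = wdiv_AE_eq[OF L2_fst[OF y] L2_snd[OF y] weak]
  have "AE x in lebesgue_on \<Omega>. (fst (y x), wdiv \<Omega> (\<lambda>x. fst (y x)) x) = y x"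
    using \<tau>(2) by eventually_elim simp
  then show "\<exists>\<tau>\<in>{\<sigma>. Hdiv \<Omega> \<sigma>}. AE x in lebesgue_on \<Omega>. (\<tau> x, wdiv \<Omega> \<tau> x) = y x"
    using \<tau>(1) by (intro bexI[of _ "\<lambda>x. fst (y x)"]) simp_all
qed

lemma test_fun_is_weak_grad:
  assumes "test_fun \<Omega> \<psi>"
  shows "is_weak_grad \<Omega> \<psi> (cgrad \<psi>)"
  unfolding is_weak_grad_iff weak_adjoint_def
proof (intro allI impI)
  fix \<phi> i assume \<phi>: "test_fun \<Omega> \<phi>"
  have "integrable (lebesgue_on \<Omega>) (\<lambda>x. \<psi> x * pd i \<phi> x)"
    "integrable (lebesgue_on \<Omega>) (\<lambda>x. pd i \<psi> x * \<phi> x)"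
    using L2_integrable_inner[OF L2_test[OF assms] L2_test_pd[OF \<phi>]]
      L2_integrable_inner[OF L2_test_pd[OF assms] L2_test[OF \<phi>]] by simp_all
  then show "l2ip \<Omega> \<psi> (pd i \<phi>) = - l2ip \<Omega> (\<lambda>x. cgrad \<psi> x $ i) \<phi>"
    using test_fun_integration_by_parts[OF sets_lebesgue assms test_fun_smooth[OF \<phi>], of i]
    by (simp add: l2ip_def cgrad_def)
qed

lemma test_fun_H1:
  assumes "test_fun \<Omega> \<phi>"
  shows "H1 \<Omega> \<phi>" "AE x in lebesgue_on \<Omega>. wgrad \<Omega> \<phi> x = cgrad \<phi> x"
  by (rule wgrad_AE_eq[OF L2_test[OF assms] L2_test_cgrad[OF assms]
      test_fun_is_weak_grad[OF assms]])+

lemma H10_H1: "H10 \<Omega> u \<Longrightarrow> H1 \<Omega> u"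
  by (simp add: H10_def)

lemma H10_iff:
  "H10 \<Omega> u \<longleftrightarrow> H1 \<Omega> u \<and> (\<exists>\<phi>. (\<forall>j. test_fun \<Omega> (\<phi> j)) \<and> (\<lambda>j. H1.seminorm (u - \<phi> j)) \<longlonglongrightarrow> 0)"
proof -
  have "H1_norm \<Omega> (\<lambda>x. u x - \<phi> x) = H1.seminorm (u - \<phi>)" if "H1 \<Omega> u" "test_fun \<Omega> \<phi>" for \<phi>
    using H1_norm_eq[OF H1.diff_in[OF that(1) test_fun_H1(1)[OF that(2)]]]
    by (simp only: fun_diff_def)
  then show ?thesis unfolding H10_def by (auto cong: conj_cong)
qed

lemma H10_closed:
  assumes u: "\<And>n. H10 \<Omega> (u n)" and v: "H1 \<Omega> v" and lim: "(\<lambda>n. H1.seminorm (u n - v)) \<longlonglongrightarrow> 0"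
  shows "H10 \<Omega> v"
proof -
  have "\<exists>\<phi>. test_fun \<Omega> \<phi> \<and> H1.seminorm (u n - \<phi>) < inverse (real (Suc n))" for n
  proof -
    obtain \<phi> where \<phi>: "\<And>j. test_fun \<Omega> (\<phi> j)" "(\<lambda>j. H1.seminorm (u n - \<phi> j)) \<longlonglongrightarrow> 0"
      using u[of n] by (auto simp: H10_iff)
    have "\<forall>\<^sub>F j in sequentially. H1.seminorm (u n - \<phi> j) < inverse (real (Suc n))"
      by (rule order_tendstoD(2)[OF \<phi>(2)]) simp
    then obtain j where "H1.seminorm (u n - \<phi> j) < inverse (real (Suc n))"
      using eventually_happens'[OF sequentially_bot] by blast
    then show ?thesis using \<phi>(1) by blast
  qed
  then obtain \<phi> where \<phi>: "\<And>n. test_fun \<Omega> (\<phi> n)"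
    "\<And>n. H1.seminorm (u n - \<phi> n) < inverse (real (Suc n))"
    using choice[of "\<lambda>n \<phi>. test_fun \<Omega> \<phi> \<and> H1.seminorm (u n - \<phi>) < inverse (real (Suc n))"] by blast
  have "(\<lambda>n. H1.seminorm (v - \<phi> n)) \<longlonglongrightarrow> 0"
  proof (rule tendsto_0_le_bound)
    show "(\<lambda>n. H1.seminorm (u n - v) + inverse (real (Suc n))) \<longlonglongrightarrow> 0"
      using tendsto_add[OF lim LIMSEQ_inverse_real_of_nat] by simp
    fix n
    note H1 = v H10_H1[OF u[of n]] test_fun_H1(1)[OF \<phi>(1)[of n]]
    show "0 \<le> H1.seminorm (v - \<phi> n)" by (intro H1.seminorm_nonneg H1.in_subspace H1)
    show "H1.seminorm (v - \<phi> n) \<le> H1.seminorm (u n - v) + inverse (real (Suc n))"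
      using H1.seminorm_triangle_via[OF H1] H1.seminorm_diff_commute[OF H1(1,2)] \<phi>(2)[of n]
      by linarith
  qed
  then show ?thesis using v \<phi>(1) by (auto simp: H10_iff)
qed

lemma H10_approx:
  assumes "H10 \<Omega> u"
  obtains \<phi> where "\<And>j. test_fun \<Omega> (\<phi> j)" "(\<lambda>j. l2norm \<Omega> (\<phi> j - u)) \<longlonglongrightarrow> 0"
    "(\<lambda>j. l2norm \<Omega> (cgrad (\<phi> j) - wgrad \<Omega> u)) \<longlonglongrightarrow> 0"
proof -
  obtain \<phi> where \<phi>: "\<And>j. test_fun \<Omega> (\<phi> j)" and lim: "(\<lambda>j. H1.seminorm (u - \<phi> j)) \<longlonglongrightarrow> 0"
    using assms by (auto simp: H10_iff)
  have H1: "H1 \<Omega> u" "H1 \<Omega> (\<phi> j)" "H1 \<Omega> (u - \<phi> j)" for j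
    using assms \<phi> by (simp_all add: H10_H1 test_fun_H1(1) H1.in_subspace)
  have grad: "l2norm \<Omega> (cgrad (\<phi> j) - wgrad \<Omega> u) = l2norm \<Omega> (wgrad \<Omega> (u - \<phi> j))" for j
  proof -
    have "AE x in lebesgue_on \<Omega>. (wgrad \<Omega> u - cgrad (\<phi> j)) x = wgrad \<Omega> (u - \<phi> j) x"
      using H1.T_diff_AE[OF H1(1) H1(2)[of j]] test_fun_H1(2)[OF \<phi>[of j]] by eventually_elim simp
    then have "l2norm \<Omega> (wgrad \<Omega> u - cgrad (\<phi> j)) = l2norm \<Omega> (wgrad \<Omega> (u - \<phi> j))"
      by (intro l2norm_cong_AE L2_diff H1_L2 H1 L2_test_cgrad \<phi>)
    then show ?thesis
      using L2.seminorm_diff_commute[OF H1_L2(2)[OF H1(1)] L2_test_cgrad[OF \<phi>]] by simp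
  qed
  show thesis
  proof (rule that[OF \<phi>])
    show "(\<lambda>j. l2norm \<Omega> (\<phi> j - u)) \<longlonglongrightarrow> 0"
    proof (rule tendsto_0_le_bound[OF lim])
      show "l2norm \<Omega> (\<phi> j - u) \<le> H1.seminorm (u - \<phi> j)" for j
        using L2.seminorm_diff_commute[OF H1_L2(1)[OF H1(2)] H1_L2(1)[OF H1(1)]]
        by (simp add: l2norm_le_H1_seminorm[OF H1(3)])
    qed (intro L2.seminorm_nonneg L2_diff H1_L2 H1)
    show "(\<lambda>j. l2norm \<Omega> (cgrad (\<phi> j) - wgrad \<Omega> u)) \<longlonglongrightarrow> 0"
    proof (rule tendsto_0_le_bound[OF lim])
      show "l2norm \<Omega> (cgrad (\<phi> j) - wgrad \<Omega> u) \<le> H1.seminorm (u - \<phi> j)" for j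
        by (simp add: grad l2norm_le_H1_seminorm[OF H1(3)])
    qed (intro L2.seminorm_nonneg L2_diff H1_L2 H1 L2_test_cgrad \<phi>)
  qed
qed

lemma wdiv_Green:
  assumes u: "H10 \<Omega> u" and \<sigma>: "Hdiv \<Omega> \<sigma>"
  shows "l2ip \<Omega> (wdiv \<Omega> \<sigma>) u = - l2ip \<Omega> \<sigma> (wgrad \<Omega> u)"
proof -
  obtain \<phi> where \<phi>: "\<And>j. test_fun \<Omega> (\<phi> j)" and lim: "(\<lambda>j. l2norm \<Omega> (\<phi> j - u)) \<longlonglongrightarrow> 0"
    "(\<lambda>j. l2norm \<Omega> (cgrad (\<phi> j) - wgrad \<Omega> u)) \<longlonglongrightarrow> 0"
    using H10_approx[OF u] by blast
  note u_L2 = H1_L2[OF H10_H1[OF u]] and \<sigma>_L2 = Hdiv_L2[OF \<sigma>]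
  have "(\<lambda>j. l2ip \<Omega> \<sigma> (cgrad (\<phi> j))) \<longlonglongrightarrow> l2ip \<Omega> \<sigma> (wgrad \<Omega> u)"
    by (intro L2.tendsto_ip_right L2_test_cgrad \<phi> u_L2 \<sigma>_L2 lim)
  moreover have "(\<lambda>j. - l2ip \<Omega> (wdiv \<Omega> \<sigma>) (\<phi> j)) \<longlonglongrightarrow> - l2ip \<Omega> (wdiv \<Omega> \<sigma>) u"
    by (intro tendsto_minus L2.tendsto_ip_right L2_test \<phi> u_L2 \<sigma>_L2 lim)
  ultimately have "l2ip \<Omega> \<sigma> (wgrad \<Omega> u) = - l2ip \<Omega> (wdiv \<Omega> \<sigma>) u"
    using wdiv_weak[OF \<sigma>] \<phi> by (simp add: is_weak_div_iff weak_adjoint_def LIMSEQ_unique)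
  then show ?thesis by simp
qed

lemma test_fun_convection:
  assumes weak: "is_weak_div \<Omega> \<beta> q" and \<phi>: "test_fun \<Omega> \<phi>"
  shows "2 * l2ip \<Omega> (\<lambda>x. \<beta> x \<bullet> cgrad \<phi> x) \<phi> = - l2ip \<Omega> (\<lambda>x. q x * \<phi> x) \<phi>"
proof -
  have cgrad: "cgrad (\<lambda>x. \<phi> x * \<phi> x) x = (2 * \<phi> x) *\<^sub>R cgrad \<phi> x" for x
    by (simp add: cgrad_def vec_eq_iff pd_mult smooth_fun_differentiable[OF test_fun_smooth[OF \<phi>]])
  have "l2ip \<Omega> \<beta> (cgrad (\<lambda>x. \<phi> x * \<phi> x)) = - l2ip \<Omega> q (\<lambda>x. \<phi> x * \<phi> x)"
    using weak test_fun_mult[OF \<phi> test_fun_smooth[OF \<phi>]]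
    by (simp add: is_weak_div_iff weak_adjoint_def)
  moreover have "l2ip \<Omega> \<beta> (cgrad (\<lambda>x. \<phi> x * \<phi> x))
      = (LINT x|lebesgue_on \<Omega>. 2 * ((\<beta> x \<bullet> cgrad \<phi> x) * \<phi> x))"
    unfolding l2ip_def by (rule Bochner_Integration.integral_cong) (auto simp: cgrad)
  ultimately show ?thesis by (simp add: l2ip_def mult.assoc)
qed

lemma convection_Green:
  assumes u: "H10 \<Omega> u" and \<beta>: "Linf \<Omega> \<beta>" and q: "Linf \<Omega> q" and weak: "is_weak_div \<Omega> \<beta> q"
  shows "2 * l2ip \<Omega> (\<lambda>x. \<beta> x \<bullet> wgrad \<Omega> u x) u = - l2ip \<Omega> (\<lambda>x. q x * u x) u"
proof -
  obtain \<phi> where \<phi>: "\<And>j. test_fun \<Omega> (\<phi> j)" and lim: "(\<lambda>j. l2norm \<Omega> (\<phi> j - u)) \<longlonglongrightarrow> 0"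
    "(\<lambda>j. l2norm \<Omega> (cgrad (\<phi> j) - wgrad \<Omega> u)) \<longlonglongrightarrow> 0"
    using H10_approx[OF u] by blast
  note u_L2 = H1_L2[OF H10_H1[OF u]]
  note inner_L2 = L2_Linf_bilinear[OF bounded_bilinear_inner \<beta>]
    and mult_L2 = L2_Linf_bilinear[OF bounded_bilinear_mult q]
  have "(\<lambda>j. 2 * l2ip \<Omega> (\<lambda>x. \<beta> x \<bullet> cgrad (\<phi> j) x) (\<phi> j)) \<longlonglongrightarrow> 2 * l2ip \<Omega> (\<lambda>x. \<beta> x \<bullet> wgrad \<Omega> u x) u"
    by (intro tendsto_mult tendsto_const L2.tendsto_ip inner_L2 u_L2 L2_test_cgrad L2_test \<phi> lim
        l2norm_Linf_bilinear_tendsto[OF bounded_bilinear_inner \<beta>])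
  moreover have "(\<lambda>j. - l2ip \<Omega> (\<lambda>x. q x * \<phi> j x) (\<phi> j)) \<longlonglongrightarrow> - l2ip \<Omega> (\<lambda>x. q x * u x) u"
    by (intro tendsto_minus L2.tendsto_ip mult_L2 u_L2 L2_test \<phi> lim
        l2norm_Linf_bilinear_tendsto[OF bounded_bilinear_mult q])
  ultimately show ?thesis
    by (simp add: test_fun_convection[OF weak \<phi>] LIMSEQ_unique)
qed

lemma U_space_D:
  assumes "v \<in> U_space \<Omega>"
  shows "H10 \<Omega> (fst v)" "H1 \<Omega> (fst v)" "Hdiv \<Omega> (snd v)"
  using assms by (auto simp: U_space_def H10_H1)

lemma U_norm_eq:
  assumes "H1 \<Omega> (fst w)" "Hdiv \<Omega> (snd w)"
  shows "U_norm \<Omega> w = sqrt ((H1.seminorm (fst w))\<^sup>2 + (Hdiv.seminorm (snd w))\<^sup>2)"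
  using assms
  by (simp add: U_norm_def H1_seminorm_square Hdiv_seminorm_square L2.seminorm_square H1_L2 Hdiv_L2)

lemma U_space_complete: "complete_wrt (U_norm \<Omega>) (U_space \<Omega>)"
  unfolding complete_wrt_def
proof (intro allI impI)
  fix X :: "nat \<Rightarrow> 'd Uelem" assume "\<forall>n. X n \<in> U_space \<Omega>" and Cauchy: "Cauchy_wrt (U_norm \<Omega>) X"
  then have X: "\<And>n. X n \<in> U_space \<Omega>" by blast
  note D = U_space_D[OF X]
  have norm_diff: "U_norm \<Omega> (X n - w) = sqrt ((H1.seminorm (fst (X n) - fst w))\<^sup>2
      + (Hdiv.seminorm (snd (X n) - snd w))\<^sup>2)" if "H1 \<Omega> (fst w)" "Hdiv \<Omega> (snd w)" for n w
    using D that by (simp add: U_norm_eq H1.in_subspace Hdiv.in_subspace)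
  have "Cauchy_wrt H1.seminorm (\<lambda>n. fst (X n))" "Cauchy_wrt Hdiv.seminorm (\<lambda>n. snd (X n))"
    by (rule Cauchy_wrt_mono[OF Cauchy, of _ _ 1]; simp add: norm_diff D real_le_rsqrt)+
  then obtain u \<sigma> where u: "H1 \<Omega> u" "(\<lambda>n. H1.seminorm (fst (X n) - u)) \<longlonglongrightarrow> 0"
    and \<sigma>: "Hdiv \<Omega> \<sigma>" "(\<lambda>n. Hdiv.seminorm (snd (X n) - \<sigma>)) \<longlonglongrightarrow> 0"
    using H1_complete[unfolded complete_wrt_def, rule_format, of "\<lambda>n. fst (X n)"]
      Hdiv_complete[unfolded complete_wrt_def, rule_format, of "\<lambda>n. snd (X n)"] D by auto
  have "(u, \<sigma>) \<in> U_space \<Omega>"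
    using H10_closed[OF D(1) u] \<sigma>(1) by (simp add: U_space_def)
  moreover have "(\<lambda>n. U_norm \<Omega> (X n - (u, \<sigma>))) \<longlonglongrightarrow> 0"
    using tendsto_real_sqrt[OF tendsto_add[
          OF tendsto_power[OF u(2), of 2] tendsto_power[OF \<sigma>(2), of 2]]]
      u(1) \<sigma>(1) by (simp add: norm_diff)
  ultimately show "\<exists>w\<in>U_space \<Omega>. (\<lambda>n. U_norm \<Omega> (X n - w)) \<longlonglongrightarrow> 0" by blast
qed

end

section \<open>The least-squares problem\<close>

lemma U_diff_eq: "U_diff v w = v - w"
  by (simp add: U_diff_def prod_eq_iff fun_eq_iff)

lemma closed_subspace_U_subspace:
  assumes "closed_subspace_U \<Omega> V"
  shows "subspace V" "V \<subseteq> U_space \<Omega>"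
proof -
  have "((\<lambda>x. fst v x + fst w x), (\<lambda>x. snd v x + snd w x)) = v + w"
    "((\<lambda>x. c * fst v x), (\<lambda>x. c *\<^sub>R snd v x)) = c *\<^sub>R v"
    "((\<lambda>x. 0), (\<lambda>x. 0)) = (0 :: 'a Uelem)" for v w :: "'a Uelem" and c
    by (simp_all add: prod_eq_iff fun_eq_iff)
  then show "subspace V" "V \<subseteq> U_space \<Omega>"
    using assms unfolding closed_subspace_U_def subspace_def by simp_all
qed

lemma (in open_domain) closed_subspace_U_complete:
  assumes V: "closed_subspace_U \<Omega> V"
  shows "complete_wrt (U_norm \<Omega>) V"
  unfolding complete_wrt_def
proof (intro allI impI)
  fix X assume X: "\<forall>n. X n \<in> V" and "Cauchy_wrt (U_norm \<Omega>) X"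
  then obtain w where w: "w \<in> U_space \<Omega>" "(\<lambda>n. U_norm \<Omega> (X n - w)) \<longlonglongrightarrow> 0"
    using U_space_complete closed_subspace_U_subspace(2)[OF V] unfolding complete_wrt_def by blast
  then have "w \<in> V" using V X unfolding closed_subspace_U_def U_diff_eq by blast
  then show "\<exists>w\<in>V. (\<lambda>n. U_norm \<Omega> (X n - w)) \<longlonglongrightarrow> 0" using w(2) by blast
qed

lemma sum_squares_le_imp_bounds:
  fixes a b r :: real
  assumes "0 \<le> a" "0 \<le> b" "0 \<le> r" "a\<^sup>2 + b\<^sup>2 \<le> r * (a + b)"
  shows "a \<le> 2 * r" "b \<le> 2 * r"
proof -
  have "(a - r / 2)\<^sup>2 + (b - r / 2)\<^sup>2 \<le> r\<^sup>2 / 2"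
    using assms(4) by (simp add: power2_eq_square field_simps)
  then have "(a - r / 2)\<^sup>2 \<le> r\<^sup>2" "(b - r / 2)\<^sup>2 \<le> r\<^sup>2"
    using zero_le_power2[of "a - r / 2"] zero_le_power2[of "b - r / 2"] zero_le_power2[of r]
    by linarith+
  then have "a - r / 2 \<le> r" "b - r / 2 \<le> r"
    using assms(3) power2_le_imp_le by blast+
  then show "a \<le> 2 * r" "b \<le> 2 * r" using assms(3) by linarith+
qed

lemma bounded_dependent_choice:
  assumes "I x" and step: "\<And>n y. n < N \<Longrightarrow> I y \<Longrightarrow> \<exists>z. I z \<and> R n y z"
  shows "\<exists>f. f 0 = x \<and> (\<forall>n<N. R n (f n) (f (Suc n)))"
proof -
  have "\<exists>f. \<forall>n. ((n = 0 \<longrightarrow> f n = x) \<and> (n \<le> N \<longrightarrow> I (f n))) \<and> (n < N \<longrightarrow> R n (f n) (f (Suc n)))"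
  proof (rule dependent_nat_choice)
    fix y n assume "(n = 0 \<longrightarrow> y = x) \<and> (n \<le> N \<longrightarrow> I y)"
    then show "\<exists>z. ((Suc n = 0 \<longrightarrow> z = x) \<and> (Suc n \<le> N \<longrightarrow> I z)) \<and> (n < N \<longrightarrow> R n y z)"
      using step[of n y] by (cases "n < N") auto
  qed (use assms(1) in blast)
  then show ?thesis by blast
qed

locale convection_diffusion = open_domain \<Omega> for \<Omega> :: "(real^'d::finite) set" +
  fixes A :: "real^'d \<Rightarrow> real^'d^'d" and \<beta> :: "real^'d \<Rightarrow> real^'d" and \<gamma> q :: "real^'d \<Rightarrow> real"
    and \<alpha> :: real
  assumes Linf_A: "Linf \<Omega> A" and \<alpha>_pos: "0 < \<alpha>"
    and A_elliptic: "AE x in lebesgue_on \<Omega>. elliptic \<alpha> (A x)"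
    and Linf_\<beta>: "Linf \<Omega> \<beta>" and Linf_\<gamma>: "Linf \<Omega> \<gamma>" and Linf_q: "Linf \<Omega> q"
    and div_\<beta>: "is_weak_div \<Omega> \<beta> q" and reaction_nonneg: "AE x in lebesgue_on \<Omega>. 0 \<le> q x / 2 + \<gamma> x"
begin

definition sqrt_grad :: "'d Uelem \<Rightarrow> real^'d \<Rightarrow> real^'d" where
  "sqrt_grad v x = mat_sqrt (A x) *v wgrad \<Omega> (fst v) x"

definition step_residual :: "real \<Rightarrow> 'd Uelem \<Rightarrow> real^'d \<Rightarrow> real" where
  "step_residual k v = (1 / k) *\<^sub>R fst v + Lop \<Omega> \<beta> \<gamma> v"

definition residual :: "real \<Rightarrow> 'd Uelem \<Rightarrow> real^'d \<Rightarrow> real \<times> (real^'d)" where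
  "residual k v x = (sqrt k * step_residual k v x, flux \<Omega> A v x)"

abbreviation residual_norm :: "real \<Rightarrow> 'd Uelem \<Rightarrow> real" where
  "residual_norm k v \<equiv> l2norm \<Omega> (residual k v)"

lemma Lop_eq: "Lop \<Omega> \<beta> \<gamma> v
    = (\<lambda>x. \<gamma> x * fst v x) - wdiv \<Omega> (snd v) - (\<lambda>x. \<beta> x \<bullet> wgrad \<Omega> (fst v) x)"
  by (simp add: Lop_def fun_eq_iff)

lemma flux_eq: "flux \<Omega> A v = sqrt_grad v - (\<lambda>x. matrix_inv (mat_sqrt (A x)) *v snd v x)"
  by (simp add: flux_def sqrt_grad_def fun_eq_iff)

lemma residual_eq: "residual k v = (\<lambda>x. ((sqrt k *\<^sub>R step_residual k v) x, flux \<Omega> A v x))"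
  by (simp add: residual_def fun_eq_iff)

lemma Linf_mat_sqrt:
  "Linf \<Omega> (\<lambda>x. mat_sqrt (A x))" "Linf \<Omega> (\<lambda>x. matrix_inv (mat_sqrt (A x)))"
  using A_elliptic
  by (auto intro!: Linf_continuous_compose[OF sets_lebesgue Linf_A closed_elliptic[of \<alpha>]]
      continuous_on_mat_sqrt continuous_on_matrix_inv_mat_sqrt \<alpha>_pos)

lemma mat_sqrt_AE:
  "AE x in lebesgue_on \<Omega>. transpose (mat_sqrt (A x)) = mat_sqrt (A x) \<and> invertible (mat_sqrt (A x))"
  using A_elliptic
proof eventually_elim
  case (elim x)
  have "elliptic (sqrt \<alpha>) (mat_sqrt (A x))" by (rule mat_sqrt_elliptic(2)[OF elim \<alpha>_pos])
  then show ?case using elliptic_symmetric elliptic_invertible \<alpha>_pos real_sqrt_gt_zero by blast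
qed

lemmas bounded_mat_sqrt = bounded_bilinear_matrix_vector_mult Linf_mat_sqrt(1)
  and bounded_mat_sqrt_inv = bounded_bilinear_matrix_vector_mult Linf_mat_sqrt(2)
  and bounded_\<beta> = bounded_bilinear_inner Linf_\<beta>
  and bounded_\<gamma> = bounded_bilinear_mult Linf_\<gamma>
  and bounded_q = bounded_bilinear_mult Linf_q

lemma controlled_by_U_norm:
  "controlled_on \<Omega> (U_space \<Omega>) (U_norm \<Omega>) fst"
  "controlled_on \<Omega> (U_space \<Omega>) (U_norm \<Omega>) (\<lambda>v. wgrad \<Omega> (fst v))"
  "controlled_on \<Omega> (U_space \<Omega>) (U_norm \<Omega>) snd"
  "controlled_on \<Omega> (U_space \<Omega>) (U_norm \<Omega>) (\<lambda>v. wdiv \<Omega> (snd v))"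
  by (rule controlled_onI[of 1];
      simp add: U_space_D H1_L2 Hdiv_L2 U_norm_def induced_norm_def[of "l2ip \<Omega>"] L2.ip_nonneg)+

lemma controlled_Lop:
  assumes "controlled_on \<Omega> (U_space \<Omega>) p fst" "controlled_on \<Omega> (U_space \<Omega>) p (\<lambda>v. wgrad \<Omega> (fst v))"
    "controlled_on \<Omega> (U_space \<Omega>) p (\<lambda>v. wdiv \<Omega> (snd v))"
  shows "controlled_on \<Omega> (U_space \<Omega>) p (Lop \<Omega> \<beta> \<gamma>)"
  unfolding Lop_eq[abs_def]
  by (intro controlled_on_diff controlled_on_bounded_bilinear[OF bounded_\<gamma>]
      controlled_on_bounded_bilinear[OF bounded_\<beta>] assms)

lemma residual_bounded: "controlled_on \<Omega> (U_space \<Omega>) (U_norm \<Omega>) (residual k)"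
proof -
  have "controlled_on \<Omega> (U_space \<Omega>) (U_norm \<Omega>) (\<lambda>v. sqrt k *\<^sub>R step_residual k v)"
    unfolding step_residual_def
    by (intro controlled_on_scaleR controlled_on_add controlled_Lop controlled_by_U_norm)
  moreover have "controlled_on \<Omega> (U_space \<Omega>) (U_norm \<Omega>) (flux \<Omega> A)"
    unfolding flux_eq[abs_def] sqrt_grad_def[abs_def]
    by (intro controlled_on_diff controlled_on_bounded_bilinear[OF bounded_mat_sqrt]
        controlled_on_bounded_bilinear[OF bounded_mat_sqrt_inv] controlled_by_U_norm)
  ultimately show ?thesis unfolding residual_eq[abs_def] by (rule controlled_on_Pair)
qed

lemma L2_U_space:
  assumes "v \<in> U_space \<Omega>"
  shows "L2 \<Omega> (fst v)" "L2 \<Omega> (wgrad \<Omega> (fst v))" "L2 \<Omega> (snd v)" "L2 \<Omega> (wdiv \<Omega> (snd v))"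
    "L2 \<Omega> (Lop \<Omega> \<beta> \<gamma> v)" "L2 \<Omega> (sqrt_grad v)" "L2 \<Omega> (flux \<Omega> A v)" "L2 \<Omega> (step_residual k v)"
    "L2 \<Omega> (residual k v)"
proof -
  show v: "L2 \<Omega> (fst v)" "L2 \<Omega> (wgrad \<Omega> (fst v))" "L2 \<Omega> (snd v)" "L2 \<Omega> (wdiv \<Omega> (snd v))"
    using U_space_D[OF assms] by (simp_all add: H1_L2 Hdiv_L2)
  show Lop: "L2 \<Omega> (Lop \<Omega> \<beta> \<gamma> v)"
    unfolding Lop_eq
    by (intro L2_diff L2_Linf_bilinear[OF bounded_\<gamma>] L2_Linf_bilinear[OF bounded_\<beta>] v)
  show sqrt_grad: "L2 \<Omega> (sqrt_grad v)"
    unfolding sqrt_grad_def by (intro L2_Linf_bilinear[OF bounded_mat_sqrt] v)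
  show flux: "L2 \<Omega> (flux \<Omega> A v)"
    unfolding flux_eq by (intro L2_diff sqrt_grad L2_Linf_bilinear[OF bounded_mat_sqrt_inv] v)
  show M: "L2 \<Omega> (step_residual k v)"
    unfolding step_residual_def by (intro L2_add L2_scaleR v Lop)
  show "L2 \<Omega> (residual k v)"
    unfolding residual_eq by (intro L2_Pair L2_scaleR M flux)
qed

lemma residual_AE_linear:
  assumes V: "subspace V" "V \<subseteq> U_space \<Omega>"
  shows "AE_linear \<Omega> V (residual k)"
proof
  show "L2 \<Omega> (residual k v)" if "v \<in> V" for v using that V(2) by (intro L2_U_space) blast
  fix v w c assume "v \<in> V" "w \<in> V"
  then have "v \<in> U_space \<Omega>" "w \<in> U_space \<Omega>" using V(2) by auto
  note v = U_space_D[OF this(1)] and w = U_space_D[OF this(2)]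
  show "AE x in lebesgue_on \<Omega>. residual k (v + c *\<^sub>R w) x = residual k v x + c *\<^sub>R residual k w x"
    using wgrad_add_scaleR(2)[OF v(2) w(2), of c] wdiv_add_scaleR(2)[OF v(3) w(3), of c]
    by eventually_elim
      (simp add: residual_def step_residual_def Lop_def flux_def inner_add_right add_divide_distrib
        matrix_vector_right_distrib matrix_vector_mult_scaleR algebra_simps)
qed (rule V)

lemma B_form_eq:
  assumes k: "0 < k" and w: "w \<in> U_space \<Omega>" and v: "v \<in> U_space \<Omega>"
  shows "B_form \<Omega> A \<beta> \<gamma> k w v = l2ip \<Omega> (residual k w) (residual k v)"
proof -
  note L2 = L2_U_space[OF w] L2_U_space[OF v] L2_scaleR
  have "l2ip \<Omega> (residual k w) (residual k v)
      = k * l2ip \<Omega> (step_residual k w) (step_residual k v) + l2ip \<Omega> (flux \<Omega> A w) (flux \<Omega> A v)"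
    using k
    by (simp add: residual_eq l2ip_Pair L2.ip_scaleR_left L2.ip_scaleR_right L2
        del: scaleR_fun_apply)
  also have "k * l2ip \<Omega> (step_residual k w) (step_residual k v)
      = 1 / k * l2ip \<Omega> (fst w) (fst v) + l2ip \<Omega> (fst w) (Lop \<Omega> \<beta> \<gamma> v)
        + l2ip \<Omega> (Lop \<Omega> \<beta> \<gamma> w) (fst v) + k * l2ip \<Omega> (Lop \<Omega> \<beta> \<gamma> w) (Lop \<Omega> \<beta> \<gamma> v)"
    using k by (simp add: step_residual_def L2.ip_linear L2_add L2 algebra_simps)
  finally show ?thesis by (simp add: B_form_def b_form_def b_tilde_def)
qed

definition load :: "real \<Rightarrow> (real^'d \<Rightarrow> real) \<Rightarrow> (real^'d \<Rightarrow> real) \<Rightarrow> real^'d \<Rightarrow> real \<times> (real^'d)" where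
  "load k g w x = (sqrt k * (g x + w x / k), 0)"

lemma F_form_eq:
  assumes "0 < k"
  shows "F_form \<Omega> \<beta> \<gamma> k v g w = l2ip \<Omega> (load k g w) (residual k v)"
proof -
  have "k * ((g x + w x / k) \<bullet> (fst v x / k + Lop \<Omega> \<beta> \<gamma> v x)) = load k g w x \<bullet> residual k v x" for x
  proof -
    have "load k g w x \<bullet> residual k v x
        = (sqrt k * sqrt k) * ((g x + w x / k) * step_residual k v x)"
      by (simp add: load_def residual_def mult_ac)
    then show ?thesis using assms by (simp add: step_residual_def)
  qed
  then show ?thesis
    unfolding F_form_def l2ip_def by (simp only: integral_mult_right_zero[symmetric])
qed

lemma L2_load:
  assumes "L2 \<Omega> g" "L2 \<Omega> w"
  shows "L2 \<Omega> (load k g w)"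
proof -
  have "L2 \<Omega> (\<lambda>x. ((sqrt k *\<^sub>R (g + (1 / k) *\<^sub>R w)) x, (0 :: real^'d \<Rightarrow> real^'d) x))"
    by (intro L2_Pair L2_scaleR L2_add L2_zero assms)
  then show ?thesis by (simp add: load_def[abs_def])
qed

lemma Lop_tested:
  assumes v: "v \<in> U_space \<Omega>"
  shows "l2ip \<Omega> (Lop \<Omega> \<beta> \<gamma> v) (fst v)
    = l2ip \<Omega> (\<lambda>x. (q x / 2 + \<gamma> x) * fst v x) (fst v) + l2ip \<Omega> (snd v) (wgrad \<Omega> (fst v))"
proof -
  let ?u = "fst v" and ?G = "wgrad \<Omega> (fst v)" and ?s = "snd v" and ?d = "wdiv \<Omega> (snd v)"
  note L2 = L2_U_space[OF v]
  have \<beta>G: "L2 \<Omega> (\<lambda>x. \<beta> x \<bullet> ?G x)" and \<gamma>u: "L2 \<Omega> (\<lambda>x. \<gamma> x * ?u x)" and qu: "L2 \<Omega> (\<lambda>x. q x * ?u x)"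
    using L2 L2_Linf_bilinear[OF bounded_\<beta>] L2_Linf_bilinear[OF bounded_\<gamma>]
      L2_Linf_bilinear[OF bounded_q]
    by blast+
  have "(\<lambda>x. (q x / 2 + \<gamma> x) * ?u x) = (1 / 2) *\<^sub>R (\<lambda>x. q x * ?u x) + (\<lambda>x. \<gamma> x * ?u x)"
    by (simp add: fun_eq_iff algebra_simps)
  then have "l2ip \<Omega> (\<lambda>x. (q x / 2 + \<gamma> x) * ?u x) ?u
      = l2ip \<Omega> (\<lambda>x. q x * ?u x) ?u / 2 + l2ip \<Omega> (\<lambda>x. \<gamma> x * ?u x) ?u"
    by (simp add: L2.ip_linear qu \<gamma>u L2 L2_scaleR)
  moreover have "l2ip \<Omega> (Lop \<Omega> \<beta> \<gamma> v) ?u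
      = l2ip \<Omega> (\<lambda>x. \<gamma> x * ?u x) ?u - l2ip \<Omega> ?d ?u - l2ip \<Omega> (\<lambda>x. \<beta> x \<bullet> ?G x) ?u"
    by (simp add: Lop_eq L2.ip_linear \<beta>G \<gamma>u L2 L2_diff)
  ultimately show ?thesis
    using wdiv_Green[OF U_space_D(1,3)[OF v]]
      convection_Green[OF U_space_D(1)[OF v] Linf_\<beta> Linf_q div_\<beta>]
    by simp
qed

lemma flux_tested:
  assumes v: "v \<in> U_space \<Omega>"
  shows "l2ip \<Omega> (flux \<Omega> A v) (sqrt_grad v)
    = l2ip \<Omega> (sqrt_grad v) (sqrt_grad v) - l2ip \<Omega> (snd v) (wgrad \<Omega> (fst v))"
proof -
  let ?s = "\<lambda>x. matrix_inv (mat_sqrt (A x)) *v snd v x"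
  note L2 = L2_U_space[OF v]
  have s: "L2 \<Omega> ?s" by (intro L2_Linf_bilinear[OF bounded_mat_sqrt_inv] L2)
  have "l2ip \<Omega> ?s (sqrt_grad v) = l2ip \<Omega> (snd v) (wgrad \<Omega> (fst v))"
    unfolding l2ip_def
  proof (rule integral_cong_AE)
    show "AE x in lebesgue_on \<Omega>. ?s x \<bullet> sqrt_grad v x = snd v x \<bullet> wgrad \<Omega> (fst v) x"
      using mat_sqrt_AE by eventually_elim
        (simp add: sqrt_grad_def symmetric_matrix_inner[symmetric] matrix_inv_mult_vec)
  qed (use L2_integrable_inner s L2 in blast)+
  then show ?thesis
    by (simp add: flux_eq L2.ip_diff_left L2 s)
qed

lemma energy_identity:
  assumes "v \<in> U_space \<Omega>"
  shows "l2ip \<Omega> (step_residual k v) (fst v) + l2ip \<Omega> (flux \<Omega> A v) (sqrt_grad v)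
    = l2ip \<Omega> (fst v) (fst v) / k + l2ip \<Omega> (\<lambda>x. (q x / 2 + \<gamma> x) * fst v x) (fst v)
      + l2ip \<Omega> (sqrt_grad v) (sqrt_grad v)"
  using Lop_tested[OF assms] flux_tested[OF assms]
  by (simp add: step_residual_def L2.ip_linear L2_U_space[OF assms] L2_scaleR)

lemma residual_norm_ge:
  assumes "0 < k" "v \<in> U_space \<Omega>"
  shows "sqrt k * l2norm \<Omega> (step_residual k v) \<le> residual_norm k v"
    "l2norm \<Omega> (flux \<Omega> A v) \<le> residual_norm k v"
proof -
  note L2 = L2_U_space[OF assms(2)]
  have "l2norm \<Omega> (sqrt k *\<^sub>R step_residual k v) \<le> 1 * residual_norm k v"
    by (intro l2norm_dominated L2_scaleR L2 AE_I2)
      (simp_all add: residual_def norm_fst_le[of "sqrt k * _", simplified])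
  then show "sqrt k * l2norm \<Omega> (step_residual k v) \<le> residual_norm k v"
    using assms(1) by (simp add: L2.seminorm_scaleR L2)
  have "l2norm \<Omega> (flux \<Omega> A v) \<le> 1 * residual_norm k v"
    by (intro l2norm_dominated L2 AE_I2) (simp_all add: residual_def norm_snd_le)
  then show "l2norm \<Omega> (flux \<Omega> A v) \<le> residual_norm k v" by simp
qed

lemma energy_estimate:
  assumes k: "0 < k" and v: "v \<in> U_space \<Omega>"
  shows "l2norm \<Omega> (fst v) \<le> 2 * sqrt k * residual_norm k v"
    "l2norm \<Omega> (sqrt_grad v) \<le> 2 * residual_norm k v"
proof -
  let ?r = "residual_norm k v"
  let ?a = "l2norm \<Omega> (fst v) / sqrt k" and ?b = "l2norm \<Omega> (sqrt_grad v)"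
  note L2 = L2_U_space[OF v] and nonneg = L2.seminorm_nonneg[OF L2_U_space(1)[OF v]]
    L2.seminorm_nonneg[OF L2_U_space(6)[OF v]] L2.seminorm_nonneg[OF L2_U_space(9)[OF v]]
  have "0 \<le> l2ip \<Omega> (\<lambda>x. (q x / 2 + \<gamma> x) * fst v x) (fst v)"
    unfolding l2ip_def using reaction_nonneg
    by (intro integral_nonneg_AE) (auto elim!: eventually_mono simp: mult.assoc)
  then have "?a\<^sup>2 + ?b\<^sup>2 \<le> l2ip \<Omega> (step_residual k v) (fst v) + l2ip \<Omega> (flux \<Omega> A v) (sqrt_grad v)"
    using energy_identity[OF v, of k] k by (simp add: power_divide L2.seminorm_square L2)
  also have "\<dots> \<le> l2norm \<Omega> (step_residual k v) * l2norm \<Omega> (fst v) + l2norm \<Omega> (flux \<Omega> A v) * ?b"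
    using L2.Cauchy_Schwarz[OF L2(8) L2(1), of k] L2.Cauchy_Schwarz[OF L2(7) L2(6)] by linarith
  also have "\<dots> \<le> ?r / sqrt k * l2norm \<Omega> (fst v) + ?r * ?b"
    using residual_norm_ge[OF k v] k nonneg
    by (intro add_mono mult_right_mono) (simp_all add: field_simps)
  finally have "?a\<^sup>2 + ?b\<^sup>2 \<le> ?r * (?a + ?b)" by (simp add: algebra_simps)
  then have "?a \<le> 2 * ?r" "?b \<le> 2 * ?r"
    using sum_squares_le_imp_bounds[of ?a ?b ?r] nonneg k by simp_all
  then show "l2norm \<Omega> (fst v) \<le> 2 * sqrt k * ?r" "?b \<le> 2 * ?r"
    using k by (simp_all add: field_simps)
qed

lemma controlled_by_residual:
  assumes k: "0 < k"
  shows "controlled_on \<Omega> (U_space \<Omega>) (residual_norm k) fst"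
    "controlled_on \<Omega> (U_space \<Omega>) (residual_norm k) (\<lambda>v. wgrad \<Omega> (fst v))"
    "controlled_on \<Omega> (U_space \<Omega>) (residual_norm k) snd"
    "controlled_on \<Omega> (U_space \<Omega>) (residual_norm k) (\<lambda>v. wdiv \<Omega> (snd v))"
proof -
  let ?controlled = "\<lambda>f. controlled_on \<Omega> (U_space \<Omega>) (residual_norm k) f"
  show u: "?controlled fst"
    using k energy_estimate(1)[OF k] by (intro controlled_onI[of "2 * sqrt k"] L2_U_space) simp_all
  have sqrt_grad: "?controlled sqrt_grad"
    using energy_estimate(2)[OF k] by (intro controlled_onI[of 2] L2_U_space) simp_all
  have flux: "?controlled (flux \<Omega> A)"
    using residual_norm_ge(2)[OF k] by (intro controlled_onI[of 1] L2_U_space) simp_all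
  have step: "?controlled (step_residual k)"
    using residual_norm_ge(1)[OF k] k
    by (intro controlled_onI[of "1 / sqrt k"] L2_U_space) (simp_all add: field_simps)
  have grad_AE:
    "AE x in lebesgue_on \<Omega>. matrix_inv (mat_sqrt (A x)) *v sqrt_grad v x = wgrad \<Omega> (fst v) x" for v
    using mat_sqrt_AE by eventually_elim (simp add: sqrt_grad_def matrix_inv_mult_vec)
  show grad: "?controlled (\<lambda>v. wgrad \<Omega> (fst v))"
    by (rule controlled_on_cong_AE[OF
          controlled_on_bounded_bilinear[OF bounded_mat_sqrt_inv sqrt_grad]])
      (intro L2_U_space grad_AE | assumption)+
  have \<sigma>_AE: "AE x in lebesgue_on \<Omega>. mat_sqrt (A x) *v (sqrt_grad v - flux \<Omega> A v) x = snd v x" for v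
    using mat_sqrt_AE by eventually_elim (simp add: flux_eq matrix_inv_mult_vec)
  show "?controlled snd"
    by (rule controlled_on_cong_AE[OF controlled_on_bounded_bilinear[OF bounded_mat_sqrt
            controlled_on_diff[OF sqrt_grad flux]]]) (intro L2_U_space \<sigma>_AE | assumption)+
  have "wdiv \<Omega> (snd v) = (\<lambda>x. \<gamma> x * fst v x) - (\<lambda>x. \<beta> x \<bullet> wgrad \<Omega> (fst v) x)
      - (step_residual k v - (1 / k) *\<^sub>R fst v)" for v
    by (simp add: step_residual_def Lop_eq)
  then show "?controlled (\<lambda>v. wdiv \<Omega> (snd v))"
    by (simp only:) (intro controlled_on_diff controlled_on_scaleR u step
        controlled_on_bounded_bilinear[OF bounded_\<gamma> u]
        controlled_on_bounded_bilinear[OF bounded_\<beta> grad])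
qed

lemma U_norm_eq_l2norm:
  assumes "v \<in> U_space \<Omega>"
  shows "U_norm \<Omega> v = l2norm \<Omega> (\<lambda>x. ((fst v x, wgrad \<Omega> (fst v) x), (snd v x, wdiv \<Omega> (snd v) x)))"
  using L2_U_space[OF assms]
  by (simp add: U_norm_def induced_norm_def[of "l2ip \<Omega>"] l2ip_Pair L2_Pair)

lemma residual_coercive:
  assumes "0 < k"
  obtains C where "0 < C" "\<And>v. v \<in> U_space \<Omega> \<Longrightarrow> U_norm \<Omega> v \<le> C * residual_norm k v"
proof -
  have "controlled_on \<Omega> (U_space \<Omega>) (residual_norm k)
      (\<lambda>v x. ((fst v x, wgrad \<Omega> (fst v) x), (snd v x, wdiv \<Omega> (snd v) x)))"
    by (intro controlled_on_Pair controlled_by_residual assms)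
  then show thesis
    using that unfolding controlled_on_def by (auto simp: U_norm_eq_l2norm)
qed

lemma residual_complete:
  assumes k: "0 < k" and V: "closed_subspace_U \<Omega> V"
  shows "complete_wrt (residual_norm k) V"
proof -
  obtain C where C: "0 < C" "\<And>v. v \<in> U_space \<Omega> \<Longrightarrow> U_norm \<Omega> v \<le> C * residual_norm k v"
    using residual_coercive[OF k] by blast
  obtain C' where C': "\<And>v. v \<in> U_space \<Omega> \<Longrightarrow> residual_norm k v \<le> C' * U_norm \<Omega> v"
    using residual_bounded[of k] unfolding controlled_on_def by blast
  have diff: "v - w \<in> U_space \<Omega>" if "v \<in> V" "w \<in> V" for v w
    using closed_subspace_U_subspace[OF V] subspace_diff that by blast
  show ?thesis
    by (rule complete_wrt_equivalent[OF closed_subspace_U_complete[OF V] C(1), where C' = C'])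
      (intro C(2) C' L2.seminorm_nonneg L2_U_space diff | assumption)+
qed

definition step_solution ::
  "real \<Rightarrow> 'd Uelem set \<Rightarrow> (real^'d \<Rightarrow> real) \<Rightarrow> (real^'d \<Rightarrow> real) \<Rightarrow> 'd Uelem \<Rightarrow> bool" where
  "step_solution k V g w u \<longleftrightarrow>
    u \<in> V \<and> (\<forall>v\<in>V. B_form \<Omega> A \<beta> \<gamma> k u v = F_form \<Omega> \<beta> \<gamma> k v g w)"

lemma step_solution_exists:
  assumes k: "0 < k" and V: "closed_subspace_U \<Omega> V" and g: "L2 \<Omega> g" and w: "L2 \<Omega> w"
  obtains u where "step_solution k V g w u"
proof -
  note sub = closed_subspace_U_subspace[OF V]
  interpret R: AE_linear \<Omega> V "residual k" by (rule residual_AE_linear[OF sub])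
  define F where "F v = l2ip \<Omega> (load k g w) (residual k v)" for v
  have load: "L2 \<Omega> (load k g w)" by (rule L2_load[OF g w])
  have "F (u + c *\<^sub>R v) = F u + c * F v" if "u \<in> V" "v \<in> V" for u v c
  proof -
    have "F (u + c *\<^sub>R v) = l2ip \<Omega> (load k g w) (residual k u + c *\<^sub>R residual k v)"
      unfolding F_def using that
      by (intro l2ip_cong_AE load L2_add L2_scaleR R.L2_T) (auto simp: R.in_subspace R.T_add_scaleR)
    then show ?thesis by (simp add: F_def L2.ip_linear load R.L2_T that L2_scaleR)
  qed
  moreover have "\<bar>F v\<bar> \<le> l2norm \<Omega> (load k g w) * R.seminorm v" if "v \<in> V" for v
    unfolding F_def R.seminorm_eq by (rule L2.Cauchy_Schwarz[OF load R.L2_T[OF that]])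
  moreover have "complete_wrt R.seminorm V"
    using residual_complete[OF k V] by (simp add: R.seminorm_eq[abs_def])
  ultimately obtain u where u: "u \<in> V" "\<And>v. v \<in> V \<Longrightarrow> l2ip \<Omega> (residual k u) (residual k v) = F v"
    using R.Riesz_representation by blast
  then have "step_solution k V g w u"
    using sub(2) unfolding step_solution_def F_form_eq[OF k]
    by (metis B_form_eq[OF k] F_def subsetD)
  then show thesis by (rule that)
qed

lemma step_solution_unique:
  assumes k: "0 < k" and V: "closed_subspace_U \<Omega> V"
    and u: "step_solution k V g w u" and u': "step_solution k V g w u'"
  shows "U_eq \<Omega> u' u"
proof -
  note sub = closed_subspace_U_subspace[OF V]
  interpret R: AE_linear \<Omega> V "residual k" by (rule residual_AE_linear[OF sub])
  let ?z = "u' - u"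
  have V_mem: "u \<in> V" "u' \<in> V" "?z \<in> V" using u u' by (auto simp: step_solution_def)
  then have U: "u \<in> U_space \<Omega>" "u' \<in> U_space \<Omega>" "?z \<in> U_space \<Omega>" using sub(2) by auto
  have "l2ip \<Omega> (residual k u') (residual k ?z) = l2ip \<Omega> (residual k u) (residual k ?z)"
    using u u' V_mem U by (simp add: step_solution_def B_form_eq[OF k, symmetric])
  then have "l2ip \<Omega> (residual k ?z) (residual k ?z) = 0"
    using V_mem by (simp add: R.ip_diff_left)
  then have "residual_norm k ?z = 0" by (simp add: induced_norm_def)
  then have "controlled_on \<Omega> {?z} (\<lambda>_. 0) fst" "controlled_on \<Omega> {?z} (\<lambda>_. 0) snd"
    using controlled_by_residual(1,3)[OF k] U(3) unfolding controlled_on_def by auto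
  then have "l2norm \<Omega> (fst ?z) = 0" "l2norm \<Omega> (snd ?z) = 0"
    using L2.seminorm_nonneg[OF L2_U_space(1)[OF U(3)]]
      L2.seminorm_nonneg[OF L2_U_space(3)[OF U(3)]]
    by (auto simp: controlled_on_def)
  from l2norm_eq_0_AE[OF L2_U_space(1)[OF U(3)] this(1)]
    l2norm_eq_0_AE[OF L2_U_space(3)[OF U(3)] this(2)]
  show ?thesis unfolding U_eq_def by eventually_elim simp
qed

theorem time_stepping_well_posed:
  fixes k :: "nat \<Rightarrow> real" and V :: "nat \<Rightarrow> 'd Uelem set" and f :: "nat \<Rightarrow> real^'d \<Rightarrow> real"
  assumes k: "\<And>n. n \<in> {1..N} \<Longrightarrow> 0 < k n" and V: "\<And>n. n \<in> {1..N} \<Longrightarrow> closed_subspace_U \<Omega> (V n)"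
    and f: "\<And>n. n \<in> {1..N} \<Longrightarrow> L2 \<Omega> (f n)" and u0: "L2 \<Omega> u0"
  obtains u where "fst (u 0) = u0"
    "\<And>n. n \<in> {1..N} \<Longrightarrow> step_solution (k n) (V n) (f n) (fst (u (n - 1))) (u n)"
    "\<And>n u'. n \<in> {1..N} \<Longrightarrow> step_solution (k n) (V n) (f n) (fst (u (n - 1))) u' \<Longrightarrow> U_eq \<Omega> u' (u n)"
proof -
  let ?solves = "\<lambda>n u. step_solution (k (Suc n)) (V (Suc n)) (f (Suc n)) (fst u)"
  have step: "\<exists>u'. L2 \<Omega> (fst u') \<and> ?solves n u u'" if n: "n < N" and u: "L2 \<Omega> (fst u)" for n u
  proof -
    have n': "Suc n \<in> {1..N}" using n by simp
    obtain u' where u': "?solves n u u'"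
      using step_solution_exists[OF k[OF n'] V[OF n'] f[OF n'] u] by blast
    then have "u' \<in> U_space \<Omega>"
      using closed_subspace_U_subspace(2)[OF V[OF n']] by (auto simp: step_solution_def)
    then show ?thesis using u' L2_U_space(1) by blast
  qed
  have init: "L2 \<Omega> (fst (u0, 0 :: real^'d \<Rightarrow> real^'d))" using u0 by simp
  have "\<exists>u. u 0 = (u0, 0) \<and> (\<forall>n<N. ?solves n (u n) (u (Suc n)))"
    by (rule bounded_dependent_choice[where I = "\<lambda>u. L2 \<Omega> (fst u)", OF init step])
  then obtain u where u: "u 0 = (u0, 0)" "\<And>n. n < N \<Longrightarrow> ?solves n (u n) (u (Suc n))" by blast
  have sol: "step_solution (k n) (V n) (f n) (fst (u (n - 1))) (u n)" if "n \<in> {1..N}" for n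
    using u(2)[of "n - 1"] that by (cases n) simp_all
  show thesis
    using u(1) sol step_solution_unique[OF k V sol] by (intro that[of u]) simp_all
qed

end

theorem theorem2p1:
  fixes \<Omega> :: "(real^'d::finite) set"
    and A :: "real^'d \<Rightarrow> real^'d^'d" and \<beta> :: "real^'d \<Rightarrow> real^'d" and \<gamma> :: "real^'d \<Rightarrow> real"
    and \<alpha>0 :: real
    and N :: nat and T :: real and t :: "nat \<Rightarrow> real"
    and f :: "nat \<Rightarrow> real^'d \<Rightarrow> real" and u0 :: "real^'d \<Rightarrow> real"
    and Uh :: "nat \<Rightarrow> 'd Uelem set"
  assumes dom: "lipschitz_domain \<Omega>" "bounded \<Omega>" "polygonal_boundary \<Omega>"
    and A_Linf: "Linf \<Omega> A"
    and A_sym: "AE x in lebesgue_on \<Omega>. transpose (A x) = A x"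
    and alpha0: "\<alpha>0 > 0"
    and A_ell: "AE x in lebesgue_on \<Omega>. \<forall>c \<in> mat_eigenvalues (A x). c \<ge> \<alpha>0"
    and beta_Linf: "Linf \<Omega> \<beta>" and gamma_Linf: "Linf \<Omega> \<gamma>"
    and div_beta: "\<exists>q. Linf \<Omega> q \<and> is_weak_div \<Omega> \<beta> q \<and>
                     Linf \<Omega> (\<lambda>x. q x / 2 + \<gamma> x) \<and>
                     (AE x in lebesgue_on \<Omega>. q x / 2 + \<gamma> x \<ge> 0)"
    and part: "t 0 = 0" "t N = T" "\<And>n. n < N \<Longrightarrow> t n < t (Suc n)"
    and f_L2: "\<And>n. n \<in> {1..N} \<Longrightarrow> L2 \<Omega> (f n)"
    and u0_L2: "L2 \<Omega> u0"
    and Uh_cl: "\<And>n. n \<in> {1..N} \<Longrightarrow> closed_subspace_U \<Omega> (Uh n)"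
  shows "\<exists>uh :: nat \<Rightarrow> 'd Uelem. fst (uh 0) = u0 \<and>
     (\<forall>n \<in> {1..N}.
        uh n \<in> Uh n \<and>
        (\<forall>vh \<in> Uh n. B_form \<Omega> A \<beta> \<gamma> (t n - t (n - 1)) (uh n) vh
                       = F_form \<Omega> \<beta> \<gamma> (t n - t (n - 1)) vh (f n) (fst (uh (n - 1)))) \<and>
        (\<forall>wh \<in> Uh n. (\<forall>vh \<in> Uh n. B_form \<Omega> A \<beta> \<gamma> (t n - t (n - 1)) wh vh
                       = F_form \<Omega> \<beta> \<gamma> (t n - t (n - 1)) vh (f n) (fst (uh (n - 1))))
                     \<longrightarrow> U_eq \<Omega> wh (uh n)))"
proof -
  obtain q where q: "Linf \<Omega> q" "is_weak_div \<Omega> \<beta> q" "AE x in lebesgue_on \<Omega>. 0 \<le> q x / 2 + \<gamma> x"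
    using div_beta by blast
  have "AE x in lebesgue_on \<Omega>. elliptic \<alpha>0 (A x)"
    using A_sym A_ell by eventually_elim (simp add: elliptic_iff_eigenvalues_ge)
  then interpret convection_diffusion \<Omega> A \<beta> \<gamma> q \<alpha>0
    using dom A_Linf alpha0 beta_Linf gamma_Linf q
    by unfold_locales (auto simp: lipschitz_domain_def)
  have "0 < t n - t (n - 1)" if "n \<in> {1..N}" for n
    using part(3)[of "n - 1"] that by (cases n) simp_all
  then obtain uh where "fst (uh 0) = u0"
    "\<And>n. n \<in> {1..N} \<Longrightarrow> step_solution (t n - t (n - 1)) (Uh n) (f n) (fst (uh (n - 1))) (uh n)"
    "\<And>n wh. n \<in> {1..N} \<Longrightarrow> step_solution (t n - t (n - 1)) (Uh n) (f n) (fst (uh (n - 1))) wh \<Longrightarrow>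
      U_eq \<Omega> wh (uh n)"
    using time_stepping_well_posed[of N "\<lambda>n. t n - t (n - 1)" Uh f u0] Uh_cl f_L2 u0_L2 by blast
  then show ?thesis
    unfolding step_solution_def by blast
qed

end
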